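(* Let $n\ge2$. There exist constants $\delta>0$ and $c>0$, depending only on $n$, such that the following holds. Let $a\in L^n_\sigma(\mathbb{R}^n)$ satisfy $\int_{\mathbb{R}^n}(1+|x|)|a(x)|\,dx<\infty$ and $\|a\|_n\le\delta$, and let $u$ be the global mild solution of the Navier--Stokes equations without external force and with initial data $a$. Then, for all $t>0$, $$\|u(t)\|_2\le c\,\min\bigl\{\|a\|_2,\;K(a)\,t^{-(n+2)/4}\bigr\},$$ where $$K(a)=\int_{\mathbb{R}^n}|x|\,|a(x)|\,dx+J(a)^{4/(n+1)}\,\|a\|_2^{2(n-1)/(n+1)},$$ $$J(a)=\|a\|_1^{1/2}\Bigl(\int_{\mathbb{R}^n}|x|\,|a(x)|\,dx\Bigr)^{1/2}+\|a\|_{4n/(3+2n)}^2 .$$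
   Context: $\|\cdot\|_q$ is the $L^q(\mathbb{R}^n)$ norm; $L^n_\sigma(\mathbb{R}^n)$ is the closure in $L^n(\mathbb{R}^n)$ of the smooth compactly supported divergence-free vector fields; $e^{t\Delta}$ is the heat semigroup and $\mathbb{P}$ the Leray projection onto divergence-free fields. The Navier--Stokes equations without force are $\partial_tu-\Delta u+u\cdot\nabla u+\nabla\pi=0$, $\operatorname{div}u=0$, $u(\cdot,0)=a$ in $\mathbb{R}^n$. Their integral (mild) form is $$u(t)=e^{t\Delta}a-\int_0^te^{(t-s)\Delta}\mathbb{P}\nabla\cdot(u\otimes u)(s)\,ds,\qquad t>0,$$ where $e^{t\Delta}\mathbb{P}\nabla\cdot$ acting on tensors is the convolution operator with kernel components $F_{\ell k,j}(x,t)=\partial_\ell E_t(x)\delta_{jk}+\int_t^\infty\partial_\ell\partial_k\partial_jE_s(x)\,ds$, $E_t(x)=(4\pi t)^{-n/2}e^{-|x|^2/(4t)}$. The global mild solution meant here is Kato's solution: with $\|v\|_{X_{2n}}=\operatorname{ess\,sup}_{t>0}t^{1/4}\|v(t)\|_{2n}$ and $C_{2n,n}$ a constant depending only on $n$ such that $\|e^{t\Delta}b\|_{X_{2n}}\le C_{2n,n}\|b\|_n$ for all $b\in L^n(\mathbb{R}^n)$, it is the unique solution of the integral equation with $\|u\|_{X_{2n}}\le 2C_{2n,n}\|a\|_n$ (which exists when $\|a\|_n\le\delta$ with $\delta=\delta(n)$ small). It is the limit in the norm of $X_{2n}$ of the Picard iterates $u_0=e^{t\Delta}a$, $u_{k+1}(t)=e^{t\Delta}a-\int_0^te^{(t-s)\Delta}\mathbb{P}\nabla\cdot(u_k\otimes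 u_k)(s)\,ds$. *)

theory Defs
  imports "HOL-Analysis.Analysis" "HOL-Probability.Essential_Supremum"
begin

text \<open>
  Vector fields on $n$-dimensional space are functions on \<^typ>\<open>real ^ 'n\<close>, with $n$ the
  cardinality of the index type. Lebesgue norms and moments take values in \<^typ>\<open>ennreal\<close>, so
  that a norm is infinite (and not silently 0) when the integral diverges.
\<close>

text \<open>Only used for exponents \<open>p > 0\<close>.\<close>

definition ennreal_powr :: "ennreal \<Rightarrow> real \<Rightarrow> ennreal" (infixr "powr\<^sub>e" 80) where
  "x powr\<^sub>e p = (if x = top then top else ennreal (enn2real x powr p))"

definition Lq_norm :: "real \<Rightarrow> ('a::euclidean_space \<Rightarrow> 'b::euclidean_space) \<Rightarrow> ennreal" where
  "Lq_norm q f = (\<integral>\<^sup>+ x. ennreal (norm (f x) powr q) \<partial>lebesgue) powr\<^sub>e (1 / q)"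

definition Lq :: "real \<Rightarrow> ('a::euclidean_space \<Rightarrow> 'b::euclidean_space) set" where
  "Lq q = {f \<in> borel_measurable lebesgue. Lq_norm q f < top}"

definition partial_deriv ::
    "'n::finite \<Rightarrow> (real ^ 'n \<Rightarrow> 'b::real_normed_vector) \<Rightarrow> real ^ 'n \<Rightarrow> 'b" where
  "partial_deriv l f x = frechet_derivative f (at x) (axis l 1)"

text \<open>
  All iterated partial derivatives are (totally) differentiable everywhere; in particular they
  are all continuous, so this is the class of smooth functions.
\<close>

definition smooth :: "(real ^ 'n::finite \<Rightarrow> 'b::real_normed_vector) \<Rightarrow> bool" where
  "smooth f \<longleftrightarrow> (\<forall>ls. foldr partial_deriv ls f differentiable_on UNIV)"

definition divergence :: "(real ^ 'n::finite \<Rightarrow> real ^ 'n) \<Rightarrow> real ^ 'n \<Rightarrow> real" where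
  "divergence f x = (\<Sum>l\<in>UNIV. partial_deriv l (\<lambda>y. f y $ l) x)"

definition test_fields_sigma :: "(real ^ 'n::finite \<Rightarrow> real ^ 'n) set" where
  "test_fields_sigma =
     {\<phi>. smooth \<phi> \<and> compact (closure {x. \<phi> x \<noteq> 0}) \<and> (\<forall>x. divergence \<phi> x = 0)}"

definition Lq_sigma :: "real \<Rightarrow> (real ^ 'n::finite \<Rightarrow> real ^ 'n) set" where
  "Lq_sigma q =
     {a \<in> Lq q. \<forall>\<epsilon>>0. \<exists>\<phi>\<in>test_fields_sigma. Lq_norm q (\<lambda>x. a x - \<phi> x) < ennreal \<epsilon>}"

definition heat_kernel :: "real \<Rightarrow> real ^ 'n::finite \<Rightarrow> real" where
  "heat_kernel t x = (4 * pi * t) powr (- (real CARD('n) / 2)) * exp (- (norm x)\<^sup>2 / (4 * t))"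

definition heat_semigroup :: "real \<Rightarrow> (real ^ 'n::finite \<Rightarrow> real ^ 'n) \<Rightarrow> real ^ 'n \<Rightarrow> real ^ 'n" where
  "heat_semigroup t b x = (LINT y|lebesgue. heat_kernel t (x - y) *\<^sub>R b y)"

definition oseen_kernel :: "'n::finite \<Rightarrow> 'n \<Rightarrow> 'n \<Rightarrow> real ^ 'n \<Rightarrow> real \<Rightarrow> real" where
  "oseen_kernel l k j x t =
     partial_deriv l (heat_kernel t) x * (if j = k then 1 else 0)
     + (LINT s:{t<..}|lebesgue.
          partial_deriv l (partial_deriv k (partial_deriv j (heat_kernel s))) x)"

text \<open>\<open>heat_Leray_div t M\<close> is $e^{t\Delta}\mathbb{P}\nabla\cdot M$ for a tensor field \<open>M\<close>.\<close>

definition heat_Leray_div ::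
    "real \<Rightarrow> (real ^ 'n::finite \<Rightarrow> real ^ 'n ^ 'n) \<Rightarrow> real ^ 'n \<Rightarrow> real ^ 'n" where
  "heat_Leray_div t M x =
     (\<chi> j. \<Sum>l\<in>UNIV. \<Sum>k\<in>UNIV. LINT y|lebesgue. oseen_kernel l k j (x - y) t * M y $ l $ k)"

definition tensor :: "real ^ 'n::finite \<Rightarrow> real ^ 'n \<Rightarrow> real ^ 'n ^ 'n" where
  "tensor v w = (\<chi> l k. v $ l * w $ k)"

text \<open>Space-time fields are written \<open>u t x\<close>; only their values at times \<open>t > 0\<close> matter.\<close>

definition X_norm :: "(real \<Rightarrow> real ^ 'n::finite \<Rightarrow> real ^ 'n) \<Rightarrow> ennreal" where
  "X_norm v = esssup (lebesgue_on {0<..})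
     (\<lambda>t. ennreal (t powr (1 / 4)) * Lq_norm (2 * real CARD('n)) (v t))"

definition mild_solution ::
    "(real ^ 'n::finite \<Rightarrow> real ^ 'n) \<Rightarrow> (real \<Rightarrow> real ^ 'n \<Rightarrow> real ^ 'n) \<Rightarrow> bool" where
  "mild_solution a u \<longleftrightarrow>
     (\<lambda>(t, x). u t x) \<in> borel_measurable (lebesgue_on ({0<..} \<times> UNIV)) \<and>
     (\<forall>t>0. AE x in lebesgue.
        u t x = heat_semigroup t a x
          - (LINT s:{0<..<t}|lebesgue. heat_Leray_div (t - s) (\<lambda>y. tensor (u s y) (u s y)) x))"

definition heat_X_bound :: "'n::finite itself \<Rightarrow> real \<Rightarrow> bool" where
  "heat_X_bound _ C \<longleftrightarrow>
     (\<forall>b \<in> Lq (real CARD('n)) :: (real ^ 'n \<Rightarrow> real ^ 'n) set.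
        X_norm (\<lambda>t. heat_semigroup t b)
          \<le> ennreal C * Lq_norm (real CARD('n)) b)"

text \<open>\<open>C\<close> is meant to be a constant with \<open>heat_X_bound\<close>.\<close>

definition kato_solution ::
    "real \<Rightarrow> (real ^ 'n::finite \<Rightarrow> real ^ 'n) \<Rightarrow> (real \<Rightarrow> real ^ 'n \<Rightarrow> real ^ 'n) \<Rightarrow> bool" where
  "kato_solution C a u \<longleftrightarrow>
     mild_solution a u \<and>
     X_norm u \<le> 2 * ennreal C * Lq_norm (real CARD('n)) a"

definition first_moment :: "(real ^ 'n::finite \<Rightarrow> real ^ 'n) \<Rightarrow> ennreal" where
  "first_moment a = (\<integral>\<^sup>+ x. ennreal (norm x * norm (a x)) \<partial>lebesgue)"

definition J :: "(real ^ 'n::finite \<Rightarrow> real ^ 'n) \<Rightarrow> ennreal" where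
  "J a = Lq_norm 1 a powr\<^sub>e (1 / 2) * first_moment a powr\<^sub>e (1 / 2)
     + (Lq_norm (4 * real CARD('n) / (3 + 2 * real CARD('n))) a)\<^sup>2"

definition K :: "(real ^ 'n::finite \<Rightarrow> real ^ 'n) \<Rightarrow> ennreal" where
  "K a = first_moment a
     + J a powr\<^sub>e (4 / (real CARD('n) + 1))
       * Lq_norm 2 a powr\<^sub>e (2 * (real CARD('n) - 1) / (real CARD('n) + 1))"

end

(*
  Pointwise, |u| <= |e^{t Laplace} a| + T(|u|,|u|), where T is the bilinear operator with a
  positive kernel dominating the Oseen kernel; all estimates are made for this majorant equation,
  with integrals of nonnegative functions only. Since t^{1/4} ||u(t)||_{2n} is small, f -> T(|u|,f) is
  a contraction for sup_t t^b ||f(t)||_2 with 0 <= b < 3/4, which gives ||u(t)||_2 <= c ||a||_2 and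
  ||u(t)||_2 <= c ||a||_{q} t^{-3/8} for q = 4n/(3+2n).
  For the faster rates the Duhamel integral is split at t/2: on (0,t/2) the L^1-L^2 bound of the kernel
  gives c t^{-(n+2)/4} times the integral of ||u(s)||_2^2, and on (t/2,t) the integral is absorbed.
  The mean of a vanishes, so e^{t Laplace} a decays in L^2 like t^{-(n+2)/4} times the first moment.
  The t^{-3/8} bound thus improves to J(a) t^{-(n+1)/4}; then ||u(s)||_2 <= c min(||a||_2, J(a) s^{-(n+1)/4})
  is square integrable in time, with the second summand of K(a) as bound, and one more application
  of the splitting gives the rate t^{-(n+2)/4}.
*)

theory Submission
  imports Defs "HOL-Probability.Distributions"
begin

section \<open>Powers of extended nonnegative reals\<close>

text \<open>Why these rates occur. The kernel bound (t-s)^(-3/4) and the bound s^(-1/4) of the L^2n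
  norm have total exponent -1, so the bilinear operator keeps a weight t^(-b). But s^(-1/4-b) is
  integrable at 0 only for b < 3/4, while the rates (n+1)/4 and (n+2)/4 are at least 3/4:
  contraction alone cannot reach them. After the split at t/2 the function ||u(s)||_2^2 must be
  integrable down to s = 0, and q = 4n/(3+2n) is chosen for this: n/2 (1/q - 1/2) = 3/8, the square
  s^(-3/4) has the integral 4 t^(1/4), and t^(-(n+2)/4) t^(1/4) = t^(-(n+1)/4). The linear part
  reaches the same rate as the geometric mean of its bounds ||a||_1 t^(-n/4) and t^(-(n+2)/4) times
  the first moment. These two contributions are the summands of J(a). Since 2(n+1)/4 > 1, the square
  of min(||a||_2, J s^(-(n+1)/4)) is integrable at infinity, and its integral is a multiple of
  J^(4/(n+1)) ||a||_2^(2(n-1)/(n+1)), the second summand of K(a).\<close>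

lemma ennreal_powr_ennreal [simp]: "0 \<le> x \<Longrightarrow> ennreal x powr\<^sub>e p = ennreal (x powr p)"
  by (simp add: ennreal_powr_def)

lemma ennreal_powr_top [simp]: "top powr\<^sub>e p = top"
  by (simp add: ennreal_powr_def)

lemma ennreal_powr_0 [simp]: "0 powr\<^sub>e p = 0"
  by (simp add: ennreal_powr_def)

lemma ennreal_powr_one [simp]: "x powr\<^sub>e 1 = x"
  by (cases x) (auto simp: ennreal_powr_def)

lemma ennreal_powr_eq_0_iff [simp]: "x powr\<^sub>e p = 0 \<longleftrightarrow> x = 0"
  by (cases x) (auto simp: ennreal_powr_def)

lemma ennreal_powr_eq_top_iff [simp]: "x powr\<^sub>e p = top \<longleftrightarrow> x = top"
  by (cases x) (auto simp: ennreal_powr_def)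

lemma ennreal_powr_mono: "x \<le> y \<Longrightarrow> 0 \<le> p \<Longrightarrow> x powr\<^sub>e p \<le> y powr\<^sub>e p"
  by (cases x; cases y) (auto simp: ennreal_powr_def top_unique intro!: ennreal_leI powr_mono2)

lemma ennreal_powr_mult: "0 < p \<Longrightarrow> (x * y) powr\<^sub>e p = x powr\<^sub>e p * y powr\<^sub>e p"
  by (cases x; cases y)
     (auto simp: ennreal_mult[symmetric] powr_mult ennreal_top_mult ennreal_mult_top)

lemma ennreal_powr_powr: "(x powr\<^sub>e p) powr\<^sub>e r = x powr\<^sub>e (p * r)"
  by (cases x) (auto simp: powr_powr)

lemma ennreal_powr_add: "x powr\<^sub>e (p + r) = x powr\<^sub>e p * x powr\<^sub>e r"
  by (cases x) (auto simp: ennreal_mult[symmetric] powr_add)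

lemma ennreal_powr_two: "x powr\<^sub>e 2 = x\<^sup>2"
  using ennreal_powr_add[of x 1 1] by (simp add: power2_eq_square)

lemma measurable_ennreal_powr [measurable]:
  assumes [measurable]: "f \<in> borel_measurable M"
  shows "(\<lambda>x. f x powr\<^sub>e p) \<in> borel_measurable M"
  unfolding ennreal_powr_def by measurable

section \<open>Hoelder, Minkowski and Young inequalities for nonnegative integrals\<close>

lemma ennreal_Young:
  assumes "0 < \<alpha>" "0 < \<beta>" "\<alpha> + \<beta> = 1"
  shows "a powr\<^sub>e \<alpha> * b powr\<^sub>e \<beta> \<le> ennreal \<alpha> * a + ennreal \<beta> * b"
proof (cases "a = 0 \<or> b = 0 \<or> a = top \<or> b = top")
  case True
  then show ?thesis using assms by (auto simp: ennreal_mult_top)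
next
  case False
  then obtain x y where "a = ennreal x" "b = ennreal y" "x > 0" "y > 0"
    by (cases a; cases b) (auto simp: less_le)
  then show ?thesis using Youngs_inequality_0[of \<alpha> \<beta> x y] assms
    by (simp add: ennreal_mult[symmetric] ennreal_plus[symmetric] del: ennreal_plus)
qed

text \<open>After division of f and g by their integrals, Young's inequality holds pointwise and
  integrates to the constant \<alpha> + \<beta> = 1. Integrals equal to 0 or top cannot be divided
  out and are treated separately. Powers sit on the integrands, and not roots on the norms, so that
  the inequality can be iterated.\<close>

lemma nn_integral_Hoelder:
  assumes [measurable]: "f \<in> borel_measurable M" "g \<in> borel_measurable M"
    and ab: "0 < \<alpha>" "0 < \<beta>" "\<alpha> + \<beta> = 1"
  shows "(\<integral>\<^sup>+x. f x powr\<^sub>e \<alpha> * g x powr\<^sub>e \<beta> \<partial>M) \<le> (\<integral>\<^sup>+x. f x \<partial>M) powr\<^sub>e \<alpha> * (\<integral>\<^sup>+x. g x \<partial>M) powr\<^sub>e \<beta>"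
proof -
  define A where "A = (\<integral>\<^sup>+x. f x \<partial>M)"
  define B where "B = (\<integral>\<^sup>+x. g x \<partial>M)"
  show ?thesis
  proof (cases "A = 0 \<or> B = 0")
    case True
    then have "(AE x in M. f x = 0) \<or> (AE x in M. g x = 0)"
      unfolding A_def B_def by (simp add: nn_integral_0_iff_AE)
    then have "AE x in M. f x powr\<^sub>e \<alpha> * g x powr\<^sub>e \<beta> = 0" by auto
    then have "(\<integral>\<^sup>+x. f x powr\<^sub>e \<alpha> * g x powr\<^sub>e \<beta> \<partial>M) = 0"
      by (simp add: nn_integral_0_iff_AE)
    then show ?thesis by simp
  next
    case F: False
    show ?thesis
    proof (cases "A = top \<or> B = top")
      case True
      then have "A powr\<^sub>e \<alpha> * B powr\<^sub>e \<beta> = top"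
        using F by (auto simp: ennreal_top_mult ennreal_mult_top)
      then show ?thesis by (simp add: A_def B_def)
    next
      case False
      then obtain x y where xy: "A = ennreal x" "B = ennreal y" "x > 0" "y > 0"
        using F by (cases A; cases B) (auto simp: less_le)
      let ?b = "\<lambda>z. A powr\<^sub>e \<alpha> * B powr\<^sub>e \<beta> * (ennreal \<alpha> * (ennreal (1/x) * f z) + ennreal \<beta> * (ennreal (1/y) * g z))"
      have 1: "f z = A * (ennreal (1/x) * f z)" "g z = B * (ennreal (1/y) * g z)" for z
        using xy by (auto simp: mult.assoc[symmetric] ennreal_mult[symmetric])
      have "f z powr\<^sub>e \<alpha> * g z powr\<^sub>e \<beta> \<le> ?b z" for z
      proof -
        have "f z powr\<^sub>e \<alpha> * g z powr\<^sub>e \<beta> = A powr\<^sub>e \<alpha> * B powr\<^sub>e \<beta> *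
          ((ennreal (1/x) * f z) powr\<^sub>e \<alpha> * (ennreal (1/y) * g z) powr\<^sub>e \<beta>)"
          using ennreal_powr_mult[OF ab(1), of A "ennreal (1/x) * f z"] ennreal_powr_mult[OF ab(2), of B "ennreal (1/y) * g z"]
          unfolding 1(1)[symmetric] 1(2)[symmetric] by (simp only: mult_ac)
        also have "\<dots> \<le> ?b z"
          using ab by (intro mult_left_mono ennreal_Young) auto
        finally show ?thesis .
      qed
      then have "(\<integral>\<^sup>+x. f x powr\<^sub>e \<alpha> * g x powr\<^sub>e \<beta> \<partial>M) \<le> (\<integral>\<^sup>+z. ?b z \<partial>M)"
        by (intro nn_integral_mono)
      also have "\<dots> = A powr\<^sub>e \<alpha> * B powr\<^sub>e \<beta> *
          (ennreal \<alpha> * (ennreal (1/x) * A) + ennreal \<beta> * (ennreal (1/y) * B))"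
        unfolding A_def B_def by (simp add: nn_integral_cmult nn_integral_add)
      also have "ennreal \<alpha> * (ennreal (1/x) * A) + ennreal \<beta> * (ennreal (1/y) * B) = 1"
        using xy ab by (simp add: ennreal_mult[symmetric] ennreal_plus[symmetric] del: ennreal_plus)
      finally show ?thesis by (simp add: A_def B_def)
    qed
  qed
qed

text \<open>The last two factors are merged into one function with the relative weights \<beta> /
  (\<beta> + \<gamma>) and \<gamma> / (\<beta> + \<gamma>), and the two-factor inequality is applied
  twice.\<close>

lemma nn_integral_Hoelder3:
  assumes [measurable]: "f \<in> borel_measurable M" "g \<in> borel_measurable M" "h \<in> borel_measurable M"
    and ab: "0 < \<alpha>" "0 < \<beta>" "0 < \<gamma>" "\<alpha> + \<beta> + \<gamma> = 1"
  shows "(\<integral>\<^sup>+x. f x powr\<^sub>e \<alpha> * g x powr\<^sub>e \<beta> * h x powr\<^sub>e \<gamma> \<partial>M)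
    \<le> (\<integral>\<^sup>+x. f x \<partial>M) powr\<^sub>e \<alpha> * (\<integral>\<^sup>+x. g x \<partial>M) powr\<^sub>e \<beta> * (\<integral>\<^sup>+x. h x \<partial>M) powr\<^sub>e \<gamma>"
proof -
  let ?I = "nn_integral M"
  let ?k = "\<lambda>x. g x powr\<^sub>e (\<beta> / (\<beta> + \<gamma>)) * h x powr\<^sub>e (\<gamma> / (\<beta> + \<gamma>))"
  have e: "?k x powr\<^sub>e (\<beta> + \<gamma>) = g x powr\<^sub>e \<beta> * h x powr\<^sub>e \<gamma>" for x
    using ab by (simp add: ennreal_powr_mult ennreal_powr_powr)
  have "(\<integral>\<^sup>+x. f x powr\<^sub>e \<alpha> * g x powr\<^sub>e \<beta> * h x powr\<^sub>e \<gamma> \<partial>M) = (\<integral>\<^sup>+x. f x powr\<^sub>e \<alpha> * ?k x powr\<^sub>e (\<beta> + \<gamma>) \<partial>M)"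
    unfolding e by (simp add: mult.assoc)
  also have "\<dots> \<le> ?I f powr\<^sub>e \<alpha> * (\<integral>\<^sup>+x. ?k x \<partial>M) powr\<^sub>e (\<beta> + \<gamma>)"
    using ab by (intro nn_integral_Hoelder) auto
  also have "\<dots> \<le> ?I f powr\<^sub>e \<alpha> *
      (?I g powr\<^sub>e (\<beta> / (\<beta> + \<gamma>)) * ?I h powr\<^sub>e (\<gamma> / (\<beta> + \<gamma>))) powr\<^sub>e (\<beta> + \<gamma>)"
    using ab by (intro mult_left_mono ennreal_powr_mono nn_integral_Hoelder)
       (auto simp: add_divide_distrib[symmetric])
  also have "\<dots> = ?I f powr\<^sub>e \<alpha> * ?I g powr\<^sub>e \<beta> * ?I h powr\<^sub>e \<gamma>"
    using ab by (simp add: ennreal_powr_mult ennreal_powr_powr mult.assoc)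
  finally show ?thesis .
qed

text \<open>The majorants are integrals of nonnegative functions and may take the value top, so the
  norm has to act on extended nonnegative functions; \<open>Lq_norm\<close> is the special case of
  the function norm (f x).\<close>

definition nn_norm :: "'a measure \<Rightarrow> real \<Rightarrow> ('a \<Rightarrow> ennreal) \<Rightarrow> ennreal" where
  "nn_norm M q f = (\<integral>\<^sup>+x. f x powr\<^sub>e q \<partial>M) powr\<^sub>e (1 / q)"

lemma nn_norm_mono_AE: "0 < q \<Longrightarrow> AE x in M. f x \<le> g x \<Longrightarrow> nn_norm M q f \<le> nn_norm M q g"
  unfolding nn_norm_def
  by (intro ennreal_powr_mono nn_integral_mono_AE) (auto elim!: eventually_mono intro: ennreal_powr_mono)

lemma nn_norm_mono: "0 < q \<Longrightarrow> (\<And>x. f x \<le> g x) \<Longrightarrow> nn_norm M q f \<le> nn_norm M q g"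
  by (rule nn_norm_mono_AE) auto

lemma nn_norm_cong_AE: "AE x in M. f x = g x \<Longrightarrow> nn_norm M q f = nn_norm M q g"
  unfolding nn_norm_def by (intro arg_cong[where f="\<lambda>x. x powr\<^sub>e _"] nn_integral_cong_AE) auto

lemma nn_norm_cmult:
  "0 < q \<Longrightarrow> f \<in> borel_measurable M \<Longrightarrow> nn_norm M q (\<lambda>x. c * f x) = c * nn_norm M q f"
  unfolding nn_norm_def by (simp add: ennreal_powr_mult nn_integral_cmult ennreal_powr_powr)

lemma nn_norm_powr: "0 < q \<Longrightarrow> nn_norm M q f powr\<^sub>e q = (\<integral>\<^sup>+x. f x powr\<^sub>e q \<partial>M)"
  by (simp add: nn_norm_def ennreal_powr_powr)

lemma nn_norm_1: "nn_norm M 1 f = (\<integral>\<^sup>+x. f x \<partial>M)"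
  by (simp add: nn_norm_def)

lemma nn_norm_2_squared: "(nn_norm M 2 f)\<^sup>2 = (\<integral>\<^sup>+x. (f x)\<^sup>2 \<partial>M)"
  using nn_norm_powr[of 2 M f] by (simp add: ennreal_powr_two)

lemma nn_norm_eq_0_imp_AE:
  "0 < q \<Longrightarrow> f \<in> borel_measurable M \<Longrightarrow> nn_norm M q f = 0 \<Longrightarrow> AE x in M. f x = 0"
  by (simp add: nn_norm_def nn_integral_0_iff_AE)

lemma measurable_nn_norm [measurable (raw)]:
  assumes "sigma_finite_measure M" "case_prod f \<in> borel_measurable (N \<Otimes>\<^sub>M M)"
  shows "(\<lambda>s. nn_norm M q (f s)) \<in> borel_measurable N"
proof -
  have [measurable]: "(\<lambda>x. case_prod f x) \<in> borel_measurable (N \<Otimes>\<^sub>M M)" using assms(2) by simp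
  have "(\<lambda>s. \<integral>\<^sup>+x. f s x powr\<^sub>e q \<partial>M) \<in> borel_measurable N"
    by (intro sigma_finite_measure.borel_measurable_nn_integral[OF assms(1)]) measurable
  then show ?thesis unfolding nn_norm_def by measurable
qed

text \<open>No duality is involved. With w(s) the norm of f(s), Hoelder in s applied to f = (f^q
  w^(1-q))^(1/q) w^(1-1/q) bounds (integral of f ds)^q by W^(q-1) times the integral of f^q w^(1-q)
  ds. Integration in x turns f^q into w^q, so that the last integral becomes at most W.\<close>

lemma Minkowski_integral:
  assumes M: "sigma_finite_measure M" and N: "sigma_finite_measure N"
    and f: "case_prod f \<in> borel_measurable (N \<Otimes>\<^sub>M M)" and q: "1 \<le> q"
  shows "nn_norm M q (\<lambda>x. \<integral>\<^sup>+s. f s x \<partial>N) \<le> (\<integral>\<^sup>+s. nn_norm M q (f s) \<partial>N)"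
proof -
  interpret N: sigma_finite_measure N by fact
  interpret M: sigma_finite_measure M by fact
  interpret P: pair_sigma_finite N M ..
  have f1[measurable]: "(\<lambda>x. f (fst x) (snd x)) \<in> borel_measurable (N \<Otimes>\<^sub>M M)"
    using f by (simp add: split_def)
  have fs[measurable]: "f s \<in> borel_measurable M" if "s \<in> space N" for s
    using measurable_compose[OF measurable_Pair1'[OF that] f] by simp
  have f2[measurable]: "(\<lambda>x. f (snd x) (fst x)) \<in> borel_measurable (M \<Otimes>\<^sub>M N)"
    using measurable_compose[OF measurable_pair_swap' f1] by (simp add: split_def)
  define w where "w s = nn_norm M q (f s)" for s
  have w[measurable]: "w \<in> borel_measurable N"
    unfolding w_def by (rule measurable_nn_norm) (use M f in auto)
  let ?h = "\<lambda>s x. f s x powr\<^sub>e q * inverse (w s) powr\<^sub>e (q - 1)"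
  let ?b = "\<lambda>s x. ?h s x powr\<^sub>e (1/q) * w s powr\<^sub>e (1 - 1/q)"
  define W where "W = (\<integral>\<^sup>+s. w s \<partial>N)"
  show ?thesis
  proof (cases "q = 1")
    case True
    then show ?thesis by (simp add: nn_norm_1 P.Fubini' f)
  next
    case False
    then have q1: "q > 1" using q by simp
    show ?thesis
    proof (cases "W = top")
      case True then show ?thesis by (simp add: W_def w_def)
    next
      case W: False
      have wfin: "AE s in N. w s \<noteq> top"
        using W nn_integral_PInf_AE[OF w] unfolding W_def by auto
      \<comment> \<open>Where w s = 0 the weight \<open>inverse (w s)\<close> is top and the
        factorisation of f breaks down, but f s then vanishes almost everywhere.\<close>
      have "AE s in N. AE x in M. f s x \<le> ?b s x"
      proof -
        have "AE x in M. f s x \<le> ?b s x"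
          if s: "s \<in> space N" "w s \<noteq> top" for s
        proof (cases "w s = 0")
          case True
          then have "AE x in M. f s x = 0" unfolding w_def using q1 s by (intro nn_norm_eq_0_imp_AE) auto
          then show ?thesis by eventually_elim auto
        next
          case False
          then obtain r where r: "w s = ennreal r" "r > 0" using s by (cases "w s") (auto simp: less_le)
          have "(inverse (w s) powr\<^sub>e (q - 1)) powr\<^sub>e (1/q) * w s powr\<^sub>e (1 - 1/q) = 1"
          proof -
            have e: "(q - 1) * (1/q) = 1 - 1/q" using q1 by (simp add: field_simps)
            have "inverse (w s) = ennreal (1/r)" using r by (simp add: inverse_ennreal inverse_eq_divide)
            then show ?thesis using r q1 unfolding ennreal_powr_powr e
              by (simp add: ennreal_mult[symmetric] powr_mult[symmetric])
          qed
          then have "?b s x = f s x" for x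
            using q1 by (simp add: ennreal_powr_mult ennreal_powr_powr mult.assoc)
          then show ?thesis by simp
        qed
        then show ?thesis using wfin by auto
      qed
      \<comment> \<open>Hoelder is to be applied in s for fixed x, so the exceptional null sets must
        change their order.\<close>
      then have "AE x in M. AE s in N. f s x \<le> ?b s x"
        by (subst P.AE_commute[symmetric]) auto
      then have "AE x in M. (\<integral>\<^sup>+s. f s x \<partial>N) powr\<^sub>e q \<le>
          (\<integral>\<^sup>+s. ?h s x \<partial>N) * W powr\<^sub>e (q - 1)"
      proof (rule AE_mp, intro AE_I2 impI)
        fix x assume x: "x \<in> space M"
        have [measurable]: "(\<lambda>s. f s x) \<in> borel_measurable N"
          using measurable_compose[OF measurable_Pair2'[OF x] f] by simp
        assume "AE s in N. f s x \<le> ?b s x"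
        then have "(\<integral>\<^sup>+s. f s x \<partial>N) \<le> (\<integral>\<^sup>+s. ?b s x \<partial>N)"
          by (rule nn_integral_mono_AE)
        also have "\<dots> \<le> (\<integral>\<^sup>+s. ?h s x \<partial>N) powr\<^sub>e (1/q) * W powr\<^sub>e (1 - 1/q)"
          unfolding W_def using q1 by (intro nn_integral_Hoelder) auto
        finally have "(\<integral>\<^sup>+s. f s x \<partial>N) powr\<^sub>e q \<le> \<dots> powr\<^sub>e q" using q1 by (intro ennreal_powr_mono) auto
        also have "\<dots> = (\<integral>\<^sup>+s. ?h s x \<partial>N) * W powr\<^sub>e (q - 1)"
          using q1 by (simp add: ennreal_powr_mult ennreal_powr_powr left_diff_distrib)
        finally show "(\<integral>\<^sup>+s. f s x \<partial>N) powr\<^sub>e q \<le> \<dots>" .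
      qed
      then have "(\<integral>\<^sup>+x. (\<integral>\<^sup>+s. f s x \<partial>N) powr\<^sub>e q \<partial>M) \<le> (\<integral>\<^sup>+x.
          (\<integral>\<^sup>+s. ?h s x \<partial>N) * W powr\<^sub>e (q - 1) \<partial>M)"
        by (rule nn_integral_mono_AE)
      also have "\<dots> = (\<integral>\<^sup>+x. (\<integral>\<^sup>+s. ?h s x \<partial>N) \<partial>M) * W powr\<^sub>e (q - 1)"
        by (rule nn_integral_multc) measurable
      also have "(\<integral>\<^sup>+x. (\<integral>\<^sup>+s. ?h s x \<partial>N) \<partial>M)
         = (\<integral>\<^sup>+s. (\<integral>\<^sup>+x. ?h s x \<partial>M) \<partial>N)"
        by (rule P.Fubini') (simp add: split_def)
      also have "\<dots> = (\<integral>\<^sup>+s. w s powr\<^sub>e q * inverse (w s) powr\<^sub>e (q - 1) \<partial>N)"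
        by (intro nn_integral_cong) (subst nn_integral_multc, use q1 in \<open>auto simp: w_def nn_norm_powr\<close>)
      also have "\<dots> \<le> W"
        unfolding W_def
      proof (rule nn_integral_mono_AE, use wfin in eventually_elim)
        fix s assume s: "w s \<noteq> top"
        show "w s powr\<^sub>e q * inverse (w s) powr\<^sub>e (q - 1) \<le> w s"
        proof (cases "w s = 0")
          case False
          then obtain r where r: "w s = ennreal r" "r > 0" using s by (cases "w s") (auto simp: less_le)
          have "w s powr\<^sub>e (1 + (q - 1)) * inverse (w s) powr\<^sub>e (q - 1) = w s"
            using r by (simp only: ennreal_powr_add) (simp add: inverse_ennreal ennreal_mult[symmetric] powr_mult[symmetric] mult.assoc)
          then show ?thesis by simp
        qed auto
      qed
      finally have "(\<integral>\<^sup>+x. (\<integral>\<^sup>+s. f s x \<partial>N) powr\<^sub>e q \<partial>M) \<le> W powr\<^sub>e 1 * W powr\<^sub>e (q - 1)"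
        by (simp add: mult_right_mono)
      also have "\<dots> = W powr\<^sub>e q" by (subst ennreal_powr_add[symmetric]) simp
      finally have "nn_norm M q (\<lambda>x. \<integral>\<^sup>+s. f s x \<partial>N) \<le> (W powr\<^sub>e q) powr\<^sub>e (1/q)"
        unfolding nn_norm_def using q1 by (intro ennreal_powr_mono) auto
      then show ?thesis using q1 by (simp add: ennreal_powr_powr W_def w_def)
    qed
  qed
qed

text \<open>Minkowski's integral inequality with the counting measure on the naturals as outer
  measure; \<open>nn_norm_add\<close> takes the counting measure on \<open>bool\<close>.\<close>

lemma nn_norm_suminf:
  assumes M: "sigma_finite_measure M" and f: "\<And>i::nat. f i \<in> borel_measurable M" and q: "1 \<le> q"
  shows "nn_norm M q (\<lambda>x. \<Sum>i. f i x) \<le> (\<Sum>i. nn_norm M q (f i))"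
proof -
  have "case_prod f \<in> borel_measurable (count_space UNIV \<Otimes>\<^sub>M M)"
    by (rule measurable_pair_measure_countable1) (use f in auto)
  from Minkowski_integral[OF M sigma_finite_measure_count_space this q]
  show ?thesis by (simp add: nn_integral_count_space_nat)
qed

lemma nn_norm_add:
  assumes M: "sigma_finite_measure M" and f: "f \<in> borel_measurable M" "g \<in> borel_measurable M" and q: "1 \<le> q"
  shows "nn_norm M q (\<lambda>x. f x + g x) \<le> nn_norm M q f + nn_norm M q g"
proof -
  have "case_prod (\<lambda>b. if b then f else g) \<in> borel_measurable (count_space UNIV \<Otimes>\<^sub>M M)"
    by (rule measurable_pair_measure_countable1) (use f in auto)
  from Minkowski_integral[OF M sigma_finite_measure_count_space this q]
  show ?thesis by (simp add: nn_integral_count_space_finite UNIV_bool add.commute)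
qed

lemma nn_norm_mult:
  assumes [measurable]: "f \<in> borel_measurable M" "g \<in> borel_measurable M"
    and e: "0 < q" "0 < r" "1 / p = 1 / q + 1 / r"
  shows "nn_norm M p (\<lambda>x. f x * g x) \<le> nn_norm M q f * nn_norm M r g"
proof -
  have p: "p > 0" "p / q > 0" "p / r > 0" "p / q + p / r = 1"
  proof -
    have "1 / p > 0" using e by (simp add: add_pos_pos)
    then show p: "p > 0" by simp
    have "p / q + p / r = p * (1 / q + 1 / r)" by (simp add: field_simps)
    also have "\<dots> = 1" using p by (simp add: e(3)[symmetric])
    finally show "p / q + p / r = 1" .
    show "p / q > 0" "p / r > 0" using p e by auto
  qed
  have "(\<integral>\<^sup>+x. (f x * g x) powr\<^sub>e p \<partial>M) = (\<integral>\<^sup>+x. (f x powr\<^sub>e q) powr\<^sub>e (p/q) * (g x powr\<^sub>e r) powr\<^sub>e (p/r) \<partial>M)"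
    using p e by (simp add: ennreal_powr_mult ennreal_powr_powr)
  also have "\<dots> \<le> (\<integral>\<^sup>+x. f x powr\<^sub>e q \<partial>M) powr\<^sub>e (p/q) * (\<integral>\<^sup>+x. g x powr\<^sub>e r \<partial>M) powr\<^sub>e (p/r)"
    by (rule nn_integral_Hoelder) (use p in auto)
  finally have "nn_norm M p (\<lambda>x. f x * g x) \<le> \<dots> powr\<^sub>e (1/p)"
    unfolding nn_norm_def using p by (intro ennreal_powr_mono) auto
  also have "\<dots> = nn_norm M q f * nn_norm M r g"
    using p e(1,2) by (simp add: nn_norm_def ennreal_powr_mult ennreal_powr_powr)
  finally show ?thesis .
qed

section \<open>Translation invariance and convolution inequalities on Euclidean space\<close>

abbreviation L_norm :: "real \<Rightarrow> ('a::euclidean_space \<Rightarrow> ennreal) \<Rightarrow> ennreal" where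
  "L_norm \<equiv> nn_norm lborel"

lemma nn_integral_lborel_translate:
  fixes f :: "'a::euclidean_space \<Rightarrow> ennreal"
  assumes [measurable]: "f \<in> borel_measurable borel"
  shows "(\<integral>\<^sup>+x. f (x - y) \<partial>lborel) = (\<integral>\<^sup>+x. f x \<partial>lborel)"
proof -
  have "(\<integral>\<^sup>+x. f x \<partial>lborel) = (\<integral>\<^sup>+x. f x \<partial>(distr lborel borel ((+) (- y))))"
    by (simp add: lborel_distr_plus)
  also have "\<dots> = (\<integral>\<^sup>+x. f (x - y) \<partial>lborel)" by (subst nn_integral_distr) auto
  finally show ?thesis by simp
qed

lemma nn_integral_lborel_reflect:
  fixes f :: "'a::euclidean_space \<Rightarrow> ennreal"
  assumes [measurable]: "f \<in> borel_measurable borel"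
  shows "(\<integral>\<^sup>+y. f (x - y) \<partial>lborel) = (\<integral>\<^sup>+x. f x \<partial>lborel)"
proof -
  have "(\<integral>\<^sup>+x. f x \<partial>lborel) = (\<integral>\<^sup>+y. f y \<partial>density (distr lborel borel (\<lambda>y. x - y)) (\<lambda>_. 1))"
    using lborel_affine[of "-1" x] by (simp add: one_ennreal.rep_eq)
  also have "\<dots> = (\<integral>\<^sup>+y. f (x - y) \<partial>lborel)" by (simp add: nn_integral_density nn_integral_distr)
  finally show ?thesis by simp
qed

lemma nn_norm_lborel_translate:
  fixes f :: "'a::euclidean_space \<Rightarrow> ennreal"
  assumes [measurable]: "f \<in> borel_measurable borel"
  shows "L_norm q (\<lambda>x. f (x - y)) = L_norm q f"
  unfolding nn_norm_def by (subst nn_integral_lborel_translate[of "\<lambda>x. f x powr\<^sub>e q" y]) auto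

text \<open>Minkowski moves the norm inside the integral over y, and translation leaves the norm of
  G unchanged. This is the endpoint r = q, p = 1 of Young's inequality, which
  \<open>Young_convolution\<close> excludes.\<close>

lemma nn_norm_convolution_L1:
  fixes G g :: "'a::euclidean_space \<Rightarrow> ennreal"
  assumes [measurable]: "G \<in> borel_measurable borel" "g \<in> borel_measurable borel" and q: "1 \<le> q"
  shows "L_norm q (\<lambda>x. \<integral>\<^sup>+y. G (x - y) * g y \<partial>lborel) \<le> L_norm q G * (\<integral>\<^sup>+y. g y \<partial>lborel)"
proof -
  have "L_norm q (\<lambda>x. \<integral>\<^sup>+y. g y * G (x - y) \<partial>lborel) \<le> (\<integral>\<^sup>+y. L_norm q (\<lambda>x. g y * G (x - y)) \<partial>lborel)"
    by (rule Minkowski_integral) (use q in \<open>auto intro: sigma_finite_lborel\<close>)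
  also have "\<dots> = (\<integral>\<^sup>+y. g y * L_norm q G \<partial>lborel)"
    using q by (simp add: nn_norm_cmult nn_norm_lborel_translate)
  also have "\<dots> = L_norm q G * (\<integral>\<^sup>+y. g y \<partial>lborel)"
    by (subst nn_integral_multc) (auto simp: mult.commute)
  finally show ?thesis by (simp add: mult.commute)
qed

text \<open>The product is split as G g = (G^r g^p)^(1/q) (g^p)^\<beta> (G^r)^\<gamma> and Hoelder
  with three factors is applied in y; only the first factor still depends on x in its integral, and
  integrating that one over x gives A * B by the L^1 bound. The strict inequalities p < q and r < q
  make \<beta> and \<gamma> positive.\<close>

lemma Young_convolution:
  fixes G g :: "'a::euclidean_space \<Rightarrow> ennreal"
  assumes [measurable]: "G \<in> borel_measurable borel" "g \<in> borel_measurable borel"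
    and e: "0 < p" "p < q" "0 < r" "r < q" "1 / p + 1 / r = 1 + 1 / q"
  shows "L_norm q (\<lambda>x. \<integral>\<^sup>+y. G (x - y) * g y \<partial>lborel) \<le> L_norm r G * L_norm p g"
proof -
  let ?F = "\<lambda>x. \<integral>\<^sup>+y. G (x - y) * g y \<partial>lborel"
  let ?C = "\<lambda>x. \<integral>\<^sup>+y. G (x - y) powr\<^sub>e r * g y powr\<^sub>e p \<partial>lborel"
  have q: "q > 0" using e by simp
  define A where "A = (\<integral>\<^sup>+y. G y powr\<^sub>e r \<partial>lborel)"
  define B where "B = (\<integral>\<^sup>+y. g y powr\<^sub>e p \<partial>lborel)"
  define \<beta> where "\<beta> = 1 / p - 1 / q"
  define \<gamma> where "\<gamma> = 1 / r - 1 / q"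
  let ?D = "B powr\<^sub>e (\<beta> * q) * A powr\<^sub>e (\<gamma> * q)"
  have bg: "\<beta> > 0" "\<gamma> > 0" "1 / q + \<beta> + \<gamma> = 1"
    using e q by (auto simp: \<beta>_def \<gamma>_def field_simps)
  have rr: "r * (1/q) + r * \<gamma> = 1" "p * (1/q) + p * \<beta> = 1"
    using e q by (auto simp: \<beta>_def \<gamma>_def field_simps)
  have key: "?F x powr\<^sub>e q
      \<le> ?C x * ?D" for x
  proof -
    have "G (x - y) * g y = (G (x - y) powr\<^sub>e r * g y powr\<^sub>e p) powr\<^sub>e (1/q) * (g y powr\<^sub>e p) powr\<^sub>e \<beta> * (G (x - y) powr\<^sub>e r) powr\<^sub>e \<gamma>" for y
    proof -
      have "G (x - y) * g y = G (x - y) powr\<^sub>e (r * (1/q) + r * \<gamma>) * g y powr\<^sub>e (p * (1/q) + p * \<beta>)"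
        unfolding rr by simp
      then show ?thesis using q by (simp add: ennreal_powr_add ennreal_powr_mult ennreal_powr_powr mult_ac)
    qed
    then have "?F x =
       (\<integral>\<^sup>+y. (G (x - y) powr\<^sub>e r * g y powr\<^sub>e p) powr\<^sub>e (1/q) * (g y powr\<^sub>e p) powr\<^sub>e \<beta> * (G (x - y) powr\<^sub>e r) powr\<^sub>e \<gamma> \<partial>lborel)"
      by simp
    also have "\<dots> \<le> ?C x powr\<^sub>e (1/q) * B powr\<^sub>e \<beta> *
       (\<integral>\<^sup>+y. G (x - y) powr\<^sub>e r \<partial>lborel) powr\<^sub>e \<gamma>"
      unfolding B_def by (rule nn_integral_Hoelder3) (use bg q in auto)
    also have "(\<integral>\<^sup>+y. G (x - y) powr\<^sub>e r \<partial>lborel) = A"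
      unfolding A_def by (rule nn_integral_lborel_reflect) auto
    finally have "?F x powr\<^sub>e q \<le>
      (?C x powr\<^sub>e (1/q) * B powr\<^sub>e \<beta> * A powr\<^sub>e \<gamma>) powr\<^sub>e q"
      using q by (intro ennreal_powr_mono) auto
    also have "\<dots> = ?C x * ?D"
      using q by (simp add: ennreal_powr_mult ennreal_powr_powr mult_ac)
    finally show ?thesis .
  qed
  have "(\<integral>\<^sup>+x. ?F x powr\<^sub>e q \<partial>lborel) \<le>
     (\<integral>\<^sup>+x. ?C x * ?D \<partial>lborel)"
    by (intro nn_integral_mono key)
  also have "\<dots> = (\<integral>\<^sup>+x. ?C x \<partial>lborel) * ?D"
    by (rule nn_integral_multc) measurable
  also have "(\<integral>\<^sup>+x. ?C x \<partial>lborel) \<le> A * B"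
    using nn_norm_convolution_L1[of "\<lambda>x. G x powr\<^sub>e r" "\<lambda>y. g y powr\<^sub>e p" 1]
    by (simp add: nn_norm_1 A_def B_def)
  finally have "(\<integral>\<^sup>+x. ?F x powr\<^sub>e q \<partial>lborel) \<le> A * B * ?D"
    by (simp add: mult_right_mono)
  then have "L_norm q (\<lambda>x. \<integral>\<^sup>+y. G (x - y) * g y \<partial>lborel) \<le> (A * B * ?D) powr\<^sub>e (1/q)"
    unfolding nn_norm_def using q by (intro ennreal_powr_mono) auto
  also have "\<dots> = A powr\<^sub>e (1/q + \<gamma>) * B powr\<^sub>e (1/q + \<beta>)"
    using q by (simp add: ennreal_powr_add ennreal_powr_mult ennreal_powr_powr mult_ac)
  also have "\<dots> = L_norm r G * L_norm p g"
    by (simp add: \<beta>_def \<gamma>_def A_def B_def nn_norm_def)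
  finally show ?thesis .
qed

section \<open>Power integrals\<close>

lemma nn_integral_powr_atLeast:
  assumes "1 < a" "0 < t"
  shows "(\<integral>\<^sup>+s. (if t < s then ennreal (s powr - a) else 0) \<partial>lborel) \<le> ennreal (t powr (1 - a) / (a - 1))"
proof -
  have "(\<integral>\<^sup>+s. (if t < s then ennreal (s powr - a) else 0) \<partial>lborel) \<le> (\<integral>\<^sup>+s. ennreal (s powr - a) * indicator {t..} s \<partial>lborel)"
    by (intro nn_integral_mono) (auto simp: indicator_def)
  also have "\<dots> = ennreal (0 - t powr (1 - a) / (1 - a))"
  proof (rule nn_integral_FTC_atLeast)
    fix x assume "t \<le> x"
    then show "((\<lambda>s. s powr (1 - a) / (1 - a)) has_real_derivative x powr - a) (at x)"
      using assms by (auto intro!: derivative_eq_intros)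
  next
    show "((\<lambda>s. s powr (1 - a) / (1 - a)) \<longlongrightarrow> 0) at_top"
      using assms by (intro tendsto_divide_zero tendsto_neg_powr filterlim_ident) auto
  qed auto
  also have "0 - t powr (1 - a) / (1 - a) = t powr (1 - a) / (a - 1)"
    using assms by (simp add: field_simps)
  finally show ?thesis .
qed

lemma nn_integral_powr_from_0:
  assumes "b < 1" "0 < t"
  shows "(\<integral>\<^sup>+s. (if 0 < s \<and> s < t then ennreal (s powr - b) else 0) \<partial>lborel) \<le> ennreal (t powr (1 - b) / (1 - b))"
proof -
  have 1: "((\<lambda>s. s powr - b) has_integral (t powr (1 - b) / (1 - b))) {0..t}"
    using has_integral_powr_from_0[of "-b" t] assms by (simp add: add.commute)
  have "((\<lambda>s. if s \<in> {0..t} then s powr - b else 0) has_integral (t powr (1 - b) / (1 - b))) UNIV"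
    by (rule has_integral_restrict_UNIV[THEN iffD2, OF 1])
  then have "(\<integral>\<^sup>+s. ennreal (if s \<in> {0..t} then s powr - b else 0) \<partial>lborel) = ennreal (t powr (1 - b) / (1 - b))"
    by (intro nn_integral_has_integral_lborel) auto
  moreover have "(\<integral>\<^sup>+s. (if 0 < s \<and> s < t then ennreal (s powr - b) else 0) \<partial>lborel) \<le> (\<integral>\<^sup>+s. ennreal (if s \<in> {0..t} then s powr - b else 0) \<partial>lborel)"
    by (intro nn_integral_mono) auto
  ultimately show ?thesis by simp
qed

lemma nn_integral_powr_to:
  assumes "a < 1" "0 \<le> r" "r < t"
  shows "(\<integral>\<^sup>+s. (if r < s \<and> s < t then ennreal ((t - s) powr - a) else 0) \<partial>lborel) \<le> ennreal ((t - r) powr (1 - a) / (1 - a))"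
proof -
  have "(\<integral>\<^sup>+s. (if r < s \<and> s < t then ennreal ((t - s) powr - a) else 0) \<partial>lborel)
     = (\<integral>\<^sup>+s. (\<lambda>s. if 0 < s \<and> s < t - r then ennreal (s powr - a) else 0) (t - s) \<partial>lborel)"
    by (intro nn_integral_cong) auto
  also have "\<dots> = (\<integral>\<^sup>+s. (if 0 < s \<and> s < t - r then ennreal (s powr - a) else 0) \<partial>lborel)"
    by (rule nn_integral_lborel_reflect) measurable
  finally show ?thesis using nn_integral_powr_from_0[of a "t - r"] assms by simp
qed

text \<open>An upper bound for the Beta function at (1 - a, 1 - b). It comes from freezing at t/2
  the factor that is regular on each half of (0, t).\<close>

definition beta_const :: "real \<Rightarrow> real \<Rightarrow> real" where
  "beta_const a b = 2 powr a / (1 - b) + 2 powr b / (1 - a)"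

lemma nn_integral_beta:
  assumes ab: "0 < a" "a < 1" "0 < b" "b < 1" and t: "0 < t"
  shows "(\<integral>\<^sup>+s. (if 0 < s \<and> s < t then ennreal ((t - s) powr - a * s powr - b) else 0) \<partial>lborel)
    \<le> ennreal (beta_const a b * t powr (1 - a - b))"
proof -
  let ?p = "\<lambda>s. if 0 < s \<and> s < t then ennreal (s powr - b) else 0"
  let ?r = "\<lambda>s. if 0 < s \<and> s < t then ennreal ((t - s) powr - a) else 0"
  let ?l = "\<lambda>s. if 0 < s \<and> s < t then ennreal ((t - s) powr - a * s powr - b) else 0"
  have "?l s
    \<le> ennreal ((t/2) powr - a) * ?p s +
      ennreal ((t/2) powr - b) * ?r s" for s
  proof (cases "0 < s \<and> s < t")
    case True
    have "(t - s) powr - a * s powr - b \<le> (t/2) powr - a * s powr - b + (t/2) powr - b * (t - s) powr - a"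
    proof (cases "s \<le> t/2")
      case True
      then have "(t - s) powr - a \<le> (t/2) powr - a" using t ab by (intro powr_mono2') auto
      then have "(t - s) powr - a * s powr - b \<le> (t/2) powr - a * s powr - b" by (rule mult_right_mono) auto
      then show ?thesis by (simp add: add_increasing2)
    next
      case False
      then have "s powr - b \<le> (t/2) powr - b" using t ab by (intro powr_mono2') auto
      then have "s powr - b * (t - s) powr - a \<le> (t/2) powr - b * (t - s) powr - a" by (rule mult_right_mono) auto
      then show ?thesis by (simp add: add_increasing mult.commute)
    qed
    then show ?thesis using True
      by (simp add: ennreal_mult[symmetric] ennreal_plus[symmetric] ennreal_leI del: ennreal_plus)
  qed auto
  then have "(\<integral>\<^sup>+s. ?l s \<partial>lborel) \<le>
     (\<integral>\<^sup>+s. ennreal ((t/2) powr - a) * ?p s +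
      ennreal ((t/2) powr - b) * ?r s \<partial>lborel)"
    by (intro nn_integral_mono)
  also have "\<dots> = ennreal ((t/2) powr - a) * (\<integral>\<^sup>+s. ?p s \<partial>lborel) +
      ennreal ((t/2) powr - b) * (\<integral>\<^sup>+s. ?r s \<partial>lborel)"
    by (simp add: nn_integral_add nn_integral_cmult)
  also have "\<dots> \<le> ennreal ((t/2) powr - a) * ennreal (t powr (1 - b) / (1 - b)) +
      ennreal ((t/2) powr - b) * ennreal (t powr (1 - a) / (1 - a))"
    using nn_integral_powr_to[of a 0 t] ab t by (intro add_mono mult_left_mono nn_integral_powr_from_0) auto
  also have "\<dots> = ennreal ((t/2) powr - a * (t powr (1 - b) / (1 - b)) + (t/2) powr - b * (t powr (1 - a) / (1 - a)))"
    using ab by (simp add: ennreal_mult[symmetric] ennreal_plus[symmetric] del: ennreal_plus)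
  also have "(t/2) powr - a * (t powr (1 - b) / (1 - b)) + (t/2) powr - b * (t powr (1 - a) / (1 - a)) = beta_const a b * t powr (1 - a - b)"
  proof -
    have "t powr - a * t powr (1 - b) = t powr (1 - a - b)" "t powr - b * t powr (1 - a) = t powr (1 - a - b)"
      by (simp_all add: powr_add[symmetric] algebra_simps)
    moreover have "(t/2) powr - a * (t powr (1 - b) / (1 - b)) = 2 powr a / (1 - b) * (t powr - a * t powr (1 - b))"
      "(t/2) powr - b * (t powr (1 - a) / (1 - a)) = 2 powr b / (1 - a) * (t powr - b * t powr (1 - a))"
      using t by (simp_all add: powr_divide powr_minus_divide[of 2])
    ultimately show ?thesis unfolding beta_const_def by (simp only: distrib_right)
  qed
  finally show ?thesis .
qed

section \<open>Gaussians\<close>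

text \<open>For a non-integrable function the Bochner integral is 0 by convention and the bound is
  trivial. The integral equation can therefore be estimated before the convergence of any of its
  integrals is known.\<close>

lemma ennreal_norm_integral_le:
  fixes f :: "'a \<Rightarrow> 'b::{banach, second_countable_topology}"
  shows "ennreal (norm (\<integral>x. f x \<partial>M)) \<le> (\<integral>\<^sup>+x. ennreal (norm (f x)) \<partial>M)"
  by (cases "integrable M f") (auto simp: integral_norm_bound_ennreal not_integrable_integral_eq)

text \<open>The heat kernel with 8 s in place of 4 s in the exponential and without the factor (4
  pi)^(-n/2), which is at most 1. The half of the exponent that is given away absorbs the powers of
  |x| produced by differentiation.\<close>

definition gauss :: "real \<Rightarrow> real ^ 'n::finite \<Rightarrow> real" where
  "gauss s x = s powr (- (real CARD('n) / 2)) * exp (- (norm x)\<^sup>2 / (8 * s))"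

lemma gauss_nonneg [simp]: "0 \<le> gauss s x"
  by (simp add: gauss_def)

lemma measurable_gauss [measurable]:
  assumes [measurable]: "f \<in> borel_measurable M" "g \<in> borel_measurable M"
  shows "(\<lambda>x. gauss (f x) (g x :: real ^ 'n::finite)) \<in> borel_measurable M"
  unfolding gauss_def by measurable

lemma nn_integral_exp_neg_norm_squared:
  assumes \<alpha>: "0 < \<alpha>"
  shows "(\<integral>\<^sup>+x. ennreal (exp (- \<alpha> * (norm (x::'a::euclidean_space))\<^sup>2)) \<partial>lborel) < top"
proof -
  define \<sigma> where "\<sigma> = 1 / sqrt (2 * \<alpha>)"
  have s: "\<sigma> > 0" "2 * \<sigma>\<^sup>2 = 1 / \<alpha>" using \<alpha> by (auto simp: \<sigma>_def power_divide)
  have "integrable lborel (\<lambda>x. sqrt (2 * pi * \<sigma>\<^sup>2) * normal_density 0 \<sigma> x)"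
    using s by (intro integrable_mult_right integrable_normal_density)
  moreover have "(\<lambda>x. sqrt (2 * pi * \<sigma>\<^sup>2) * normal_density 0 \<sigma> x) = (\<lambda>x::real. exp (- \<alpha> * x\<^sup>2))"
    using s by (auto simp: normal_density_def fun_eq_iff)
  ultimately have 1: "(\<integral>\<^sup>+x. ennreal (exp (- \<alpha> * x\<^sup>2)) \<partial>(lborel :: real measure)) < top"
    by (simp add: integrable_iff_bounded)
  have "exp (- \<alpha> * (norm x)\<^sup>2) = (\<Prod>b\<in>Basis. exp (- \<alpha> * (x \<bullet> b)\<^sup>2))" for x :: 'a
  proof -
    have "(norm x)\<^sup>2 = (\<Sum>b\<in>Basis. (x \<bullet> b)\<^sup>2)"
      unfolding power2_norm_eq_inner by (subst euclidean_inner) (simp add: power2_eq_square)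
    then show ?thesis by (simp add: sum_distrib_left exp_sum[symmetric])
  qed
  then have "(\<integral>\<^sup>+x. ennreal (exp (- \<alpha> * (norm (x::'a))\<^sup>2)) \<partial>lborel) = (\<integral>\<^sup>+x. (\<Prod>b\<in>Basis. ennreal (exp (- \<alpha> * ((x::'a) \<bullet> b)\<^sup>2))) \<partial>lborel)"
    by (simp add: prod_ennreal)
  also have "\<dots> = (\<Prod>b\<in>(Basis::'a set). (\<integral>\<^sup>+x. ennreal (exp (- \<alpha> * x\<^sup>2)) \<partial>lborel))"
    by (rule nn_integral_lborel_prod) auto
  also have "\<dots> < top"
    using 1 by (simp add: power_less_top_ennreal)
  finally show ?thesis .
qed

lemma nn_integral_lborel_scale:
  fixes f :: "'a::euclidean_space \<Rightarrow> ennreal"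
  assumes [measurable]: "f \<in> borel_measurable borel" and c: "0 < c"
  shows "(\<integral>\<^sup>+x. f x \<partial>lborel) = ennreal (c ^ DIM('a)) * (\<integral>\<^sup>+x. f (c *\<^sub>R x) \<partial>lborel)"
proof -
  have "(\<integral>\<^sup>+x. f x \<partial>lborel) = (\<integral>\<^sup>+x. f x \<partial>(density (distr lborel borel (\<lambda>x. c *\<^sub>R x)) (\<lambda>_. ennreal (c ^ DIM('a)))))"
    using lborel_affine[of c "0::'a"] c by simp
  also have "\<dots> = ennreal (c ^ DIM('a)) * (\<integral>\<^sup>+x. f (c *\<^sub>R x) \<partial>lborel)"
    by (simp add: nn_integral_density nn_integral_distr nn_integral_cmult)
  finally show ?thesis .
qed

definition gauss_const :: "'n::finite itself \<Rightarrow> real \<Rightarrow> real" where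
  "gauss_const _ r = enn2real (L_norm r (\<lambda>x :: real ^ 'n. ennreal (gauss 1 x)))"

lemma gauss_const_nonneg [simp]: "0 \<le> gauss_const T r"
  by (simp add: gauss_const_def)

text \<open>Parabolic scaling: the substitution of sqrt s * x for x reduces every s to one and the
  same Gaussian integral, which is finite. In particular the \<open>enn2real\<close> in
  \<open>gauss_const\<close> loses nothing.\<close>

lemma nn_norm_gauss:
  assumes r: "0 < r" and s: "0 < s"
  shows "L_norm r (\<lambda>x :: real ^ 'n::finite. ennreal (gauss s x))
    = ennreal (gauss_const TYPE('n) r * s powr (- (real CARD('n) / 2) * (1 - 1 / r)))"
proof -
  define I where "I = (\<integral>\<^sup>+x. ennreal (exp (- (r/8) * (norm (x::real ^ 'n))\<^sup>2)) \<partial>lborel)"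
  have I: "I < top" unfolding I_def using r by (intro nn_integral_exp_neg_norm_squared) auto
  define i where "i = enn2real I"
  have i: "I = ennreal i" "i \<ge> 0" using I by (auto simp: i_def)
  have *: "L_norm r (\<lambda>x :: real ^ 'n. ennreal (gauss s x))
    = ennreal (i powr (1/r) * s powr (- (real CARD('n) / 2) * (1 - 1 / r)))" if s: "0 < s" for s
  proof -
    have "(\<integral>\<^sup>+x. ennreal (gauss s (x::real ^ 'n)) powr\<^sub>e r \<partial>lborel) =
       (\<integral>\<^sup>+x. ennreal (s powr (- (real CARD('n) / 2) * r)) * ennreal (exp (- (r / (8 * s)) * (norm (x::real ^ 'n))\<^sup>2)) \<partial>lborel)"
    proof (intro nn_integral_cong)
      fix x :: "real ^ 'n"
      have "gauss s x powr r = s powr (- (real CARD('n) / 2) * r) * exp (- (r / (8 * s)) * (norm x)\<^sup>2)"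
        unfolding gauss_def by (simp add: powr_mult powr_powr exp_powr_real mult.commute)
      then show "ennreal (gauss s x) powr\<^sub>e r = ennreal (s powr (- (real CARD('n) / 2) * r)) * ennreal (exp (- (r / (8 * s)) * (norm x)\<^sup>2))"
        by (simp add: ennreal_mult[symmetric])
    qed
    also have "\<dots> = ennreal (s powr (- (real CARD('n) / 2) * r)) * (\<integral>\<^sup>+x. ennreal (exp (- (r / (8 * s)) * (norm (x::real ^ 'n))\<^sup>2)) \<partial>lborel)"
      by (rule nn_integral_cmult) auto
    also have "(\<integral>\<^sup>+x. ennreal (exp (- (r / (8 * s)) * (norm (x::real ^ 'n))\<^sup>2)) \<partial>lborel) = ennreal (sqrt s ^ CARD('n)) * I"
      unfolding I_def using s by (subst nn_integral_lborel_scale[of _ "sqrt s"]) (auto simp: power_mult_distrib)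
    also have "sqrt s ^ CARD('n) = s powr (real CARD('n) / 2)"
      using s by (simp add: powr_half_sqrt[symmetric] powr_realpow[symmetric] powr_powr)
    finally have "L_norm r (\<lambda>x :: real ^ 'n. ennreal (gauss s x)) = ennreal ((s powr (- (real CARD('n) / 2) * r) * (s powr (real CARD('n) / 2) * i)) powr (1/r))"
      using i by (simp add: nn_norm_def ennreal_mult[symmetric])
    also have "(s powr (- (real CARD('n) / 2) * r) * (s powr (real CARD('n) / 2) * i)) powr (1/r) = i powr (1/r) * s powr (- (real CARD('n) / 2) * (1 - 1 / r))"
    proof -
      have e: "- (real CARD('n) / 2) * r * (1/r) + real CARD('n) / 2 * (1/r) = - (real CARD('n) / 2) * (1 - 1 / r)"
        using r by (simp add: field_simps)
      have "(s powr (- (real CARD('n) / 2) * r) * (s powr (real CARD('n) / 2) * i)) powr (1/r)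
        = i powr (1/r) * (s powr (- (real CARD('n) / 2) * r * (1/r)) * s powr (real CARD('n) / 2 * (1/r)))"
        using r s i by (simp only: powr_mult powr_powr mult_ac mult_nonneg_nonneg powr_ge_zero)
      then show ?thesis by (simp only: powr_add[symmetric] e)
    qed
    finally show ?thesis .
  qed
  \<comment> \<open>The constant i^(1/r) is identified by evaluating the formula at s = 1.\<close>
  have "gauss_const TYPE('n) r = i powr (1/r)"
    using *[of 1] by (simp add: gauss_const_def)
  then show ?thesis using *[OF s] by simp
qed

section \<open>The kernel of the Stokes semigroup composed with the divergence\<close>

lemma heat_kernel_has_derivative:
  assumes "0 < t"
  shows "(heat_kernel t has_derivative (\<lambda>h. - (x \<bullet> h) / (2 * t) * heat_kernel t x)) (at (x :: real ^ 'n::finite))"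
proof -
  have "((\<lambda>x::real ^ 'n. (4 * pi * t) powr (- (real CARD('n) / 2)) * exp (- (x \<bullet> x) / (4 * t))) has_derivative
     (\<lambda>h. - (x \<bullet> h) / (2 * t) * ((4 * pi * t) powr (- (real CARD('n) / 2)) * exp (- (x \<bullet> x) / (4 * t))))) (at x)"
    using assms by (auto intro!: derivative_eq_intros simp: fun_eq_iff inner_commute field_simps)
  then show ?thesis by (simp add: heat_kernel_def[abs_def] power2_norm_eq_inner)
qed

lemma partial_deriv_eqI:
  "(f has_derivative f') (at x) \<Longrightarrow> partial_deriv l f x = f' (axis l 1)"
  by (simp add: partial_deriv_def frechet_derivative_at[symmetric])

lemma axis_nth_if: "axis l (c::real) $ j = (if j = l then c else 0)"
  by (simp add: axis_def)

lemma partial_deriv_heat_kernel: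
  "0 < t \<Longrightarrow> partial_deriv l (heat_kernel t) = (\<lambda>x :: real ^ 'n::finite. - (x $ l) / (2 * t) * heat_kernel t x)"
  by (rule ext, subst partial_deriv_eqI[OF heat_kernel_has_derivative]) (auto simp: inner_axis)

lemma partial_deriv2_heat_kernel:
  assumes "0 < t"
  shows "partial_deriv k (partial_deriv j (heat_kernel t)) =
    (\<lambda>x :: real ^ 'n::finite. (x $ j * x $ k / (4 * t\<^sup>2) - (if j = k then 1 else 0) / (2 * t)) * heat_kernel t x)"
proof
  fix x :: "real ^ 'n"
  have "((\<lambda>x :: real ^ 'n. - (x $ j) / (2 * t) * heat_kernel t x) has_derivative
    (\<lambda>h. - (x $ j) / (2 * t) * (- (x \<bullet> h) / (2 * t) * heat_kernel t x) + - (h $ j) / (2 * t) * heat_kernel t x)) (at x)"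
    using assms by (auto intro!: derivative_eq_intros heat_kernel_has_derivative bounded_linear_vec_nth
      bounded_linear_imp_has_derivative simp: fun_eq_iff field_simps power2_eq_square power4_eq_xxxx)
  note d = partial_deriv_eqI[OF this, of k]
  show "partial_deriv k (partial_deriv j (heat_kernel t)) x =
    (x $ j * x $ k / (4 * t\<^sup>2) - (if j = k then 1 else 0) / (2 * t)) * heat_kernel t x"
    unfolding partial_deriv_heat_kernel[OF assms] d
    using assms by (auto simp: inner_axis axis_nth_if field_simps power2_eq_square)
qed

lemma partial_deriv3_heat_kernel:
  assumes "0 < t"
  shows "partial_deriv l (partial_deriv k (partial_deriv j (heat_kernel t))) =
    (\<lambda>x :: real ^ 'n::finite. (- (x $ l * x $ k * x $ j) / (8 * t ^ 3) + ((if j = k then x $ l else 0)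
      + (if l = j then x $ k else 0) + (if l = k then x $ j else 0)) / (4 * t\<^sup>2)) * heat_kernel t x)"
proof
  fix x :: "real ^ 'n"
  have "((\<lambda>x :: real ^ 'n. (x $ j * x $ k / (4 * t\<^sup>2) - (if j = k then 1 else 0) / (2 * t)) * heat_kernel t x) has_derivative
    (\<lambda>h. (x $ j * x $ k / (4 * t\<^sup>2) - (if j = k then 1 else 0) / (2 * t)) * (- (x \<bullet> h) / (2 * t) * heat_kernel t x)
       + (x $ j * h $ k + h $ j * x $ k) / (4 * t\<^sup>2) * heat_kernel t x)) (at x)"
    using assms by (auto intro!: derivative_eq_intros heat_kernel_has_derivative bounded_linear_vec_nth
      bounded_linear_imp_has_derivative simp: fun_eq_iff field_simps power2_eq_square power4_eq_xxxx)
  note d = partial_deriv_eqI[OF this, of l]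
  show "partial_deriv l (partial_deriv k (partial_deriv j (heat_kernel t))) x =
    (- (x $ l * x $ k * x $ j) / (8 * t ^ 3) + ((if j = k then x $ l else 0)
      + (if l = j then x $ k else 0) + (if l = k then x $ j else 0)) / (4 * t\<^sup>2)) * heat_kernel t x"
    unfolding partial_deriv2_heat_kernel[OF assms] d
    using assms by (auto simp: inner_axis axis_nth_if field_simps power2_eq_square power3_eq_cube)
qed

text \<open>With y = |x| / sqrt t this trades powers of |x| for powers of t. The constant 129 is 128
  + 1: the quadratic Taylor term (y^2/8)^2/2 equals y^4/128, and y^3 is at most 1 + y^4.\<close>

lemma le_exp_square:
  assumes "0 \<le> (y::real)"
  shows "y \<le> 8 * exp (y\<^sup>2 / 8)" "y ^ 3 \<le> 129 * exp (y\<^sup>2 / 8)"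
proof -
  have y: "y \<le> 1 + y\<^sup>2" "y ^ 3 \<le> 1 + y ^ 4"
  proof -
    show "y \<le> 1 + y\<^sup>2" using zero_le_power2[of "y - 1/2"] by (simp add: power2_diff power_divide)
    show "y ^ 3 \<le> 1 + y ^ 4"
    proof (cases "y \<le> 1")
      case True then show ?thesis using assms power_le_one[of y 3] by (smt (verit) zero_le_power)
    next
      case False then have "y ^ 3 \<le> y ^ 4" by (intro power_increasing) auto
      then show ?thesis by simp
    qed
  qed
  have e1: "1 + y\<^sup>2 / 8 \<le> exp (y\<^sup>2 / 8)" by (rule exp_ge_add_one_self)
  show "y \<le> 8 * exp (y\<^sup>2 / 8)" using y(1) e1 by linarith
  have "1 + y\<^sup>2 / 8 + (y\<^sup>2 / 8)\<^sup>2 / 2 \<le> exp (y\<^sup>2 / 8)" by (rule exp_lower_Taylor_quadratic) auto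
  then have "1 + y\<^sup>2 / 8 + y ^ 4 / 128 \<le> exp (y\<^sup>2 / 8)" by (simp add: power_divide flip: power_mult)
  then have "y ^ 4 \<le> 128 * exp (y\<^sup>2 / 8)" using zero_le_power2[of y] by linarith
  moreover have "1 \<le> exp (y\<^sup>2 / 8)" by simp
  ultimately show "y ^ 3 \<le> 129 * exp (y\<^sup>2 / 8)" using y(2) by linarith
qed

lemma heat_kernel_nonneg [simp]: "0 \<le> heat_kernel t x"
  by (simp add: heat_kernel_def)

lemma heat_kernel_le:
  assumes t: "0 < t"
  shows "heat_kernel t (x :: real ^ 'n::finite) \<le> exp (- ((norm x / sqrt t)\<^sup>2 / 8)) * gauss t x"
proof -
  have "(4 * pi * t) powr (- (real CARD('n) / 2)) \<le> t powr (- (real CARD('n) / 2))"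
    using t pi_ge_two by (intro powr_mono2') auto
  moreover have "exp (- (norm x)\<^sup>2 / (4 * t)) = exp (- ((norm x / sqrt t)\<^sup>2 / 8)) * exp (- (norm x)\<^sup>2 / (8 * t))"
    using t by (simp add: power_divide field_simps flip: exp_add)
  ultimately show ?thesis unfolding heat_kernel_def gauss_def
    by (simp add: mult_right_mono mult.assoc mult.left_commute)
qed

lemma heat_kernel_le_gauss: "0 < t \<Longrightarrow> heat_kernel t (x :: real ^ 'n::finite) \<le> gauss t x"
  by (rule order.trans[OF heat_kernel_le]) (auto intro!: mult_left_le_one_le)

lemma norm_heat_kernel_le:
  assumes t: "0 < t"
  shows "norm x * heat_kernel t (x :: real ^ 'n::finite) \<le> 8 * t powr (1/2) * gauss t x"
    "norm x ^ 3 * heat_kernel t x \<le> 129 * t powr (3/2) * gauss t x"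
proof -
  define y where "y = norm x / sqrt t"
  have y: "norm x = y * t powr (1/2)" "y \<ge> 0" using t by (auto simp: y_def powr_half_sqrt)
  have t3: "(t powr (1/2)) ^ 3 = t powr (3/2)" using t by (simp add: powr_powr flip: powr_realpow)
  have h: "heat_kernel t x \<le> exp (- (y\<^sup>2 / 8)) * gauss t x" unfolding y_def by (rule heat_kernel_le[OF t])
  have "norm x * heat_kernel t x \<le> (8 * exp (y\<^sup>2 / 8) * t powr (1/2)) * (exp (- (y\<^sup>2 / 8)) * gauss t x)"
    unfolding y(1) using y le_exp_square[OF y(2)] by (intro mult_mono h) auto
  also have "\<dots> = 8 * t powr (1/2) * gauss t x" by (simp add: exp_minus)
  finally show "norm x * heat_kernel t x \<le> 8 * t powr (1/2) * gauss t x" .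
  have "norm x ^ 3 * heat_kernel t x \<le> (129 * exp (y\<^sup>2 / 8) * t powr (3/2)) * (exp (- (y\<^sup>2 / 8)) * gauss t x)"
    unfolding y(1) power_mult_distrib t3 using y le_exp_square[OF y(2)] by (intro mult_mono h) auto
  also have "\<dots> = 129 * t powr (3/2) * gauss t x" by (simp add: exp_minus)
  finally show "norm x ^ 3 * heat_kernel t x \<le> 129 * t powr (3/2) * gauss t x" .
qed

text \<open>The factor 4 would do here; 23 is what the third derivatives require, where 129/8 + 6 =
  22.125. A common factor can be pulled out of \<open>oseen_majorant\<close>.\<close>

lemma abs_partial_deriv_heat_kernel_le:
  assumes t: "0 < t"
  shows "\<bar>partial_deriv l (heat_kernel t) (x :: real ^ 'n::finite)\<bar> \<le> 23 * t powr (- (1/2)) * gauss t x"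
proof -
  have "\<bar>partial_deriv l (heat_kernel t) x\<bar> \<le> norm x * heat_kernel t x / (2 * t)"
    using t component_le_norm_cart[of x l] unfolding partial_deriv_heat_kernel[OF t]
    by (simp add: abs_mult mult_right_mono divide_right_mono)
  also have "\<dots> \<le> 8 * t powr (1/2) * gauss t x / (2 * t)"
    using t by (intro divide_right_mono norm_heat_kernel_le) auto
  also have "\<dots> = 4 * t powr (- (1/2)) * gauss t x"
  proof -
    have "t powr (1/2) = t * t powr (- (1/2))" using t powr_add[of t 1 "-(1/2)"] by simp
    then show ?thesis using t by simp
  qed
  also have "\<dots> \<le> 23 * t powr (- (1/2)) * gauss t x" by (intro mult_right_mono) auto
  finally show ?thesis .
qed

lemma abs_partial_deriv3_heat_kernel_le:
  assumes t: "0 < t"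
  shows "\<bar>partial_deriv l (partial_deriv k (partial_deriv j (heat_kernel t))) (x :: real ^ 'n::finite)\<bar>
    \<le> 23 * t powr (- (3/2)) * gauss t x"
proof -
  note c = component_le_norm_cart[of x]
  have a: "\<bar>- (x $ l * x $ k * x $ j) / (8 * t ^ 3)\<bar> \<le> norm x ^ 3 / (8 * t ^ 3)"
    using t unfolding power3_eq_cube by (auto simp: abs_mult intro!: divide_right_mono mult_mono c)
  have b: "\<bar>((if j = k then x $ l else 0) + (if l = j then x $ k else 0) + (if l = k then x $ j else 0)) / (4 * t\<^sup>2)\<bar> \<le> 3 * norm x / (4 * t\<^sup>2)"
    using t c[of l] c[of k] c[of j] by (auto simp: intro!: divide_right_mono)
  have "\<bar>partial_deriv l (partial_deriv k (partial_deriv j (heat_kernel t))) x\<bar> \<le> (norm x ^ 3 / (8 * t ^ 3) + 3 * norm x / (4 * t\<^sup>2)) * heat_kernel t x"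
    unfolding partial_deriv3_heat_kernel[OF t] abs_mult abs_of_nonneg[OF heat_kernel_nonneg]
    using a b by (intro mult_right_mono order.trans[OF abs_triangle_ineq]) auto
  also have "\<dots> = norm x ^ 3 * heat_kernel t x / (8 * t ^ 3) + 3 * (norm x * heat_kernel t x) / (4 * t\<^sup>2)"
    by (simp add: distrib_right)
  also have "\<dots> \<le> (129 * t powr (3/2) * gauss t x) / (8 * t ^ 3) + 3 * (8 * t powr (1/2) * gauss t x) / (4 * t\<^sup>2)"
    using t by (intro add_mono divide_right_mono mult_left_mono norm_heat_kernel_le) auto
  also have "\<dots> = (129 / 8 + 6) * t powr (- (3/2)) * gauss t x"
  proof -
    define B where "B = t powr (- (3/2))"
    have A: "t powr (3/2) = t ^ 3 * B" "t powr (1/2) = t\<^sup>2 * B"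
      using t powr_add[of t 3 "-(3/2)"] powr_add[of t 2 "-(3/2)"] by (simp_all add: B_def)
    show ?thesis using t unfolding A B_def[symmetric] by (simp add: distrib_right)
  qed
  also have "\<dots> \<le> 23 * t powr (- (3/2)) * gauss t x" by (intro mult_right_mono) auto
  finally show ?thesis .
qed

text \<open>One function serves all index triples. Being a superposition of Gaussians, it gets its
  L^r norms from those of \<open>gauss\<close> by Minkowski's inequality.\<close>

definition oseen_majorant :: "real \<Rightarrow> real ^ 'n::finite \<Rightarrow> ennreal" where
  "oseen_majorant t x = 23 * (ennreal (t powr (- (1/2)) * gauss t x)
     + (\<integral>\<^sup>+s. (if t < s then ennreal (s powr (- (3/2)) * gauss s x) else 0) \<partial>lborel))"

lemma measurable_oseen_majorant [measurable]:
  assumes [measurable]: "f \<in> borel_measurable M" "g \<in> borel_measurable M"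
  shows "(\<lambda>x. oseen_majorant (f x) (g x :: real ^ 'n::finite)) \<in> borel_measurable M"
  unfolding oseen_majorant_def by measurable

lemma numeral_mult_ennreal: "0 \<le> x \<Longrightarrow> numeral k * ennreal x = ennreal (numeral k * x)"
  by (simp add: ennreal_mult)

lemma oseen_kernel_le_majorant:
  assumes t: "0 < t"
  shows "ennreal \<bar>oseen_kernel l k j (x :: real ^ 'n::finite) t\<bar> \<le> oseen_majorant t x"
proof -
  let ?D = "\<lambda>s. partial_deriv l (partial_deriv k (partial_deriv j (heat_kernel s))) x"
  have "ennreal \<bar>LINT s:{t<..}|lebesgue. ?D s\<bar> \<le> (\<integral>\<^sup>+s. ennreal (norm (indicator {t<..} s *\<^sub>R ?D s)) \<partial>lebesgue)"
    unfolding set_lebesgue_integral_def real_norm_def[symmetric] by (rule ennreal_norm_integral_le)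
  also have "\<dots> = (\<integral>\<^sup>+s. ennreal (norm (indicator {t<..} s *\<^sub>R ?D s)) \<partial>lborel)" by (rule nn_integral_completion)
  also have "\<dots> \<le> (\<integral>\<^sup>+s. 23 * (if t < s then ennreal (s powr (- (3/2)) * gauss s x) else 0) \<partial>lborel)"
  proof (intro nn_integral_mono)
    fix s
    have "ennreal \<bar>?D s\<bar> \<le> ennreal (23 * (s powr (- (3/2)) * gauss s x))" if "t < s"
      using abs_partial_deriv3_heat_kernel_le[of s l k j x] that t by (intro ennreal_leI) auto
    then show "ennreal (norm (indicator {t<..} s *\<^sub>R ?D s)) \<le> 23 * (if t < s then ennreal (s powr (- (3/2)) * gauss s x) else 0)"
      by (auto simp: indicator_def ennreal_mult)
  qed
  also have "\<dots> = 23 * (\<integral>\<^sup>+s. (if t < s then ennreal (s powr (- (3/2)) * gauss s x) else 0) \<partial>lborel)"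
    by (rule nn_integral_cmult) measurable
  finally have 2: "ennreal \<bar>LINT s:{t<..}|lebesgue. ?D s\<bar> \<le> \<dots>" .
  have 1: "ennreal \<bar>partial_deriv l (heat_kernel t) x * (if j = k then 1 else 0)\<bar> \<le> 23 * ennreal (t powr (- (1/2)) * gauss t x)"
    using abs_partial_deriv_heat_kernel_le[OF t, of l x] unfolding numeral_mult_ennreal
    by (subst numeral_mult_ennreal) (auto intro!: ennreal_leI simp: mult.assoc)
  have "ennreal \<bar>oseen_kernel l k j x t\<bar> \<le> ennreal (\<bar>partial_deriv l (heat_kernel t) x * (if j = k then 1 else 0)\<bar> + \<bar>LINT s:{t<..}|lebesgue. ?D s\<bar>)"
    unfolding oseen_kernel_def by (intro ennreal_leI abs_triangle_ineq)
  also have "\<dots> \<le> oseen_majorant t x"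
    unfolding oseen_majorant_def distrib_left using 1 2 by (simp add: add_mono)
  finally show ?thesis .
qed

text \<open>With \<kappa> = n/2 (1 - 1/r) the Gaussians in the integral over s > t have norms
  proportional to s^(-3/2-\<kappa>); integrating this power gives the denominator 1/2 + \<kappa> and
  the same rate t^(-1/2-\<kappa>) as for the first term.\<close>

definition oseen_const :: "'n::finite itself \<Rightarrow> real \<Rightarrow> real" where
  "oseen_const T r = 23 * (gauss_const T r + gauss_const T r / (1/2 + real CARD('n) / 2 * (1 - 1 / r)))"

lemma oseen_const_nonneg [simp]: "1 \<le> r \<Longrightarrow> 0 \<le> oseen_const T r"
  unfolding oseen_const_def
  by (intro mult_nonneg_nonneg add_nonneg_nonneg divide_nonneg_nonneg gauss_const_nonneg) auto

lemma nn_norm_oseen_majorant: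
  assumes r: "1 \<le> r" and t: "0 < t"
  shows "L_norm r (oseen_majorant t :: real ^ 'n::finite \<Rightarrow> ennreal)
    \<le> ennreal (oseen_const TYPE('n) r * t powr (- (1/2) - real CARD('n) / 2 * (1 - 1 / r)))"
proof -
  define \<kappa> where "\<kappa> = real CARD('n) / 2 * (1 - 1 / r)"
  have \<kappa>: "\<kappa> \<ge> 0" using r by (auto simp: \<kappa>_def)
  define c where "c = gauss_const TYPE('n) r"
  have c: "0 \<le> c" "\<And>s. 0 < s \<Longrightarrow>
    L_norm r (\<lambda>x :: real ^ 'n. ennreal (gauss s x)) = ennreal (c * s powr (- \<kappa>))"
    using nn_norm_gauss[of r, where 'n='n] r unfolding \<kappa>_def minus_mult_left c_def by auto
  have g: "L_norm r (\<lambda>x :: real ^ 'n. ennreal (s powr b * gauss s x)) = ennreal (c * s powr (b - \<kappa>))" if "0 < s" for s b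
  proof -
    have "L_norm r (\<lambda>x :: real ^ 'n. ennreal (s powr b * gauss s x)) = ennreal (s powr b) * ennreal (c * s powr (- \<kappa>))"
      using r by (simp add: ennreal_mult nn_norm_cmult c(2)[OF that])
    also have "\<dots> = ennreal (c * (s powr b * s powr (- \<kappa>)))" using c by (simp add: ennreal_mult[symmetric] mult_ac)
    also have "s powr b * s powr (- \<kappa>) = s powr (b - \<kappa>)" by (simp flip: powr_add)
    finally show ?thesis .
  qed
  let ?A = "\<lambda>x::real ^ 'n. ennreal (t powr (- (1/2)) * gauss t x)"
  let ?f = "\<lambda>s x::real ^ 'n. if t < s then ennreal (s powr (- (3/2)) * gauss s x) else 0"
  have A: "L_norm r ?A = ennreal (c * t powr (- (1/2) - \<kappa>))"
    by (rule g[OF t])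
  have f: "L_norm r (?f s) = ennreal c * (if t < s then ennreal (s powr - (3/2 + \<kappa>)) else 0)" for s
  proof (cases "t < s")
    case True
    then show ?thesis using t g[of s "-(3/2)"] c by (simp add: ennreal_mult)
  next
    case False
    then show ?thesis by (simp add: nn_norm_def)
  qed
  have "L_norm r (\<lambda>x::real ^ 'n. \<integral>\<^sup>+s. ?f s x \<partial>lborel) \<le> (\<integral>\<^sup>+s. L_norm r (?f s) \<partial>lborel)"
    using r by (intro Minkowski_integral sigma_finite_lborel) auto
  also have "\<dots> = ennreal c * (\<integral>\<^sup>+s. (if t < s then ennreal (s powr - (3/2 + \<kappa>)) else 0) \<partial>lborel)"
    unfolding f by (rule nn_integral_cmult) measurable
  also have "\<dots> \<le> ennreal c * ennreal (t powr (1 - (3/2 + \<kappa>)) / ((3/2 + \<kappa>) - 1))"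
    using \<kappa> t by (intro mult_left_mono nn_integral_powr_atLeast) auto
  also have "\<dots> = ennreal (c / (1/2 + \<kappa>) * t powr (- (1/2) - \<kappa>))"
  proof -
    have "1 - (3/2 + \<kappa>) = - (1/2) - \<kappa>" "(3/2 + \<kappa>) - 1 = 1/2 + \<kappa>" by simp_all
    then show ?thesis using c \<kappa> by (simp add: ennreal_mult[symmetric])
  qed
  finally have B: "L_norm r (\<lambda>x::real ^ 'n. \<integral>\<^sup>+s. ?f s x \<partial>lborel) \<le> \<dots>" .
  have "L_norm r (oseen_majorant t :: real ^ 'n \<Rightarrow> ennreal) = 23 * L_norm r (\<lambda>x. ?A x + (\<integral>\<^sup>+s. ?f s x \<partial>lborel))"
    unfolding oseen_majorant_def[abs_def] using r by (intro nn_norm_cmult) auto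
  also have "\<dots> \<le> 23 * (L_norm r ?A + L_norm r (\<lambda>x::real ^ 'n. \<integral>\<^sup>+s. ?f s x \<partial>lborel))"
    using r by (intro mult_left_mono nn_norm_add sigma_finite_lborel) auto
  also have "\<dots> \<le> 23 * (ennreal (c * t powr (- (1/2) - \<kappa>)) + ennreal (c / (1/2 + \<kappa>) * t powr (- (1/2) - \<kappa>)))"
    unfolding A by (intro mult_left_mono add_left_mono B) auto
  also have "\<dots> = ennreal (23 * (c + c / (1/2 + \<kappa>)) * t powr (- (1/2) - \<kappa>))"
    using c \<kappa> by (subst ennreal_plus[symmetric]) (auto simp: numeral_mult_ennreal distrib_right mult.assoc)
  finally show ?thesis unfolding \<kappa>_def c_def oseen_const_def .
qed

section \<open>The bilinear majorant operator\<close>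

abbreviation Borel_field :: "('a::topological_space \<Rightarrow> 'b::topological_space \<Rightarrow> ennreal) \<Rightarrow> bool" where
  "Borel_field U \<equiv> case_prod U \<in> borel_measurable (borel \<Otimes>\<^sub>M borel)"

text \<open>Almost every time is all that can be asked for, since \<open>X_norm\<close> is an
  essential supremum.\<close>

abbreviation decays :: "real \<Rightarrow> ennreal \<Rightarrow> real \<Rightarrow> (real \<Rightarrow> 'a::euclidean_space \<Rightarrow> ennreal) \<Rightarrow> bool" where
  "decays q E b f \<equiv> AE s in lborel. 0 < s \<longrightarrow> L_norm q (f s) \<le> E * ennreal (s powr - b)"

definition kato_op ::
    "(real \<Rightarrow> real ^ 'n::finite \<Rightarrow> ennreal) \<Rightarrow> (real \<Rightarrow> real ^ 'n \<Rightarrow> ennreal) \<Rightarrow> real \<Rightarrow> real ^ 'n \<Rightarrow> ennreal" where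
  "kato_op U f t x = (\<integral>\<^sup>+s. (if 0 < s \<and> s < t then
      \<integral>\<^sup>+y. oseen_majorant (t - s) (x - y) * (U s y * f s y) \<partial>lborel else 0) \<partial>lborel)"

lemma measurable_uncurry:
  "case_prod U \<in> borel_measurable (M \<Otimes>\<^sub>M N) \<Longrightarrow> f \<in> measurable L M \<Longrightarrow> g \<in> measurable L N \<Longrightarrow>
    (\<lambda>w. U (f w) (g w)) \<in> borel_measurable L"
  using measurable_compose[of "\<lambda>w. (f w, g w)" L "M \<Otimes>\<^sub>M N" "case_prod U"] by simp

lemma measurable_kato_op:
  fixes U f :: "real \<Rightarrow> real ^ 'n::finite \<Rightarrow> ennreal"
  assumes U: "Borel_field U"
    and f: "Borel_field f"
  shows "Borel_field (kato_op U f)"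
proof -
  note [measurable] = measurable_uncurry[OF U] measurable_uncurry[OF f]
  show ?thesis unfolding kato_op_def[abs_def] by measurable
qed

text \<open>Null sets disappear under the integral, so an inequality valid almost everywhere becomes
  one valid at every point after one application of \<open>kato_op\<close>. The induction in
  \<open>kato_op_iteration\<close> rests on this.\<close>

lemma kato_op_subadd:
  fixes U f g h :: "real \<Rightarrow> real ^ 'n::finite \<Rightarrow> ennreal"
  assumes U: "Borel_field U"
    and g: "Borel_field g"
    and h: "Borel_field h"
    and le: "AE s in lborel. 0 < s \<longrightarrow> (AE y in lborel. f s y \<le> g s y + h s y)"
  shows "kato_op U f t x \<le> kato_op U g t x + kato_op U h t x"
proof -
  note [measurable] = measurable_uncurry[OF U] measurable_uncurry[OF g] measurable_uncurry[OF h]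
  let ?o = "\<lambda>f s y. oseen_majorant (t - s) (x - y) * (U s y * f s y)"
  let ?K = "\<lambda>f s. if 0 < s \<and> s < t then \<integral>\<^sup>+y. ?o f s y \<partial>lborel else 0"
  have "kato_op U f t x \<le> (\<integral>\<^sup>+s. ?K g s + ?K h s \<partial>lborel)"
    unfolding kato_op_def
  proof (rule nn_integral_mono_AE, use le in eventually_elim)
    fix s assume le: "0 < s \<longrightarrow> (AE y in lborel. f s y \<le> g s y + h s y)"
    show "?K f s \<le> ?K g s + ?K h s"
    proof (cases "0 < s \<and> s < t")
      case True
      have "(\<integral>\<^sup>+y. ?o f s y \<partial>lborel) \<le>
        (\<integral>\<^sup>+y. ?o g s y + ?o h s y \<partial>lborel)"
      proof (rule nn_integral_mono_AE)
        have "AE y in lborel. f s y \<le> g s y + h s y" using le True by auto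
        then show "AE y in lborel. ?o f s y \<le>
          ?o g s y + ?o h s y"
          by eventually_elim (simp add: distrib_left[symmetric] mult_left_mono)
      qed
      also have "\<dots> = (\<integral>\<^sup>+y. ?o g s y \<partial>lborel) +
          (\<integral>\<^sup>+y. ?o h s y \<partial>lborel)"
        by (rule nn_integral_add) measurable
      finally show ?thesis using True by simp
    qed auto
  qed
  also have "\<dots> = kato_op U g t x + kato_op U h t x"
    unfolding kato_op_def by (rule nn_integral_add) measurable
  finally show ?thesis .
qed

lemma nn_norm_kato_op_le:
  fixes U f :: "real \<Rightarrow> real ^ 'n::finite \<Rightarrow> ennreal"
  assumes U: "Borel_field U"
    and f: "Borel_field f" and q: "1 \<le> q"
  shows "L_norm q (kato_op U f t) \<le> (\<integral>\<^sup>+s. (if 0 < s \<and> s < t then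
      L_norm q (\<lambda>x. \<integral>\<^sup>+y. oseen_majorant (t - s) (x - y) * (U s y * f s y) \<partial>lborel) else 0) \<partial>lborel)"
proof -
  note [measurable] = measurable_uncurry[OF U] measurable_uncurry[OF f]
  have "L_norm q (kato_op U f t) \<le> (\<integral>\<^sup>+s. L_norm q (\<lambda>x. if 0 < s \<and> s < t then
      \<integral>\<^sup>+y. oseen_majorant (t - s) (x - y) * (U s y * f s y) \<partial>lborel else 0) \<partial>lborel)"
    unfolding kato_op_def[abs_def]
    by (rule Minkowski_integral) (use q in \<open>auto intro: sigma_finite_lborel\<close>)
  also have "\<dots> = (\<integral>\<^sup>+s. (if 0 < s \<and> s < t then
      L_norm q (\<lambda>x. \<integral>\<^sup>+y. oseen_majorant (t - s) (x - y) * (U s y * f s y) \<partial>lborel) else 0) \<partial>lborel)"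
    by (intro nn_integral_cong) (auto simp: nn_norm_def)
  finally show ?thesis .
qed

definition bilinear_const :: "'n::finite itself \<Rightarrow> real" where
  "bilinear_const T = oseen_const T (2 * real CARD('n) / (2 * real CARD('n) - 1))"

text \<open>Hoelder against L^2n lowers the exponent q to p with 1/p = 1/q + 1/(2n), and Young with
  the exponent r conjugate to 2n brings it back to q. The price is \<tau>^(-1/2 - n/2 * 1/(2n)) =
  \<tau>^(-3/4), the same in every dimension.\<close>

lemma oseen_convolution_bound:
  fixes U f :: "real ^ 'n::finite \<Rightarrow> ennreal"
  assumes n: "2 \<le> CARD('n)" and [measurable]: "U \<in> borel_measurable borel" "f \<in> borel_measurable borel"
    and q: "2 \<le> q" and \<tau>: "0 < \<tau>"
  shows "0 \<le> bilinear_const TYPE('n)"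
    and "L_norm q (\<lambda>x. \<integral>\<^sup>+y. oseen_majorant \<tau> (x - y) * (U y * f y) \<partial>lborel) \<le>
      ennreal (bilinear_const TYPE('n) * \<tau> powr - (3/4)) * (L_norm (2 * real CARD('n)) U * L_norm q f)"
proof -
  define N where "N = real CARD('n)"
  have N: "N \<ge> 2" using n by (simp add: N_def)
  define r where "r = 2 * N / (2 * N - 1)"
  have r: "1 \<le> r" "r < 2" "1 / r = 1 - 1 / (2 * N)" using N by (auto simp: r_def field_simps)
  have c: "bilinear_const TYPE('n) = oseen_const TYPE('n) r" by (simp add: bilinear_const_def r_def N_def)
  then show "0 \<le> bilinear_const TYPE('n)" using r by simp
  have e: "- (1/2) - real CARD('n) / 2 * (1 - 1 / r) = - (3/4)" using N unfolding r(3) N_def by (simp add: field_simps)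
  define p where "p = 1 / (1 / q + 1 / (2 * N))"
  have p: "1 / p = 1 / (2 * N) + 1 / q" "0 < p" "p < q"
    using q N by (auto simp: p_def field_simps)
  have "L_norm q (\<lambda>x. \<integral>\<^sup>+y. oseen_majorant \<tau> (x - y) * (U y * f y) \<partial>lborel) \<le>
      L_norm r (oseen_majorant \<tau> :: real ^ 'n \<Rightarrow> ennreal) * L_norm p (\<lambda>y. U y * f y)"
    by (rule Young_convolution) (use p q r in auto)
  also have "\<dots> \<le> ennreal (bilinear_const TYPE('n) * \<tau> powr - (3/4)) * (L_norm (2 * N) U * L_norm q f)"
    using nn_norm_oseen_majorant[OF r(1) \<tau>, where 'n='n] unfolding e c
    by (intro mult_mono nn_norm_mult) (use p q N in auto)
  finally show "L_norm q (\<lambda>x. \<integral>\<^sup>+y. oseen_majorant \<tau> (x - y) * (U y * f y) \<partial>lborel) \<le>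
      ennreal (bilinear_const TYPE('n) * \<tau> powr - (3/4)) * (L_norm (2 * real CARD('n)) U * L_norm q f)"
    by (simp add: N_def)
qed

definition decay_const :: "'n::finite itself \<Rightarrow> real \<Rightarrow> real" where
  "decay_const T b = bilinear_const T * beta_const (3/4) (1/4 + b)"

text \<open>The exponents -3/4 of the kernel and -1/4 of U add up to -1, so the Beta integral
  reproduces exactly the weight t^(-b) of f. The condition b < 3/4 is integrability of s^(-1/4-b) at
  0.\<close>

lemma kato_op_decay:
  fixes U f :: "real \<Rightarrow> real ^ 'n::finite \<Rightarrow> ennreal"
  assumes n: "2 \<le> CARD('n)" and b: "0 \<le> b" "b < 3/4"
    and U: "Borel_field U"
    and f: "Borel_field f" and q: "2 \<le> q" and t: "0 < t"
    and E: "decays (2 * real CARD('n)) E (1/4) U"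
    and D: "decays q D b f"
  shows "L_norm q (kato_op U f t) \<le> ennreal (decay_const TYPE('n) b) * E * D * ennreal (t powr - b)"
proof -
  define c where "c = bilinear_const TYPE('n)"
  have c: "0 \<le> c" unfolding c_def by (rule oseen_convolution_bound[OF n, of "\<lambda>_. 0" "\<lambda>_. 0" 2 1]) auto
  define B where "B = beta_const (3/4) (1/4 + b)"
  have B: "B \<ge> 0" using b unfolding B_def beta_const_def by (intro add_nonneg_nonneg divide_nonneg_nonneg) auto
  note [measurable] = measurable_uncurry[OF U] measurable_uncurry[OF f]
  have "L_norm q (kato_op U f t) \<le> (\<integral>\<^sup>+s. (if 0 < s \<and> s < t then
    L_norm q (\<lambda>x. \<integral>\<^sup>+y. oseen_majorant (t - s) (x - y) * (U s y * f s y) \<partial>lborel) else 0) \<partial>lborel)"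
    using q by (intro nn_norm_kato_op_le U f) auto
  also have "\<dots> \<le> (\<integral>\<^sup>+s. (ennreal c * E * D) * (if 0 < s \<and> s < t then ennreal ((t - s) powr - (3/4) * s powr - (1/4 + b)) else 0) \<partial>lborel)"
  proof (rule nn_integral_mono_AE, use E D in eventually_elim)
    fix s assume E: "0 < s \<longrightarrow> L_norm (2 * real CARD('n)) (U s) \<le> E * ennreal (s powr - (1/4))"
     and D: "0 < s \<longrightarrow> L_norm q (f s) \<le> D * ennreal (s powr - b)"
    show "(if 0 < s \<and> s < t then L_norm q (\<lambda>x. \<integral>\<^sup>+y. oseen_majorant (t - s) (x - y) * (U s y * f s y) \<partial>lborel) else 0)
       \<le> (ennreal c * E * D) * (if 0 < s \<and> s < t then ennreal ((t - s) powr - (3/4) * s powr - (1/4 + b)) else 0)"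
    proof (cases "0 < s \<and> s < t")
      case True
      have "L_norm q (\<lambda>x. \<integral>\<^sup>+y. oseen_majorant (t - s) (x - y) * (U s y * f s y) \<partial>lborel)
        \<le> ennreal (c * (t - s) powr - (3/4)) * (L_norm (2 * real CARD('n)) (U s) * L_norm q (f s))"
        unfolding c_def using True q by (intro oseen_convolution_bound n) auto
      also have "\<dots> \<le> ennreal (c * (t - s) powr - (3/4)) * ((E * ennreal (s powr - (1/4))) * (D * ennreal (s powr - b)))"
        using E D True c by (intro mult_mono ennreal_leI) auto
      also have "\<dots> = (ennreal c * E * D) * (ennreal ((t - s) powr - (3/4)) * (ennreal (s powr - (1/4)) * ennreal (s powr - b)))"
        using c by (simp add: ennreal_mult mult_ac)
      also have "ennreal ((t - s) powr - (3/4)) * (ennreal (s powr - (1/4)) * ennreal (s powr - b)) = ennreal ((t - s) powr - (3/4) * s powr - (1/4 + b))"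
        by (simp add: ennreal_mult[symmetric] powr_add[symmetric])
      finally show ?thesis using True by simp
    qed auto
  qed
  also have "\<dots> = (ennreal c * E * D) * (\<integral>\<^sup>+s. (if 0 < s \<and> s < t then ennreal ((t - s) powr - (3/4) * s powr - (1/4 + b)) else 0) \<partial>lborel)"
    by (rule nn_integral_cmult) measurable
  also have "\<dots> \<le> (ennreal c * E * D) * ennreal (B * t powr (1 - 3/4 - (1/4 + b)))"
    unfolding B_def using b t by (intro mult_left_mono nn_integral_beta) auto
  also have "\<dots> = ennreal (c * B) * E * D * ennreal (t powr - b)"
    using c B by (simp add: ennreal_mult mult_ac)
  finally show ?thesis unfolding c_def B_def decay_const_def .
qed

text \<open>For U of this size \<open>kato_op U\<close> contracts by the factor 1/2 both with the
  weight b, as needed in L^2, and with the weight 1/4, as needed for the remainder in L^2n. The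
  \<open>max 0\<close> and the added 1 keep the denominator positive.\<close>

definition iteration_radius :: "'n::finite itself \<Rightarrow> real \<Rightarrow> real" where
  "iteration_radius T b = 1 / (2 * (max 0 (max (decay_const T b) (decay_const T (1/4))) + 1))"

lemma iteration_radius_pos [simp]: "0 < iteration_radius T b"
  by (simp add: iteration_radius_def)

text \<open>A subsolution of the majorant equation is dominated by the Neumann series \<open>\<Sum>j. (kato_op U)\<^sup>j h\<close>:
  the remainder \<open>(kato_op U)\<^sup>k U\<close> tends to zero in the norm \<open>X_norm\<close>. No finiteness of the
  $L^2$ norm of the subsolution is needed beforehand.\<close>

lemma kato_op_iteration:
  fixes U h :: "real \<Rightarrow> real ^ 'n::finite \<Rightarrow> ennreal" and b :: real
  defines "\<epsilon> \<equiv> iteration_radius TYPE('n) b"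
  assumes n: "2 \<le> CARD('n)" and b: "0 \<le> b" "b < 3/4"
    and U: "Borel_field U"
    and h: "Borel_field h" and t: "0 < t"
    and X: "decays (2 * real CARD('n)) (ennreal \<epsilon>) (1/4) U"
    and sub: "AE s in lborel. 0 < s \<longrightarrow> (AE x in lborel. U s x \<le> h s x + kato_op U U s x)"
    and hD: "\<And>s. 0 < s \<Longrightarrow> L_norm 2 (h s) \<le> D * ennreal (s powr - b)"
    and v: "AE x in lborel. v x \<le> h t x + kato_op U U t x"
  shows "L_norm 2 v \<le> 2 * D * ennreal (t powr - b)"
proof -
  let ?c = "decay_const TYPE('n)"
  have \<epsilon>: "\<epsilon> > 0" "max (?c b) (?c (1/4)) * \<epsilon> \<le> 1/2"
    by (auto simp: \<epsilon>_def iteration_radius_def divide_simps)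
  have \<epsilon>': "ennreal (?c b) * ennreal \<epsilon> \<le> ennreal (1/2)" "ennreal (?c (1/4)) * ennreal \<epsilon> \<le> ennreal (1/2)"
  proof -
    have "?c b * \<epsilon> \<le> 1/2" "?c (1/4) * \<epsilon> \<le> 1/2"
      by (rule order.trans[OF mult_right_mono \<epsilon>(2)]; use \<epsilon>(1) in simp)+
    then show "ennreal (?c b) * ennreal \<epsilon> \<le> ennreal (1/2)" "ennreal (?c (1/4)) * ennreal \<epsilon> \<le> ennreal (1/2)"
      using \<epsilon>(1) by (auto simp only: ennreal_mult''[symmetric] less_imp_le intro!: ennreal_leI)
  qed
  define H where "H j = (kato_op U ^^ j) h" for j
  define R where "R j = (kato_op U ^^ j) U" for j
  have HS: "H (Suc j) = kato_op U (H j)" and RS: "R (Suc j) = kato_op U (R j)" for j by (simp_all add: H_def R_def)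
  have H0: "H 0 = h" and R0: "R 0 = U" by (simp_all add: H_def R_def)
  have Hm: "Borel_field (H j)" for j
    by (induction j) (simp_all add: HS H0 h measurable_kato_op U)
  have Rm: "Borel_field (R j)" for j
    by (induction j) (simp_all add: RS R0 measurable_kato_op U)
  note [measurable] = measurable_uncurry[OF U] measurable_uncurry[OF h]
    measurable_uncurry[OF Hm] measurable_uncurry[OF Rm]
  have mono: "R (Suc j) s x \<le> H (Suc j) s x + R (Suc (Suc j)) s x"
    if "AE s in lborel. 0 < s \<longrightarrow> (AE x in lborel. R j s x \<le> H j s x + R (Suc j) s x)" for j s x
    using kato_op_subadd[OF U Hm[of j] Rm[of "Suc j"] that, of s x] by (simp only: HS RS)
  have step: "AE s in lborel. 0 < s \<longrightarrow> (AE x in lborel. R j s x \<le> H j s x + R (Suc j) s x)" for j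
  proof (induction j)
    case 0
    then show ?case using sub by (simp add: R_def H_def)
  next
    case (Suc j)
    show ?case using mono[OF Suc] by simp
  qed
  note step' = mono[OF step]
  \<comment> \<open>\<open>R 1\<close> is \<open>kato_op U U\<close>, so the left side is the right
    side of the inequality for v. The telescoping holds at every point, as all its steps come after
    one application of the operator.\<close>
  have part: "h s x + R 1 s x \<le> (\<Sum>j<Suc k. H j s x) + R (Suc k) s x" for s x k
  proof (induction k)
    case 0
    then show ?case by (simp add: H_def)
  next
    case (Suc k)
    then have "h s x + R 1 s x \<le> (\<Sum>j<Suc k. H j s x) + (H (Suc k) s x + R (Suc (Suc k)) s x)"
      using step'[of k s x] by (meson add_left_mono order.trans)
    then show ?case by (simp add: add.assoc)
  qed
  define S where "S x = (\<Sum>j. H j t x)" for x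
  have [measurable]: "S \<in> borel_measurable borel" unfolding S_def[abs_def] by measurable
  have RS_le: "L_norm (2 * real CARD('n)) (R (Suc k) s) \<le> ennreal \<epsilon> * ennreal (1/2) ^ Suc k * ennreal (s powr - (1/4))"
    if "0 < s" and k: "decays (2 * real CARD('n)) (ennreal \<epsilon> * ennreal (1/2) ^ k) (1/4) (R k)" for k s
  proof -
    have "L_norm (2 * real CARD('n)) (R (Suc k) s) \<le> ennreal (?c (1/4)) * ennreal \<epsilon> * (ennreal \<epsilon> * ennreal (1/2) ^ k) * ennreal (s powr - (1/4))"
      unfolding RS by (rule kato_op_decay[OF n]) (use U Rm n that X in auto)
    also have "\<dots> \<le> ennreal (1/2) * (ennreal \<epsilon> * ennreal (1/2) ^ k) * ennreal (s powr - (1/4))"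
      by (intro mult_right_mono \<epsilon>') auto
    finally show ?thesis by (simp add: mult_ac)
  qed
  have RX: "decays (2 * real CARD('n)) (ennreal \<epsilon> * ennreal (1/2) ^ k) (1/4) (R k)" for k
  proof (induction k)
    case 0 then show ?case using X by (simp add: R_def)
  next
    case (Suc k)
    then show ?case using RS_le[OF _ Suc] by auto
  qed
  have RX': "L_norm (2 * real CARD('n)) (R (Suc k) t) \<le> ennreal (\<epsilon> * (1/2) ^ Suc k * t powr - (1/4))" for k
  proof -
    have "ennreal ((1/2) ^ Suc k) = ennreal (1/2) ^ Suc k" by (rule ennreal_power[symmetric]) simp
    then have "ennreal (\<epsilon> * (1/2) ^ Suc k * t powr - (1/4)) = ennreal \<epsilon> * ennreal (1/2) ^ Suc k * ennreal (t powr - (1/4))"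
      using \<epsilon>(1) by (subst ennreal_mult, simp, simp, subst ennreal_mult) auto
    then show ?thesis using RS_le[OF t RX] by simp
  qed
  \<comment> \<open>The remainders are small in norm only and need not converge pointwise. Their
    infimum lies below each of them, so its norm is 0 and it vanishes almost everywhere.\<close>
  define I where "I x = (INF k. R (Suc k) t x)" for x
  have [measurable]: "I \<in> borel_measurable borel" unfolding I_def[abs_def] by measurable
  have "L_norm (2 * real CARD('n)) I \<le> ennreal (\<epsilon> * (1/2) ^ Suc k * t powr - (1/4))" for k
    using n by (intro order.trans[OF nn_norm_mono RX']) (auto simp: I_def intro!: INF_lower)
  moreover have "(\<lambda>k. ennreal (\<epsilon> * (1/2) ^ Suc k * t powr - (1/4))) \<longlonglongrightarrow> ennreal (\<epsilon> * 0 * t powr - (1/4))"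
    by (intro tendsto_ennrealI tendsto_intros LIMSEQ_Suc LIMSEQ_power_zero) auto
  ultimately have "L_norm (2 * real CARD('n)) I \<le> 0"
    by (intro LIMSEQ_le_const) auto
  then have I0: "AE x in lborel. I x = 0"
    using n by (intro nn_norm_eq_0_imp_AE) auto
  have "AE x in lborel. v x \<le> S x"
    using v I0
  proof eventually_elim
    fix x assume v: "v x \<le> h t x + kato_op U U t x" and I: "I x = 0"
    have "v x \<le> S x + R (Suc k) t x" for k
    proof -
      have "v x \<le> (\<Sum>j<Suc k. H j t x) + R (Suc k) t x"
        using v part[of t x k] by (simp add: R_def)
      also have "\<dots> \<le> S x + R (Suc k) t x"
        unfolding S_def by (intro add_right_mono sum_le_suminf) auto
      finally show ?thesis .
    qed
    then have "v x \<le> (INF k. S x + R (Suc k) t x)" by (intro INF_greatest) auto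
    also have "\<dots> = S x + I x" unfolding I_def by (rule INF_ennreal_const_add)
    finally show "v x \<le> S x" using I by simp
  qed
  then have "L_norm 2 v \<le> L_norm 2 S" by (intro nn_norm_mono_AE) auto
  also have "\<dots> \<le> (\<Sum>j. L_norm 2 (H j t))"
    unfolding S_def by (rule nn_norm_suminf) (auto intro: sigma_finite_lborel)
  also have "\<dots> \<le> (\<Sum>j. D * ennreal (t powr - b) * ennreal ((1/2) ^ j))"
  proof (intro suminf_le)
    fix j
    have "0 < s \<Longrightarrow> L_norm 2 (H j s) \<le> D * ennreal (1/2) ^ j * ennreal (s powr - b)" for s
    proof (induction j arbitrary: s)
      case 0 then show ?case using hD by (simp add: H_def)
    next
      case (Suc j)
      have "L_norm 2 (H (Suc j) s) \<le> ennreal (?c b) * ennreal \<epsilon> * (D * ennreal (1/2) ^ j) * ennreal (s powr - b)"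
        unfolding HS by (rule kato_op_decay[OF n]) (use U Hm Suc X b in auto)
      also have "\<dots> \<le> ennreal (1/2) * (D * ennreal (1/2) ^ j) * ennreal (s powr - b)"
        by (intro mult_right_mono \<epsilon>') auto
      finally show ?case by (simp add: mult_ac)
    qed
    from this[OF t] show "L_norm 2 (H j t) \<le> D * ennreal (t powr - b) * ennreal ((1/2) ^ j)"
      by (subst ennreal_power[symmetric]) (simp, simp only: mult_ac)
  qed auto
  also have "\<dots> = D * ennreal (t powr - b) * (\<Sum>j. ennreal ((1/2) ^ j))" by (rule ennreal_suminf_cmult)
  also have "(\<Sum>j. ennreal ((1/2) ^ j)) = ennreal (\<Sum>j. (1/2) ^ j)"
    by (rule suminf_ennreal2) (auto simp: summable_geometric)
  also have "(\<Sum>j. (1/2::real) ^ j) = 2" by (simp add: suminf_geometric)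
  finally show "L_norm 2 v \<le> 2 * D * ennreal (t powr - b)" by (simp add: mult_ac)
qed

section \<open>Decay of the heat semigroup\<close>

definition heat_majorant :: "(real ^ 'n::finite \<Rightarrow> ennreal) \<Rightarrow> real \<Rightarrow> real ^ 'n \<Rightarrow> ennreal" where
  "heat_majorant A t x = (\<integral>\<^sup>+y. ennreal (heat_kernel t (x - y)) * A y \<partial>lborel)"

text \<open>If a has mean zero, \<open>heat_kernel t x\<close> times the integral of a can be
  subtracted from the heat semigroup without changing it; the difference of kernels then yields a
  factor |y| and an additional decay t^(-1/2).\<close>

definition heat_diff_majorant :: "(real ^ 'n::finite \<Rightarrow> ennreal) \<Rightarrow> real \<Rightarrow> real ^ 'n \<Rightarrow> ennreal" where
  "heat_diff_majorant A t x = (\<integral>\<^sup>+y. ennreal \<bar>heat_kernel t (x - y) - heat_kernel t x\<bar> * A y \<partial>lborel)"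

lemma measurable_heat_kernel [measurable]:
  assumes [measurable]: "f \<in> borel_measurable M" "g \<in> borel_measurable M"
  shows "(\<lambda>x. heat_kernel (f x) (g x :: real ^ 'n::finite)) \<in> borel_measurable M"
  unfolding heat_kernel_def by measurable

lemma measurable_heat_majorant [measurable]:
  assumes [measurable]: "A \<in> borel_measurable borel" "f \<in> borel_measurable M" "g \<in> borel_measurable M"
  shows "(\<lambda>x. heat_majorant A (f x) (g x :: real ^ 'n::finite)) \<in> borel_measurable M"
  unfolding heat_majorant_def by measurable

lemma measurable_heat_diff_majorant [measurable]:
  assumes [measurable]: "A \<in> borel_measurable borel" "f \<in> borel_measurable M" "g \<in> borel_measurable M"
  shows "(\<lambda>x. heat_diff_majorant A (f x) (g x :: real ^ 'n::finite)) \<in> borel_measurable M"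
  unfolding heat_diff_majorant_def by measurable

lemma heat_majorant_le_gauss:
  assumes "0 < t"
  shows "heat_majorant A t x \<le> (\<integral>\<^sup>+y. ennreal (gauss t (x - y)) * A y \<partial>lborel)"
  unfolding heat_majorant_def using assms
  by (intro nn_integral_mono mult_right_mono ennreal_leI heat_kernel_le_gauss) auto

lemma convolution_commute:
  fixes G g :: "'a::euclidean_space \<Rightarrow> ennreal"
  assumes [measurable]: "G \<in> borel_measurable borel" "g \<in> borel_measurable borel"
  shows "(\<integral>\<^sup>+y. G (x - y) * g y \<partial>lborel) = (\<integral>\<^sup>+y. g (x - y) * G y \<partial>lborel)"
  using nn_integral_lborel_reflect[of "\<lambda>y. g (x - y) * G y" x] by (simp add: mult.commute)

lemma heat_majorant_L2:
  fixes A :: "real ^ 'n::finite \<Rightarrow> ennreal"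
  assumes [measurable]: "A \<in> borel_measurable borel" and t: "0 < t"
  shows "L_norm 2 (heat_majorant A t) \<le> ennreal (gauss_const TYPE('n) 1) * L_norm 2 A"
proof -
  have "L_norm 2 (heat_majorant A t) \<le> L_norm 2 (\<lambda>x. \<integral>\<^sup>+y. A (x - y) * ennreal (gauss t y) \<partial>lborel)"
    using heat_majorant_le_gauss[OF t] by (subst convolution_commute[symmetric]) (auto intro!: nn_norm_mono)
  also have "\<dots> \<le> L_norm 2 A * (\<integral>\<^sup>+y. ennreal (gauss t (y :: real ^ 'n)) \<partial>lborel)"
    by (rule nn_norm_convolution_L1) auto
  also have "(\<integral>\<^sup>+y. ennreal (gauss t (y :: real ^ 'n)) \<partial>lborel) = ennreal (gauss_const TYPE('n) 1)"
    using nn_norm_gauss[of 1 t, where 'n='n] t by (simp add: nn_norm_1)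
  finally show ?thesis by (simp add: mult.commute)
qed

lemma heat_majorant_L1_L2:
  fixes A :: "real ^ 'n::finite \<Rightarrow> ennreal"
  assumes [measurable]: "A \<in> borel_measurable borel" and t: "0 < t"
  shows "L_norm 2 (heat_majorant A t)
    \<le> ennreal (gauss_const TYPE('n) 2) * L_norm 1 A * ennreal (t powr (- (real CARD('n) / 4)))"
proof -
  have "L_norm 2 (heat_majorant A t) \<le> L_norm 2 (\<lambda>x :: real ^ 'n. ennreal (gauss t x)) * L_norm 1 A"
    unfolding nn_norm_1 using heat_majorant_le_gauss[OF t]
    by (intro order.trans[OF nn_norm_mono nn_norm_convolution_L1]) auto
  also have "\<dots> = ennreal (gauss_const TYPE('n) 2) * L_norm 1 A * ennreal (t powr (- (real CARD('n) / 4)))"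
    using nn_norm_gauss[of 2 t, where 'n='n] t by (simp add: ennreal_mult mult_ac)
  finally show ?thesis .
qed

definition subcritical_const :: "'n::finite itself \<Rightarrow> real" where
  "subcritical_const T = gauss_const T (4 * real CARD('n) / (4 * real CARD('n) - 3))"

lemma subcritical_const_nonneg [simp]: "0 \<le> subcritical_const T"
  by (simp add: subcritical_const_def)

text \<open>Young with 1/p = 1/2 + 3/(4n) and 1/r = 1 - 3/(4n): the Gaussian norm decays at the rate
  n/2 * 3/(4n) = 3/8, the same for all n.\<close>

lemma heat_majorant_Lq_L2:
  fixes A :: "real ^ 'n::finite \<Rightarrow> ennreal"
  assumes n: "2 \<le> CARD('n)" and [measurable]: "A \<in> borel_measurable borel" and t: "0 < t"
  shows "L_norm 2 (heat_majorant A t) \<le> ennreal (subcritical_const TYPE('n)) *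
    L_norm (4 * real CARD('n) / (3 + 2 * real CARD('n))) A * ennreal (t powr - (3/8))"
proof -
  define N where "N = real CARD('n)"
  have N: "N \<ge> 2" using n by (simp add: N_def)
  define r where "r = 4 * N / (4 * N - 3)"
  have r: "0 < r" "r < 2" "1 / r = 1 - 3 / (4 * N)" using N by (auto simp: r_def field_simps)
  define p where "p = 4 * N / (3 + 2 * N)"
  have p: "0 < p" "p < 2" "1 / p = 1 / 2 + 3 / (4 * N)" using N by (auto simp: p_def field_simps)
  have c: "subcritical_const TYPE('n) = gauss_const TYPE('n) r" by (simp add: subcritical_const_def r_def N_def)
  have e: "- (real CARD('n) / 2) * (1 - 1 / r) = - (3/8)" using N unfolding r(3) N_def by (simp add: field_simps)
  have "L_norm 2 (heat_majorant A t) \<le> L_norm r (\<lambda>x :: real ^ 'n. ennreal (gauss t x)) * L_norm p A"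
    using heat_majorant_le_gauss[OF t] p r
    by (intro order.trans[OF nn_norm_mono Young_convolution]) auto
  also have "\<dots> = ennreal (subcritical_const TYPE('n)) * L_norm p A * ennreal (t powr - (3/8))"
    unfolding nn_norm_gauss[OF r(1) t] e c by (simp add: ennreal_mult mult_ac)
  finally show ?thesis by (simp add: p_def N_def)
qed

text \<open>With E the kernel, the square is expanded and the cross term computed exactly: the
  parallelogram identity gives E(x-y) E(x) = e E(x-y/2)^2 with e = exp(-|y|^2/(8t)). The squared
  norm is thus 2 (1 - e) S, and 1 - e is at most |y|^2/(8t).\<close>

lemma nn_norm_heat_kernel_diff:
  fixes y :: "real ^ 'n::finite"
  assumes t: "0 < t"
  shows "L_norm 2 (\<lambda>x. ennreal \<bar>heat_kernel t (x - y) - heat_kernel t x\<bar>) \<le>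
    ennreal (norm y * t powr (- (1/2))) * L_norm 2 (\<lambda>x :: real ^ 'n. ennreal (heat_kernel t x))"
proof -
  let ?E = "heat_kernel t :: real ^ 'n \<Rightarrow> real"
  let ?S = "L_norm 2 (\<lambda>x. ennreal (?E x))"
  let ?n = "ennreal (norm y * t powr (- (1/2)))"
  let ?z = "\<lambda>x. (norm (x - y /\<^sub>R 2))\<^sup>2"
  define S where "S = (\<integral>\<^sup>+x. ennreal ((?E x)\<^sup>2) \<partial>lborel)"
  have S2: "S = (?S)\<^sup>2"
    by (simp add: nn_norm_2_squared S_def ennreal_power)
  have "?S \<le> L_norm 2 (\<lambda>x :: real ^ 'n. ennreal (gauss t x))"
    by (intro nn_norm_mono ennreal_leI heat_kernel_le_gauss t) auto
  also have "\<dots> < top" using nn_norm_gauss[of 2 t, where 'n='n] t by simp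
  finally have "S < top" unfolding S2 by (simp add: power_less_top_ennreal)
  then obtain \<sigma> where \<sigma>: "S = ennreal \<sigma>" "0 \<le> \<sigma>" by (cases S) auto
  define I where "I = (\<integral>\<^sup>+x. ennreal ((?E (x - y) - ?E x)\<^sup>2) \<partial>lborel)"
  define e where "e = exp (- (norm y)\<^sup>2 / (8 * t))"
  have prod: "?E (x - y) * ?E x = e * (?E (x - y /\<^sub>R 2))\<^sup>2" for x
  proof -
    have "(norm (x - y))\<^sup>2 + (norm x)\<^sup>2 = 2 * ?z x + (norm y)\<^sup>2 / 2"
      by (simp add: power2_norm_eq_inner inner_diff inner_commute field_simps)
    then have "(norm (x - y))\<^sup>2 = 2 * ?z x + (norm y)\<^sup>2 / 2 - (norm x)\<^sup>2" by simp
    then have "- (norm (x - y))\<^sup>2 / (4 * t) + - (norm x)\<^sup>2 / (4 * t) = - (norm y)\<^sup>2 / (8 * t) + 2 * (- ?z x / (4 * t))"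
      using t by (simp only:) (simp add: field_simps)
    then have "exp (- (norm (x - y))\<^sup>2 / (4 * t)) * exp (- (norm x)\<^sup>2 / (4 * t)) = e * (exp (- ?z x / (4 * t)))\<^sup>2"
      unfolding e_def exp_add[symmetric] exp_double[symmetric] by simp
    then show ?thesis unfolding heat_kernel_def by (simp add: power2_eq_square mult_ac)
  qed
  \<comment> \<open>Extended numbers do not cancel, so the cross term is kept on the left until I is
    known to be finite; only then the identity is solved for I over the reals.\<close>
  have "I + ennreal (2 * e) * S = (\<integral>\<^sup>+x. ennreal ((?E (x - y) - ?E x)\<^sup>2) + ennreal (2 * e) * ennreal ((?E (x - y /\<^sub>R 2))\<^sup>2) \<partial>lborel)"
    unfolding I_def S_def using nn_integral_lborel_translate[of "\<lambda>x. ennreal ((?E x)\<^sup>2)" "y /\<^sub>R 2"]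
    by (simp add: nn_integral_add nn_integral_cmult)
  also have "\<dots> = (\<integral>\<^sup>+x. ennreal ((?E (x - y))\<^sup>2) + ennreal ((?E x)\<^sup>2) \<partial>lborel)"
  proof (intro nn_integral_cong)
    fix x :: "real ^ 'n"
    have "(?E (x - y) - ?E x)\<^sup>2 + 2 * e * (?E (x - y /\<^sub>R 2))\<^sup>2 = (?E (x - y))\<^sup>2 + (?E x)\<^sup>2"
      using prod[of x] by (simp add: power2_diff)
    then show "ennreal ((?E (x - y) - ?E x)\<^sup>2) + ennreal (2 * e) * ennreal ((?E (x - y /\<^sub>R 2))\<^sup>2) = ennreal ((?E (x - y))\<^sup>2) + ennreal ((?E x)\<^sup>2)"
      by (simp add: ennreal_mult[symmetric] ennreal_plus[symmetric] e_def del: ennreal_plus)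
  qed
  also have "\<dots> = S + S"
    unfolding S_def using nn_integral_lborel_translate[of "\<lambda>x. ennreal ((?E x)\<^sup>2)" y]
    by (simp add: nn_integral_add)
  finally have eq: "I + ennreal (2 * e * \<sigma>) = ennreal (2 * \<sigma>)"
    using \<sigma> by (simp add: ennreal_mult[symmetric] ennreal_plus[symmetric] e_def del: ennreal_plus)
  then have "I \<noteq> top" by auto
  then obtain i where i: "I = ennreal i" "i \<ge> 0" by (cases I) auto
  have "i + 2 * e * \<sigma> = 2 * \<sigma>"
    using eq \<sigma> i by (simp add: ennreal_plus[symmetric] e_def del: ennreal_plus)
  then have "i = 2 * \<sigma> * (1 - e)" by (simp add: algebra_simps)
  also have "1 - e \<le> (norm y)\<^sup>2 / (8 * t)"
    using exp_ge_add_one_self[of "- (norm y)\<^sup>2 / (8 * t)"] by (simp add: e_def)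
  then have "2 * \<sigma> * (1 - e) \<le> 2 * \<sigma> * ((norm y)\<^sup>2 / (8 * t))" using \<sigma> by (intro mult_left_mono) auto
  also have "\<dots> \<le> (norm y)\<^sup>2 / t * \<sigma>" using t \<sigma> by (simp add: field_simps)
  finally have "I \<le> ennreal ((norm y)\<^sup>2 / t * \<sigma>)" using i by (simp add: ennreal_leI)
  also have "\<dots> = ennreal ((norm y * t powr (- (1/2)))\<^sup>2) * S"
  proof -
    have "(t powr (- (1/2)))\<^sup>2 = 1 / t" using t by (simp add: power2_eq_square powr_add[symmetric] powr_minus_divide)
    then show ?thesis using \<sigma> t by (simp add: ennreal_mult[symmetric] power_mult_distrib)
  qed
  also have "\<dots> = (?n * ?S)\<^sup>2"
    by (simp add: S2 power_mult_distrib ennreal_power)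
  finally have "(\<integral>\<^sup>+x. (ennreal \<bar>?E (x - y) - ?E x\<bar>) powr\<^sub>e 2 \<partial>lborel) \<le> (?n * ?S) powr\<^sub>e 2"
    unfolding I_def ennreal_powr_two by (simp add: ennreal_power)
  then have "L_norm 2 (\<lambda>x. ennreal \<bar>?E (x - y) - ?E x\<bar>) \<le> ((?n * ?S) powr\<^sub>e 2) powr\<^sub>e (1/2)"
    unfolding nn_norm_def by (intro ennreal_powr_mono) auto
  then show ?thesis by (simp add: ennreal_powr_powr)
qed

lemma heat_diff_majorant_L2:
  fixes A :: "real ^ 'n::finite \<Rightarrow> ennreal"
  assumes [measurable]: "A \<in> borel_measurable borel" and t: "0 < t"
  shows "L_norm 2 (heat_diff_majorant A t) \<le> ennreal (gauss_const TYPE('n) 2) *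
    (\<integral>\<^sup>+y. ennreal (norm y) * A y \<partial>lborel) * ennreal (t powr (- (real CARD('n) + 2) / 4))"
proof -
  define c where "c = gauss_const TYPE('n) 2"
  have c: "0 \<le> c" by (simp add: c_def)
  have E: "L_norm 2 (\<lambda>x :: real ^ 'n. ennreal (heat_kernel t x)) \<le> ennreal (c * t powr (- (real CARD('n) / 4)))"
  proof -
    have "L_norm 2 (\<lambda>x :: real ^ 'n. ennreal (heat_kernel t x)) \<le> L_norm 2 (\<lambda>x :: real ^ 'n. ennreal (gauss t x))"
      by (intro nn_norm_mono ennreal_leI heat_kernel_le_gauss t) auto
    also have "\<dots> \<le> ennreal (c * t powr (- (real CARD('n) / 4)))"
      using nn_norm_gauss[of 2 t, where 'n='n] t by (simp add: c_def)
    finally show ?thesis .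
  qed
  have "L_norm 2 (heat_diff_majorant A t) \<le> (\<integral>\<^sup>+y. L_norm 2 (\<lambda>x. ennreal \<bar>heat_kernel t (x - y) - heat_kernel t x\<bar> * A y) \<partial>lborel)"
    unfolding heat_diff_majorant_def[abs_def] by (rule Minkowski_integral) (auto intro: sigma_finite_lborel)
  also have "\<dots> \<le> (\<integral>\<^sup>+y. ennreal c * ennreal (t powr (- (real CARD('n) + 2) / 4)) * (ennreal (norm y) * A y) \<partial>lborel)"
  proof (intro nn_integral_mono)
    fix y :: "real ^ 'n"
    have "L_norm 2 (\<lambda>x. A y * ennreal \<bar>heat_kernel t (x - y) - heat_kernel t x\<bar>) = A y * L_norm 2 (\<lambda>x. ennreal \<bar>heat_kernel t (x - y) - heat_kernel t x\<bar>)"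
      by (rule nn_norm_cmult) auto
    also have "\<dots> \<le> A y * (ennreal (norm y * t powr (- (1/2))) * ennreal (c * t powr (- (real CARD('n) / 4))))"
      by (intro mult_left_mono order.trans[OF nn_norm_heat_kernel_diff[OF t]] E) auto
    also have "ennreal (norm y * t powr (- (1/2))) * ennreal (c * t powr (- (real CARD('n) / 4))) =
        ennreal c * ennreal (norm y) * ennreal (t powr (- (real CARD('n) + 2) / 4))"
    proof -
      have "- (1/2) + - (real CARD('n) / 4) = - (real CARD('n) + 2) / 4" by (simp add: field_simps)
      then have "t powr (- (1/2)) * t powr (- (real CARD('n) / 4)) = t powr (- (real CARD('n) + 2) / 4)"
        by (simp only: powr_add[symmetric])
      then have "(norm y * t powr (- (1/2))) * (c * t powr (- (real CARD('n) / 4))) = c * norm y * t powr (- (real CARD('n) + 2) / 4)"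
        by (simp add: mult_ac)
      then show ?thesis using c
        by (simp only: ennreal_mult[symmetric] mult_nonneg_nonneg norm_ge_zero powr_ge_zero add_nonneg_nonneg zero_le_one)
    qed
    finally show "L_norm 2 (\<lambda>x. ennreal \<bar>heat_kernel t (x - y) - heat_kernel t x\<bar> * A y) \<le>
       ennreal c * ennreal (t powr (- (real CARD('n) + 2) / 4)) * (ennreal (norm y) * A y)"
      by (simp add: mult_ac)
  qed
  also have "\<dots> = ennreal c * ennreal (t powr (- (real CARD('n) + 2) / 4)) * (\<integral>\<^sup>+y. ennreal (norm y) * A y \<partial>lborel)"
    by (rule nn_integral_cmult) measurable
  finally show ?thesis by (simp add: c_def mult_ac)
qed

section \<open>Integrable solenoidal fields have mean zero\<close>

lemma lborel_integral_translate:
  fixes f :: "'a::euclidean_space \<Rightarrow> real"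
  assumes [measurable]: "f \<in> borel_measurable borel"
  shows "integrable lborel (\<lambda>x. f (c + x)) \<longleftrightarrow> integrable lborel f" "(\<integral>x. f (c + x) \<partial>lborel) = (\<integral>x. f x \<partial>lborel)"
proof -
  have "integrable lborel f \<longleftrightarrow> integrable (distr lborel borel ((+) c)) f" by (simp add: lborel_distr_plus)
  also have "\<dots> \<longleftrightarrow> integrable lborel (\<lambda>x. f (c + x))" by (subst integrable_distr_eq) auto
  finally show "integrable lborel (\<lambda>x. f (c + x)) \<longleftrightarrow> integrable lborel f" by simp
  have "(\<integral>x. f x \<partial>lborel) = (\<integral>x. f x \<partial>distr lborel borel ((+) c))" by (simp add: lborel_distr_plus)
  also have "\<dots> = (\<integral>x. f (c + x) \<partial>lborel)" by (subst integral_distr) auto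
  finally show "(\<integral>x. f (c + x) \<partial>lborel) = (\<integral>x. f x \<partial>lborel)" by simp
qed

lemma partial_deriv_has_derivative_line:
  fixes g :: "real ^ 'n::finite \<Rightarrow> real"
  assumes "\<And>x. g differentiable (at x)"
  shows "((\<lambda>s. g (x + s *\<^sub>R axis l 1)) has_real_derivative partial_deriv l g (x + s *\<^sub>R axis l 1)) (at s)"
proof -
  let ?e = "axis l 1 :: real ^ 'n"
  let ?D = "frechet_derivative g (at (x + s *\<^sub>R ?e))"
  have D: "(g has_derivative ?D) (at (x + s *\<^sub>R ?e))"
    using assms frechet_derivative_works by blast
  have "((\<lambda>s. x + s *\<^sub>R ?e) has_derivative (\<lambda>h. h *\<^sub>R ?e)) (at s)"
    by (auto intro!: derivative_eq_intros)
  from diff_chain_at[OF this, of g ?D] D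
  have "((\<lambda>s. g (x + s *\<^sub>R ?e)) has_derivative (\<lambda>h. ?D (h *\<^sub>R ?e))) (at s)"
    by (simp add: o_def)
  moreover have "(\<lambda>h. ?D (h *\<^sub>R ?e)) = (*) (?D ?e)"
    using linear_scale[OF has_derivative_linear[OF D]] by (auto simp: fun_eq_iff mult.commute)
  ultimately show ?thesis by (simp add: has_field_derivative_def partial_deriv_def)
qed

text \<open>By translation invariance the integrals of all difference quotients vanish.\<close>

lemma integral_partial_deriv_eq_0:
  fixes g :: "real ^ 'n::finite \<Rightarrow> real"
  assumes d: "\<And>x. g differentiable (at x)" and c: "continuous_on UNIV (partial_deriv l g)"
    and supp: "\<And>x. r < norm x \<Longrightarrow> g x = 0"
  shows "integrable lborel (partial_deriv l g)" "(\<integral>x. partial_deriv l g x \<partial>lborel) = 0"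
proof -
  let ?e = "axis l 1 :: real ^ 'n"
  have gc: "continuous_on UNIV g"
    using d differentiable_imp_continuous_within by (auto simp: continuous_on_eq_continuous_within)
  then have [measurable]: "g \<in> borel_measurable borel" by (rule borel_measurable_continuous_onI)
  have [measurable]: "partial_deriv l g \<in> borel_measurable borel" using c by (rule borel_measurable_continuous_onI)
  have D0: "partial_deriv l g x = 0" if "r < norm x" for x
  proof -
    have "open {x :: real ^ 'n. r < norm x}" by (intro open_Collect_less continuous_intros)
    then have "(g has_derivative (\<lambda>_. 0)) (at x)"
      using that supp by (intro has_derivative_transform_within_open[of "\<lambda>_. 0" "\<lambda>_. 0" x UNIV "{x. r < norm x}" g]) auto
    from partial_deriv_eqI[OF this] show ?thesis by simp
  qed
  have "bounded (partial_deriv l g ` cball 0 r)"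
    by (intro compact_imp_bounded compact_continuous_image) (auto intro: continuous_on_subset[OF c])
  then obtain B where "\<forall>x\<in>cball 0 r. \<bar>partial_deriv l g x\<bar> \<le> B"
    by (auto simp: bounded_iff)
  then have B: "norm x \<le> r \<Longrightarrow> \<bar>partial_deriv l g x\<bar> \<le> B" for x by simp
  define C where "C = max B 0"
  have C: "\<bar>partial_deriv l g x\<bar> \<le> C" for x using B[of x] D0[of x] by (cases "norm x \<le> r") (auto simp: C_def)
  define h where "h k = 1 / real (Suc k)" for k
  have h: "0 < h k" "h k \<le> 1" for k by (auto simp: h_def)
  define q where "q k x = (g (h k *\<^sub>R ?e + x) - g x) / h k" for k x
  have [measurable]: "q k \<in> borel_measurable borel" for k unfolding q_def[abs_def] by measurable
  \<comment> \<open>The dominating function: C bounds the quotients by the mean value theorem, and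
    since h k is at most 1 the shifted support stays in the ball of radius r + 1.\<close>
  have q_bound: "norm (q k x) \<le> C * indicator (cball 0 (r + 1)) x" for k x
  proof (cases "norm x \<le> r + 1")
    case True
    have "\<exists>z. 0 < z \<and> z < h k \<and> g (x + h k *\<^sub>R ?e) - g (x + 0 *\<^sub>R ?e) = (h k - 0) * partial_deriv l g (x + z *\<^sub>R ?e)"
      using h by (intro MVT2[of 0 "h k" "\<lambda>s. g (x + s *\<^sub>R ?e)"] partial_deriv_has_derivative_line d) auto
    then obtain z where "g (x + h k *\<^sub>R ?e) - g x = h k * partial_deriv l g (x + z *\<^sub>R ?e)" by auto
    then have "q k x = partial_deriv l g (x + z *\<^sub>R ?e)" using h[of k] by (simp add: q_def add.commute)
    then show ?thesis using C True by simp
  next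
    case False
    have "norm (h k *\<^sub>R ?e + x) \<ge> norm x - norm (h k *\<^sub>R ?e)" by (metis add.commute norm_diff_ineq)
    moreover have "norm (h k *\<^sub>R ?e) \<le> 1" using h[of k] by simp
    ultimately have "g (h k *\<^sub>R ?e + x) = 0" using False by (intro supp) linarith
    moreover have "g x = 0" using False by (intro supp) linarith
    ultimately show ?thesis by (auto simp: q_def C_def)
  qed
  have q_lim: "(\<lambda>k. q k x) \<longlonglongrightarrow> partial_deriv l g x" for x
  proof -
    have "((\<lambda>s. (g (x + (0 + s) *\<^sub>R ?e) - g (x + 0 *\<^sub>R ?e)) / s) \<longlongrightarrow> partial_deriv l g (x + 0 *\<^sub>R ?e)) (at 0)"
      using partial_deriv_has_derivative_line[OF d, of x l 0] unfolding DERIV_def .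
    moreover have "h \<longlonglongrightarrow> 0" unfolding h_def by (intro LIMSEQ_Suc lim_1_over_n)
    then have "filterlim h (at 0) sequentially"
      unfolding filterlim_at using h by (auto simp: less_le)
    ultimately have "(\<lambda>k. (g (x + (0 + h k) *\<^sub>R ?e) - g (x + 0 *\<^sub>R ?e)) / h k) \<longlonglongrightarrow> partial_deriv l g (x + 0 *\<^sub>R ?e)"
      by (rule filterlim_compose)
    then show ?thesis by (simp add: q_def add.commute)
  qed
  have fin: "emeasure lborel (cball 0 \<rho> :: (real ^ 'n) set) < top" for \<rho>
    using emeasure_bounded_finite[OF bounded_cball] by simp
  have dom: "integrable lborel (\<lambda>x::real ^ 'n. C * indicator (cball 0 (r + 1)) x)"
    by (intro integrable_mult_right integrable_real_indicator) (auto simp: fin)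
  show "integrable lborel (partial_deriv l g)"
    by (rule integrable_dominated_convergence[where s=q and w="\<lambda>x. C * indicator (cball 0 (r + 1)) x"])
      (use dom q_bound q_lim in auto)
  have lim: "(\<lambda>k. \<integral>x. q k x \<partial>lborel) \<longlonglongrightarrow> (\<integral>x. partial_deriv l g x \<partial>lborel)"
    by (rule integral_dominated_convergence[where w="\<lambda>x. C * indicator (cball 0 (r + 1)) x"])
      (use dom q_bound q_lim in auto)
  have g_int: "integrable lborel g"
  proof -
    have "bounded (g ` cball 0 r)"
      by (intro compact_imp_bounded compact_continuous_image) (auto intro: continuous_on_subset[OF gc])
    then obtain b where "\<forall>x\<in>cball 0 r. \<bar>g x\<bar> \<le> b" by (auto simp: bounded_iff)
    then have b: "norm x \<le> r \<Longrightarrow> \<bar>g x\<bar> \<le> b" for x by simp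
    show ?thesis
    proof (rule Bochner_Integration.integrable_bound)
      show "integrable lborel (\<lambda>x::real ^ 'n. max b 0 * indicator (cball 0 r) x)"
        by (intro integrable_mult_right integrable_real_indicator) (auto simp: fin)
      have "norm (g x) \<le> norm (max b 0 * indicator (cball 0 r) x)" for x
        using b[of x] supp[of x] by (cases "norm x \<le> r") auto
      then show "AE x in lborel. norm (g x) \<le> norm (max b 0 * indicator (cball 0 r) x)" by simp
    qed auto
  qed
  have "(\<integral>x. q k x \<partial>lborel) = 0" for k
    unfolding q_def using g_int lborel_integral_translate[of g "h k *\<^sub>R ?e"]
    by (simp add: Bochner_Integration.integral_diff)
  then show "(\<integral>x. partial_deriv l g x \<partial>lborel) = 0"
    using lim LIMSEQ_unique[of "\<lambda>k. 0" 0] by auto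
qed

lemma smooth_differentiable:
  assumes "smooth f"
  shows "f differentiable (at x)" "partial_deriv l f differentiable (at x)"
proof -
  have "foldr partial_deriv [] f differentiable_on UNIV" "foldr partial_deriv [l] f differentiable_on UNIV"
    using assms unfolding smooth_def by blast+
  then show "f differentiable (at x)" "partial_deriv l f differentiable (at x)"
    by (simp_all add: differentiable_on_def)
qed

text \<open>The gradient of \<open>x $ j * exp (- \<delta> * (norm x)\<^sup>2)\<close>; it tends to \<open>axis j 1\<close> as \<open>\<delta>\<close> tends to 0.\<close>

definition moment_grad :: "real \<Rightarrow> 'n \<Rightarrow> real ^ 'n::finite \<Rightarrow> real ^ 'n" where
  "moment_grad \<delta> j x = exp (- \<delta> * (norm x)\<^sup>2) *\<^sub>R (axis j 1 - (2 * \<delta> * x $ j) *\<^sub>R x)"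

lemma measurable_moment_grad [measurable]: "moment_grad \<delta> j \<in> borel_measurable borel"
  unfolding moment_grad_def[abs_def]
  by (intro borel_measurable_continuous_onI continuous_intros)

text \<open>Half of the Gaussian exponent absorbs the quadratic factor, since 1 + 2 z is at most 4
  (1 + z/2), hence at most 4 exp (z/2). The bound gives membership in every L^p for \<delta> > 0 and
  the bound 4 uniformly in \<delta>.\<close>

lemma norm_moment_grad_le:
  assumes "0 \<le> \<delta>"
  shows "norm (moment_grad \<delta> j x) \<le> 4 * exp (- (\<delta> / 2) * (norm x)\<^sup>2)"
proof -
  define z where "z = \<delta> * (norm x)\<^sup>2"
  have z: "z \<ge> 0" using assms by (simp add: z_def)
  have "norm (axis j 1 - (2 * \<delta> * x $ j) *\<^sub>R x) \<le> norm (axis j (1::real)) + norm ((2 * \<delta> * x $ j) *\<^sub>R x)"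
    by (rule norm_triangle_ineq4)
  also have "\<dots> \<le> 1 + 2 * \<delta> * norm x * norm x"
    using assms component_le_norm_cart[of x j] by (auto simp: abs_mult intro!: mult_right_mono mult_left_mono)
  also have "\<dots> \<le> 4 * (1 + z / 2)" using z by (simp add: z_def power2_eq_square mult_ac)
  also have "\<dots> \<le> 4 * exp (z / 2)" by (intro mult_left_mono exp_ge_add_one_self) auto
  finally have "norm (moment_grad \<delta> j x) \<le> exp (- z) * (4 * exp (z / 2))"
    unfolding moment_grad_def by (simp add: z_def)
  also have "\<dots> = 4 * exp (- (\<delta> / 2) * (norm x)\<^sup>2)" by (simp add: z_def exp_add[symmetric])
  finally show ?thesis .
qed

lemma norm_inner_moment_grad_le:
  assumes "0 \<le> \<delta>"
  shows "norm (v \<bullet> moment_grad \<delta> j x) \<le> 4 * norm v"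
proof -
  have "norm (moment_grad \<delta> j x) \<le> 4 * exp (- (\<delta> / 2) * (norm x)\<^sup>2)" using assms by (rule norm_moment_grad_le)
  also have "\<dots> \<le> 4 * 1" using assms by (intro mult_left_mono) auto
  finally have "norm v * norm (moment_grad \<delta> j x) \<le> norm v * 4" by (intro mult_left_mono) auto
  then show ?thesis using Cauchy_Schwarz_ineq2[of v "moment_grad \<delta> j x"] by simp
qed

text \<open>With \<Phi> = x_j exp(-\<delta> |x|^2) the integrand is the inner product of \<psi> with
  the gradient of \<Phi>. As \<psi> is divergence-free, this is the divergence of the compactly
  supported field \<Phi> \<psi>.\<close>

lemma integral_test_field_moment_grad:
  assumes \<psi>: "\<psi> \<in> test_fields_sigma"
  shows "integrable lborel (\<lambda>x :: real ^ 'n::finite. \<psi> x \<bullet> moment_grad \<delta> j x)"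
    "(\<integral>x. \<psi> x \<bullet> moment_grad \<delta> j x \<partial>lborel) = 0"
proof -
  define \<Phi> where "\<Phi> x = x $ j * exp (- \<delta> * (x \<bullet> x))" for x :: "real ^ 'n"
  have \<psi>s: "smooth \<psi>" and div: "\<And>x. divergence \<psi> x = 0" and "compact (closure {x. \<psi> x \<noteq> 0})"
    using \<psi> by (auto simp: test_fields_sigma_def)
  then have "bounded {x. \<psi> x \<noteq> 0}" using compact_closure by blast
  then obtain r where r: "\<And>x. \<psi> x \<noteq> 0 \<Longrightarrow> norm x \<le> r" by (auto simp: bounded_iff)
  have \<psi>d: "(\<psi> has_derivative frechet_derivative \<psi> (at x)) (at x)" for x
    using smooth_differentiable(1)[OF \<psi>s] frechet_derivative_works by blast
  have \<psi>l: "((\<lambda>y. \<psi> y $ l) has_derivative (\<lambda>h. frechet_derivative \<psi> (at x) h $ l)) (at x)" for x l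
    by (rule bounded_linear.has_derivative[OF bounded_linear_vec_nth \<psi>d])
  have \<Phi>d: "(\<Phi> has_derivative (\<lambda>h. h \<bullet> moment_grad \<delta> j x)) (at x)" for x
  proof -
    have "(\<Phi> has_derivative (\<lambda>h. x $ j * (exp (- \<delta> * (x \<bullet> x)) * (- \<delta> * (2 * (x \<bullet> h)))) + h $ j * exp (- \<delta> * (x \<bullet> x)))) (at x)"
      unfolding \<Phi>_def by (auto intro!: derivative_eq_intros bounded_linear_vec_nth bounded_linear_imp_has_derivative
        simp: fun_eq_iff inner_commute)
    moreover have "(\<lambda>h. x $ j * (exp (- \<delta> * (x \<bullet> x)) * (- \<delta> * (2 * (x \<bullet> h)))) + h $ j * exp (- \<delta> * (x \<bullet> x))) = (\<lambda>h. h \<bullet> moment_grad \<delta> j x)"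
      by (auto simp: moment_grad_def fun_eq_iff inner_diff_right inner_axis power2_norm_eq_inner inner_commute algebra_simps)
    ultimately show ?thesis by simp
  qed
  define g where "g l x = \<Phi> x * \<psi> x $ l" for l x
  have gd: "(g l has_derivative (\<lambda>h. \<Phi> x * frechet_derivative \<psi> (at x) h $ l + (h \<bullet> moment_grad \<delta> j x) * \<psi> x $ l)) (at x)" for l x
    unfolding g_def by (intro has_derivative_mult \<Phi>d \<psi>l)
  have gp: "partial_deriv l (g l) x = \<Phi> x * partial_deriv l (\<lambda>y. \<psi> y $ l) x + moment_grad \<delta> j x $ l * \<psi> x $ l" for l x
    unfolding partial_deriv_eqI[OF gd] partial_deriv_eqI[OF \<psi>l] by (simp add: inner_axis')
  \<comment> \<open>\<open>smooth\<close> speaks of derivatives of the vector field,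
    \<open>divergence\<close> of derivatives of its components. The first form is the one from which
    continuity can be read off.\<close>
  have gp': "partial_deriv l (g l) = (\<lambda>x. \<Phi> x * partial_deriv l \<psi> x $ l + moment_grad \<delta> j x $ l * \<psi> x $ l)" for l
    unfolding gp partial_deriv_eqI[OF \<psi>l] by (auto simp: partial_deriv_def gp partial_deriv_eqI[OF \<psi>l])
  have c1: "continuous_on UNIV \<psi>" "continuous_on UNIV (partial_deriv l \<psi>)" for l
    by (intro continuous_at_imp_continuous_on ballI differentiable_imp_continuous_within smooth_differentiable[OF \<psi>s])+
  have c: "continuous_on UNIV (partial_deriv l (g l))" for l
    unfolding gp' \<Phi>_def moment_grad_def by (intro continuous_intros c1)
  have g_diff: "g l differentiable (at x)" for l x using gd differentiableI by blast
  have g0: "r < norm x \<Longrightarrow> g l x = 0" for l x using r[of x] by (cases "\<psi> x = 0") (auto simp: g_def)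
  have sum: "(\<Sum>l\<in>UNIV. partial_deriv l (g l) x) = \<psi> x \<bullet> moment_grad \<delta> j x" for x
  proof -
    have "(\<Sum>l\<in>UNIV. partial_deriv l (g l) x) = \<Phi> x * divergence \<psi> x + \<psi> x \<bullet> moment_grad \<delta> j x"
      unfolding gp divergence_def inner_vec_def by (simp add: sum.distrib sum_distrib_left mult.commute)
    then show ?thesis by (simp add: div)
  qed
  have "integrable lborel (\<lambda>x. \<Sum>l\<in>UNIV. partial_deriv l (g l) x)"
    by (intro Bochner_Integration.integrable_sum integral_partial_deriv_eq_0[OF g_diff c g0])
  then show "integrable lborel (\<lambda>x. \<psi> x \<bullet> moment_grad \<delta> j x)" by (simp add: sum)
  have "(\<integral>x. (\<Sum>l\<in>UNIV. partial_deriv l (g l) x) \<partial>lborel) = 0"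
    using integral_partial_deriv_eq_0[OF g_diff c g0] by (subst Bochner_Integration.integral_sum) auto
  then show "(\<integral>x. \<psi> x \<bullet> moment_grad \<delta> j x \<partial>lborel) = 0" by (simp add: sum)
qed

lemma Lq_norm_eq_nn_norm: "Lq_norm q f = L_norm q (\<lambda>x. ennreal (norm (f x)))"
  by (simp add: Lq_norm_def nn_norm_def nn_integral_completion)

lemma nn_norm_lebesgue: "nn_norm lebesgue q f = L_norm q f"
  by (simp add: nn_norm_def nn_integral_completion)

text \<open>The test fields approximate a in L^n, and \<open>moment_grad\<close> lies in the dual
  space L^(n/(n-1)) thanks to its Gaussian factor, so the identity for test fields passes to the
  limit.\<close>

lemma integral_moment_grad_eq_0:
  fixes a :: "real ^ 'n::finite \<Rightarrow> real ^ 'n"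
  assumes n: "2 \<le> CARD('n)" and a: "a \<in> Lq_sigma (real CARD('n))" and int: "integrable lebesgue a" and \<delta>: "0 < \<delta>"
  shows "(\<integral>x. a x \<bullet> moment_grad \<delta> j x \<partial>lebesgue) = 0"
proof -
  define N where "N = real CARD('n)"
  have N: "N \<ge> 2" using n by (simp add: N_def)
  define p where "p = N / (N - 1)"
  have p: "p > 0" "1 / 1 = 1 / N + 1 / p" using N by (auto simp: p_def field_simps)
  have am[measurable]: "a \<in> borel_measurable lebesgue" using a by (simp add: Lq_sigma_def Lq_def)
  have Wm[measurable]: "moment_grad \<delta> j \<in> borel_measurable lebesgue" by (simp add: measurable_completion)
  define Q where "Q = L_norm p (\<lambda>x. ennreal (norm (moment_grad \<delta> j x)))"
  have "Q < top"
  proof -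
    have "(\<integral>\<^sup>+x. ennreal (norm (moment_grad \<delta> j x)) powr\<^sub>e p \<partial>lborel) \<le> (\<integral>\<^sup>+x. ennreal (4 powr p) * ennreal (exp (- (\<delta> / 2 * p) * (norm (x :: real ^ 'n))\<^sup>2)) \<partial>lborel)"
    proof (intro nn_integral_mono)
      fix x :: "real ^ 'n"
      have "ennreal (norm (moment_grad \<delta> j x)) powr\<^sub>e p \<le> ennreal (4 * exp (- (\<delta> / 2) * (norm x)\<^sup>2)) powr\<^sub>e p"
        using \<delta> p by (intro ennreal_powr_mono ennreal_leI norm_moment_grad_le) auto
      also have "\<dots> = ennreal (4 powr p) * ennreal (exp (- (\<delta> / 2 * p) * (norm x)\<^sup>2))"
        by (subst ennreal_powr_ennreal) (simp_all add: powr_mult exp_powr_real ennreal_mult[symmetric] mult_ac)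
      finally show "ennreal (norm (moment_grad \<delta> j x)) powr\<^sub>e p \<le> ennreal (4 powr p) * ennreal (exp (- (\<delta> / 2 * p) * (norm x)\<^sup>2))" .
    qed
    also have "\<dots> = ennreal (4 powr p) * (\<integral>\<^sup>+x. ennreal (exp (- (\<delta> / 2 * p) * (norm (x :: real ^ 'n))\<^sup>2)) \<partial>lborel)"
      by (rule nn_integral_cmult) auto
    also have "\<dots> < top"
      using nn_integral_exp_neg_norm_squared[where 'a="real ^ 'n", of "\<delta> / 2 * p"] \<delta> p by (simp add: ennreal_mult_less_top)
    finally show ?thesis unfolding Q_def nn_norm_def less_top[symmetric] by (simp only: ennreal_powr_eq_top_iff not_False_eq_True)
  qed
  then obtain \<kappa> where \<kappa>: "Q = ennreal \<kappa>" "0 \<le> \<kappa>" by (cases Q) auto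
  have "\<bar>\<integral>x. a x \<bullet> moment_grad \<delta> j x \<partial>lebesgue\<bar> \<le> \<epsilon> * \<kappa>" if \<epsilon>: "0 < \<epsilon>" for \<epsilon>
  proof -
    obtain \<psi> where \<psi>: "\<psi> \<in> test_fields_sigma" "Lq_norm N (\<lambda>x. a x - \<psi> x) < ennreal \<epsilon>"
      using a \<epsilon> by (auto simp: Lq_sigma_def N_def)
    have "smooth \<psi>" using \<psi> by (simp add: test_fields_sigma_def)
    then have "continuous_on UNIV \<psi>"
      by (intro continuous_at_imp_continuous_on ballI differentiable_imp_continuous_within smooth_differentiable)
    then have [measurable]: "\<psi> \<in> borel_measurable borel" by (rule borel_measurable_continuous_onI)
    have [measurable]: "\<psi> \<in> borel_measurable lebesgue" by (simp add: measurable_completion)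
    have i1: "integrable lebesgue (\<lambda>x. a x \<bullet> moment_grad \<delta> j x)"
    proof (rule Bochner_Integration.integrable_bound)
      show "integrable lebesgue (\<lambda>x. 4 * norm (a x))" using int by simp
      show "AE x in lebesgue. norm (a x \<bullet> moment_grad \<delta> j x) \<le> norm (4 * norm (a x))"
        using \<delta> by (simp add: norm_inner_moment_grad_le[unfolded real_norm_def])
    qed measurable
    have i2: "integrable lebesgue (\<lambda>x. \<psi> x \<bullet> moment_grad \<delta> j x)" "(\<integral>x. \<psi> x \<bullet> moment_grad \<delta> j x \<partial>lebesgue) = 0"
      using integral_test_field_moment_grad[OF \<psi>(1), of \<delta> j] by (auto simp: integrable_completion integral_completion)
    have "(\<integral>x. a x \<bullet> moment_grad \<delta> j x \<partial>lebesgue) = (\<integral>x. (a x - \<psi> x) \<bullet> moment_grad \<delta> j x \<partial>lebesgue)"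
      unfolding inner_diff_left using i1 i2 by simp
    then have "ennreal \<bar>\<integral>x. a x \<bullet> moment_grad \<delta> j x \<partial>lebesgue\<bar> \<le> (\<integral>\<^sup>+x. ennreal (norm ((a x - \<psi> x) \<bullet> moment_grad \<delta> j x)) \<partial>lebesgue)"
      using ennreal_norm_integral_le[of lebesgue "\<lambda>x. (a x - \<psi> x) \<bullet> moment_grad \<delta> j x"] by simp
    also have "\<dots> \<le> (\<integral>\<^sup>+x. ennreal (norm (a x - \<psi> x)) * ennreal (norm (moment_grad \<delta> j x)) \<partial>lebesgue)"
      by (intro nn_integral_mono) (simp add: ennreal_mult[symmetric] ennreal_leI Cauchy_Schwarz_ineq2)
    also have "\<dots> = nn_norm lebesgue 1 (\<lambda>x. ennreal (norm (a x - \<psi> x)) * ennreal (norm (moment_grad \<delta> j x)))"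
      by (simp add: nn_norm_1)
    also have "\<dots> \<le> nn_norm lebesgue N (\<lambda>x. ennreal (norm (a x - \<psi> x))) * nn_norm lebesgue p (\<lambda>x. ennreal (norm (moment_grad \<delta> j x)))"
      by (rule nn_norm_mult) (use p N in auto)
    also have "\<dots> \<le> ennreal \<epsilon> * ennreal \<kappa>"
      using \<psi>(2) \<kappa> by (intro mult_mono) (auto simp: nn_norm_lebesgue Lq_norm_eq_nn_norm Q_def)
    also have "\<dots> = ennreal (\<epsilon> * \<kappa>)" using \<epsilon> \<kappa> by (simp add: ennreal_mult)
    finally show ?thesis using \<epsilon> \<kappa> by simp
  qed
  note bound = this
  show ?thesis
  proof (rule ccontr)
    let ?z = "\<bar>\<integral>x. a x \<bullet> moment_grad \<delta> j x \<partial>lebesgue\<bar>"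
    assume "(\<integral>x. a x \<bullet> moment_grad \<delta> j x \<partial>lebesgue) \<noteq> 0"
    then have z: "?z > 0" by simp
    have "?z \<le> ?z / (2 * (\<kappa> + 1)) * \<kappa>" using z \<kappa> by (intro bound) auto
    also have "?z * \<kappa> < ?z * (2 * (\<kappa> + 1))" using z \<kappa> by (intro mult_strict_left_mono) auto
    then have "?z / (2 * (\<kappa> + 1)) * \<kappa> < ?z" using \<kappa> by (simp add: pos_divide_less_eq)
    finally show False by simp
  qed
qed

text \<open>The constant field \<open>axis j 1\<close> is not in the dual of L^n, so approximation
  in L^n does not control the mean directly. The identity is first obtained for
  \<open>moment_grad\<close> and \<delta> is then sent to 0 by dominated convergence, with 4 |a| as
  integrable bound.\<close>

lemma integral_Lq_sigma_eq_0:
  fixes a :: "real ^ 'n::finite \<Rightarrow> real ^ 'n"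
  assumes n: "2 \<le> CARD('n)" and a: "a \<in> Lq_sigma (real CARD('n))" and int: "integrable lebesgue a"
  shows "(\<integral>x. a x \<partial>lebesgue) = 0"
proof -
  have am[measurable]: "a \<in> borel_measurable lebesgue" using a by (simp add: Lq_sigma_def Lq_def)
  have "(\<integral>x. a x \<partial>lebesgue) $ j = 0" for j
  proof -
    define d where "d k = 1 / real (Suc k)" for k
    have d: "0 < d k" for k by (simp add: d_def)
    have d0: "d \<longlonglongrightarrow> 0" unfolding d_def by (intro LIMSEQ_Suc lim_1_over_n)
    have Wm[measurable]: "moment_grad \<delta> j \<in> borel_measurable lebesgue" for \<delta> by (simp add: measurable_completion)
    have "(\<lambda>k. \<integral>x. a x \<bullet> moment_grad (d k) j x \<partial>lebesgue) \<longlonglongrightarrow> (\<integral>x. a x $ j \<partial>lebesgue)"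
    proof (rule integral_dominated_convergence[where w="\<lambda>x. 4 * norm (a x)"])
      show "integrable lebesgue (\<lambda>x. 4 * norm (a x))" using int by simp
      show "AE x in lebesgue. norm (a x \<bullet> moment_grad (d k) j x) \<le> 4 * norm (a x)" for k
        using d[of k] by (simp add: norm_inner_moment_grad_le[unfolded real_norm_def])
      have "(\<lambda>k. a x \<bullet> moment_grad (d k) j x) \<longlonglongrightarrow> a x \<bullet> (exp (- 0 * (norm x)\<^sup>2) *\<^sub>R (axis j 1 - (2 * 0 * x $ j) *\<^sub>R x))" for x
        unfolding moment_grad_def by (intro tendsto_intros d0)
      then show "AE x in lebesgue. (\<lambda>k. a x \<bullet> moment_grad (d k) j x) \<longlonglongrightarrow> a x $ j" by (simp add: inner_axis)
      show "(\<lambda>x. a x $ j) \<in> borel_measurable lebesgue"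
        by (rule measurable_compose[OF am]) simp
    qed measurable
    then have "(\<integral>x. a x $ j \<partial>lebesgue) = 0"
      using integral_moment_grad_eq_0[OF n a int d] LIMSEQ_unique[of "\<lambda>k. 0" 0] by auto
    then show ?thesis
      using integral_bounded_linear[OF bounded_linear_vec_nth[of j] int] by simp
  qed
  then show ?thesis by (simp add: vec_eq_iff)
qed

section \<open>Pointwise bounds for the heat semigroup\<close>

lemma heat_semigroup_le_majorant:
  assumes A: "AE y in lborel. ennreal (norm (a y)) = A y"
  shows "ennreal (norm (heat_semigroup t a x)) \<le> heat_majorant A t (x :: real ^ 'n::finite)"
proof -
  have "ennreal (norm (heat_semigroup t a x)) \<le> (\<integral>\<^sup>+y. ennreal (norm (heat_kernel t (x - y) *\<^sub>R a y)) \<partial>lborel)"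
    unfolding heat_semigroup_def by (rule order.trans[OF ennreal_norm_integral_le]) (simp add: nn_integral_completion)
  also have "\<dots> = heat_majorant A t x"
    unfolding heat_majorant_def
    by (rule nn_integral_cong_AE, use A in eventually_elim) (simp add: ennreal_mult)
  finally show ?thesis .
qed

lemma heat_semigroup_le_diff_majorant:
  fixes a :: "real ^ 'n::finite \<Rightarrow> real ^ 'n"
  assumes A: "AE y in lborel. ennreal (norm (a y)) = A y" and int: "integrable lebesgue a"
    and mean: "(\<integral>y. a y \<partial>lebesgue) = 0" and t: "0 < t"
  shows "ennreal (norm (heat_semigroup t a x)) \<le> heat_diff_majorant A t x"
proof -
  have am[measurable]: "a \<in> borel_measurable lebesgue" using int by auto
  have [measurable]: "(\<lambda>y. heat_kernel t (x - y)) \<in> borel_measurable lebesgue"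
    by (rule measurable_completion) measurable
  have i: "integrable lebesgue (\<lambda>y. heat_kernel t (x - y) *\<^sub>R a y)"
  proof (rule Bochner_Integration.integrable_bound)
    let ?c = "(4 * pi * t) powr (- (real CARD('n) / 2))"
    show "integrable lebesgue (\<lambda>y. ?c *\<^sub>R a y)" using int by simp
    have "heat_kernel t z \<le> ?c" for z :: "real ^ 'n"
      unfolding heat_kernel_def using t by (intro mult_left_le) auto
    then have "norm (heat_kernel t (x - y) *\<^sub>R a y) \<le> norm (?c *\<^sub>R a y)" for y
      by (simp add: mult_right_mono)
    then show "AE y in lebesgue. norm (heat_kernel t (x - y) *\<^sub>R a y) \<le> norm (?c *\<^sub>R a y)" by simp
  qed measurable
  have "heat_semigroup t a x = (\<integral>y. heat_kernel t (x - y) *\<^sub>R a y - heat_kernel t x *\<^sub>R a y \<partial>lebesgue)"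
    unfolding heat_semigroup_def using i int mean by (simp add: Bochner_Integration.integral_diff)
  also have "\<dots> = (\<integral>y. (heat_kernel t (x - y) - heat_kernel t x) *\<^sub>R a y \<partial>lebesgue)"
    by (simp add: scaleR_left_diff_distrib)
  finally have "ennreal (norm (heat_semigroup t a x)) \<le> (\<integral>\<^sup>+y. ennreal (norm ((heat_kernel t (x - y) - heat_kernel t x) *\<^sub>R a y)) \<partial>lborel)"
    using ennreal_norm_integral_le[of lebesgue "\<lambda>y. (heat_kernel t (x - y) - heat_kernel t x) *\<^sub>R a y"]
    by (simp add: nn_integral_completion)
  also have "\<dots> = heat_diff_majorant A t x"
    unfolding heat_diff_majorant_def
    by (rule nn_integral_cong_AE, use A in eventually_elim) (simp add: ennreal_mult)
  finally show ?thesis .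
qed

section \<open>From the integral equation to the majorant equation\<close>

text \<open>The Euclidean norm is bounded by the sum of the components; n^3 counts the triples j, l,
  k, all of which have the same majorant.\<close>

lemma norm_heat_Leray_div_tensor_le:
  fixes v :: "real ^ 'n::finite \<Rightarrow> real ^ 'n"
  assumes \<tau>: "0 < \<tau>"
  shows "ennreal (norm (heat_Leray_div \<tau> (\<lambda>y. tensor (v y) (v y)) x)) \<le>
    ennreal (real CARD('n) ^ 3) * (\<integral>\<^sup>+y. oseen_majorant \<tau> (x - y) * (ennreal (norm (v y)) * ennreal (norm (v y))) \<partial>lborel)"
proof -
  define Z where "Z = (\<integral>\<^sup>+y. oseen_majorant \<tau> (x - y) * (ennreal (norm (v y)) * ennreal (norm (v y))) \<partial>lborel)"
  let ?I = "\<lambda>j l k. LINT y|lebesgue. oseen_kernel l k j (x - y) \<tau> * tensor (v y) (v y) $ l $ k"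
  have I: "ennreal \<bar>?I j l k\<bar> \<le> Z" for j l k
  proof -
    have "ennreal \<bar>?I j l k\<bar> \<le> (\<integral>\<^sup>+y. ennreal \<bar>oseen_kernel l k j (x - y) \<tau> * tensor (v y) (v y) $ l $ k\<bar> \<partial>lborel)"
      using ennreal_norm_integral_le[of lebesgue "\<lambda>y. oseen_kernel l k j (x - y) \<tau> * tensor (v y) (v y) $ l $ k"]
      by (simp add: nn_integral_completion)
    also have "\<dots> \<le> Z"
      unfolding Z_def
    proof (intro nn_integral_mono)
      fix y
      have "\<bar>tensor (v y) (v y) $ l $ k\<bar> \<le> norm (v y) * norm (v y)"
        by (auto simp: tensor_def abs_mult intro!: mult_mono component_le_norm_cart)
      then have "ennreal \<bar>tensor (v y) (v y) $ l $ k\<bar> \<le> ennreal (norm (v y)) * ennreal (norm (v y))"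
        by (simp add: ennreal_mult[symmetric] ennreal_leI)
      then show "ennreal \<bar>oseen_kernel l k j (x - y) \<tau> * tensor (v y) (v y) $ l $ k\<bar> \<le>
         oseen_majorant \<tau> (x - y) * (ennreal (norm (v y)) * ennreal (norm (v y)))"
        unfolding abs_mult ennreal_mult[OF abs_ge_zero abs_ge_zero]
        by (intro mult_mono oseen_kernel_le_majorant \<tau>) auto
    qed
    finally show ?thesis .
  qed
  let ?w = "heat_Leray_div \<tau> (\<lambda>y. tensor (v y) (v y)) x"
  have "norm ?w \<le> (\<Sum>j\<in>UNIV. \<bar>?w $ j\<bar>)" by (rule norm_le_l1_cart)
  also have "\<dots> \<le> (\<Sum>j\<in>UNIV. \<Sum>l\<in>UNIV. \<Sum>k\<in>UNIV. \<bar>?I j l k\<bar>)"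
    unfolding heat_Leray_div_def vec_lambda_beta
    by (intro sum_mono order.trans[OF sum_abs] sum_mono order.trans[OF sum_abs]) auto
  finally have "ennreal (norm ?w) \<le> ennreal (\<Sum>j\<in>UNIV. \<Sum>l\<in>UNIV. \<Sum>k\<in>UNIV. \<bar>?I j l k\<bar>)" by (rule ennreal_leI)
  also have "\<dots> = (\<Sum>j\<in>UNIV. \<Sum>l\<in>UNIV. \<Sum>k\<in>UNIV. ennreal \<bar>?I j l k\<bar>)"
    by (simp add: sum_nonneg)
  also have "\<dots> \<le> (\<Sum>j\<in>(UNIV::'n set). \<Sum>l\<in>(UNIV::'n set). \<Sum>k\<in>(UNIV::'n set). Z)"
    by (intro sum_mono I)
  also have "\<dots> = ennreal (real CARD('n) ^ 3) * Z"
    by (simp add: power3_eq_cube ennreal_mult ennreal_of_nat_eq_real_of_nat mult.assoc)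
  finally show ?thesis unfolding Z_def .
qed

lemma kato_op_cmult:
  fixes W :: "real \<Rightarrow> real ^ 'n::finite \<Rightarrow> ennreal"
  assumes W: "Borel_field W"
  shows "kato_op (\<lambda>s y. c * W s y) (\<lambda>s y. c * W s y) t x = c * (c * kato_op W W t x)"
proof -
  note [measurable] = measurable_uncurry[OF W]
  have "(if 0 < s \<and> s < t then \<integral>\<^sup>+y. oseen_majorant (t - s) (x - y) * (c * W s y * (c * W s y)) \<partial>lborel else 0)
    = c * (c * (if 0 < s \<and> s < t then \<integral>\<^sup>+y. oseen_majorant (t - s) (x - y) * (W s y * W s y) \<partial>lborel else 0))" for s
  proof -
    have "(\<integral>\<^sup>+y. oseen_majorant (t - s) (x - y) * (c * W s y * (c * W s y)) \<partial>lborel) =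
      (\<integral>\<^sup>+y. c * (c * (oseen_majorant (t - s) (x - y) * (W s y * W s y))) \<partial>lborel)"
      by (simp add: mult_ac)
    also have "\<dots> = c * (c * (\<integral>\<^sup>+y. oseen_majorant (t - s) (x - y) * (W s y * W s y) \<partial>lborel))"
      by (simp add: nn_integral_cmult)
    finally show ?thesis by simp
  qed
  then show ?thesis unfolding kato_op_def by (simp add: nn_integral_cmult)
qed

text \<open>Two adjustments are made to |u|. Multiplication by \<kappa> removes the factor n^3 in
  front of the quadratic term, since \<kappa> times \<kappa> T(W,W) is T(\<kappa> W, \<kappa> W).
  And u is only Lebesgue measurable in space-time, so a Borel version V replaces it under the time
  integral. V agrees with \<kappa> |u| at almost every time only, which is why the inequality, valid
  at every time, keeps u outside the integral.\<close>

lemma mild_solution_majorant: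
  fixes u :: "real \<Rightarrow> real ^ 'n::finite \<Rightarrow> real ^ 'n"
  assumes u: "mild_solution a u"
  defines "\<kappa> \<equiv> ennreal (real CARD('n) ^ 3)"
  obtains V where "Borel_field V"
    "AE s in lborel. 0 < s \<longrightarrow> (AE x in lborel. V s x = \<kappa> * ennreal (norm (u s x)))"
    "\<And>t. 0 < t \<Longrightarrow> AE x in lborel. \<kappa> * ennreal (norm (u t x))
       \<le> \<kappa> * ennreal (norm (heat_semigroup t a x)) + kato_op V V t x"
proof -
  let ?S = "{0<..} \<times> UNIV :: (real \<times> (real ^ 'n)) set"
  \<comment> \<open>Extension by zero to all of space-time, since u is measurable on positive times
    only.\<close>
  define f where "f = (\<lambda>p. ennreal (norm (indicator ?S p *\<^sub>R (case p of (t, x) \<Rightarrow> u t x))))"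
  have "open ?S" by (rule open_Times[OF open_greaterThan open_UNIV])
  then have S: "?S \<in> sets lebesgue" by (intro sets_completionI_sets) (simp only: sets_lborel borel_open)
  then have S': "?S \<inter> space lebesgue \<in> sets lebesgue" by (simp only: sets.Int_space_eq2)
  have "(\<lambda>(t, x). u t x) \<in> borel_measurable (lebesgue_on ?S)"
    using u unfolding mild_solution_def by (rule conjunct1)
  then have "(\<lambda>p. indicator ?S p *\<^sub>R (case p of (t, x) \<Rightarrow> u t x)) \<in> borel_measurable lebesgue"
    by (rule borel_measurable_restrict_space_iff[THEN iffD1, OF S'])
  then have "f \<in> borel_measurable lebesgue" unfolding f_def by measurable
  then obtain f' where f': "f' \<in> borel_measurable lborel" "AE p in lborel. f p = f' p"
    using completion_ex_borel_measurable by blast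
  define W where "W s x = f' (s, x)" for s x
  have W: "Borel_field W"
  proof -
    have e: "case_prod W = f'" unfolding W_def by (rule case_prod_eta)
    show ?thesis unfolding e borel_prod using f'(1) by simp
  qed
  note [measurable] = measurable_uncurry[OF W]
  have "AE p in lborel \<Otimes>\<^sub>M lborel. f p = f' p" unfolding lborel_prod by (rule f'(2))
  then have "AE s in lborel. AE x in lborel. f (s, x) = f' (s, x)" by (rule lborel_pair.AE_pair)
  then have Wu: "AE s in lborel. 0 < s \<longrightarrow> (AE x in lborel. W s x = ennreal (norm (u s x)))"
  proof eventually_elim
    fix s assume ae: "AE x in lborel. f (s, x) = f' (s, x)"
    show "0 < s \<longrightarrow> (AE x in lborel. W s x = ennreal (norm (u s x)))"
    proof
      assume s: "0 < s"
      from ae show "AE x in lborel. W s x = ennreal (norm (u s x))"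
      proof eventually_elim
        fix x assume "f (s, x) = f' (s, x)"
        then have "W s x = f (s, x)" unfolding W_def by simp
        then show "W s x = ennreal (norm (u s x))" using s by (simp only: f_def) simp
      qed
    qed
  qed
  define V where "V s x = \<kappa> * W s x" for s x
  have V: "Borel_field V" unfolding V_def by measurable
  show ?thesis
  proof (rule that[OF V])
    show "AE s in lborel. 0 < s \<longrightarrow> (AE x in lborel. V s x = \<kappa> * ennreal (norm (u s x)))"
      using Wu by eventually_elim (auto simp: V_def)
    fix t :: real assume t: "0 < t"
    let ?F = "\<lambda>x s. heat_Leray_div (t - s) (\<lambda>y. tensor (u s y) (u s y)) x"
    have "AE x in lborel. u t x = heat_semigroup t a x - (LINT s:{0<..<t}|lebesgue. ?F x s)"
    proof -
      have "\<forall>t>0. AE x in lebesgue. u t x = heat_semigroup t a x - (LINT s:{0<..<t}|lebesgue. heat_Leray_div (t - s) (\<lambda>y. tensor (u s y) (u s y)) x)"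
        using u unfolding mild_solution_def by (rule conjunct2)
      then show ?thesis using t unfolding AE_completion_iff by blast
    qed
    then show "AE x in lborel. \<kappa> * ennreal (norm (u t x))
       \<le> \<kappa> * ennreal (norm (heat_semigroup t a x)) + kato_op V V t x"
    proof eventually_elim
      fix x assume x: "u t x = heat_semigroup t a x - (LINT s:{0<..<t}|lebesgue. ?F x s)"
      let ?Z = "\<lambda>s. if 0 < s \<and> s < t then \<integral>\<^sup>+y. oseen_majorant (t - s) (x - y) * (W s y * W s y) \<partial>lborel else 0"
      have "ennreal (norm (LINT s:{0<..<t}|lebesgue. ?F x s)) \<le> (\<integral>\<^sup>+s. ennreal (norm (indicator {0<..<t} s *\<^sub>R ?F x s)) \<partial>lborel)"
        unfolding set_lebesgue_integral_def by (rule order.trans[OF ennreal_norm_integral_le]) (simp add: nn_integral_completion)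
      also have "\<dots> \<le> (\<integral>\<^sup>+s. \<kappa> * ?Z s \<partial>lborel)"
      proof (rule nn_integral_mono_AE, use Wu in eventually_elim)
        fix s assume s: "0 < s \<longrightarrow> (AE y in lborel. W s y = ennreal (norm (u s y)))"
        show "ennreal (norm (indicator {0<..<t} s *\<^sub>R ?F x s)) \<le> \<kappa> * ?Z s"
        proof (cases "0 < s \<and> s < t")
          case True
          then have ae: "AE y in lborel. W s y = ennreal (norm (u s y))" using s by auto
          have "ennreal (norm (?F x s)) \<le> \<kappa> * (\<integral>\<^sup>+y. oseen_majorant (t - s) (x - y) * (ennreal (norm (u s y)) * ennreal (norm (u s y))) \<partial>lborel)"
            unfolding \<kappa>_def using True by (intro norm_heat_Leray_div_tensor_le) auto
          also have "(\<integral>\<^sup>+y. oseen_majorant (t - s) (x - y) * (ennreal (norm (u s y)) * ennreal (norm (u s y))) \<partial>lborel)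
            = (\<integral>\<^sup>+y. oseen_majorant (t - s) (x - y) * (W s y * W s y) \<partial>lborel)"
            by (rule nn_integral_cong_AE, use ae in eventually_elim) simp
          finally show ?thesis using True by simp
        qed auto
      qed
      also have "\<dots> = \<kappa> * kato_op W W t x"
        unfolding kato_op_def by (rule nn_integral_cmult) measurable
      finally have L: "ennreal (norm (LINT s:{0<..<t}|lebesgue. ?F x s)) \<le> \<kappa> * kato_op W W t x" .
      have "ennreal (norm (u t x)) \<le> ennreal (norm (heat_semigroup t a x) + norm (LINT s:{0<..<t}|lebesgue. ?F x s))"
        unfolding x by (intro ennreal_leI norm_triangle_ineq4)
      also have "\<dots> = ennreal (norm (heat_semigroup t a x)) + ennreal (norm (LINT s:{0<..<t}|lebesgue. ?F x s))"
        by (rule ennreal_plus) (rule norm_ge_zero)+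
      also have "\<dots> \<le> ennreal (norm (heat_semigroup t a x)) + \<kappa> * kato_op W W t x"
        by (rule add_left_mono[OF L])
      finally have "ennreal (norm (u t x)) \<le> ennreal (norm (heat_semigroup t a x)) + \<kappa> * kato_op W W t x" .
      then have "\<kappa> * ennreal (norm (u t x)) \<le> \<kappa> * (ennreal (norm (heat_semigroup t a x)) + \<kappa> * kato_op W W t x)"
        by (rule mult_left_mono) simp
      also have "\<dots> = \<kappa> * ennreal (norm (heat_semigroup t a x)) + kato_op V V t x"
        unfolding V_def kato_op_cmult[OF W] by (simp add: distrib_left)
      finally show "\<kappa> * ennreal (norm (u t x)) \<le> \<dots>" .
    qed
  qed
qed

lemma X_norm_AE:
  assumes "X_norm u \<le> E"
  shows "AE s in lborel. 0 < s \<longrightarrow> Lq_norm (2 * real CARD('n)) (u s :: real ^ 'n::finite \<Rightarrow> real ^ 'n) \<le> E * ennreal (s powr - (1/4))"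
proof -
  let ?x = "\<lambda>s. ennreal (s powr (1 / 4)) * Lq_norm (2 * real CARD('n)) (u s)"
  have "AE s in lebesgue_on {0<..}. ?x s \<le> X_norm u"
    unfolding X_norm_def by (rule esssup_AE)
  then have "AE s in lebesgue_on {0<..}. ?x s \<le> E"
    by eventually_elim (rule order.trans[OF _ assms])
  then have "AE s in lebesgue. 0 < s \<longrightarrow> ?x s \<le> E"
    by (subst (asm) AE_restrict_space_iff) auto
  then have "AE s in lborel. 0 < s \<longrightarrow> ?x s \<le> E"
    by (simp add: AE_completion_iff)
  then show ?thesis
  proof eventually_elim
    fix s
    assume a: "0 < s \<longrightarrow> ?x s \<le> E"
    show "0 < s \<longrightarrow> Lq_norm (2 * real CARD('n)) (u s) \<le> E * ennreal (s powr - (1/4))"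
    proof
      assume s: "0 < s"
      have "ennreal (s powr - (1/4)) * ennreal (s powr (1/4)) = 1"
        using s by (simp add: ennreal_mult[symmetric] powr_add[symmetric])
      then have "Lq_norm (2 * real CARD('n)) (u s) = ennreal (s powr - (1/4)) * (ennreal (s powr (1/4)) * Lq_norm (2 * real CARD('n)) (u s))"
        by (simp add: mult.assoc[symmetric])
      also have "\<dots> \<le> ennreal (s powr - (1/4)) * E" using a s by (intro mult_left_mono) auto
      finally show "Lq_norm (2 * real CARD('n)) (u s) \<le> E * ennreal (s powr - (1/4))" by (simp add: mult.commute)
    qed
  qed
qed

section \<open>Bootstrapping the decay rate\<close>

abbreviation early_part :: "(real \<Rightarrow> ennreal) \<Rightarrow> real \<Rightarrow> ennreal" where
  "early_part G t \<equiv> \<integral>\<^sup>+s. (if 0 < s \<and> s < t then (G s)\<^sup>2 else 0) \<partial>lborel"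

abbreviation late_part :: "real \<Rightarrow> (real \<Rightarrow> ennreal) \<Rightarrow> real \<Rightarrow> ennreal" where
  "late_part \<eta> G t \<equiv> \<integral>\<^sup>+s. (if t / 2 < s \<and> s < t
     then ennreal (\<eta> * ((t - s) powr - (3/4) * s powr - (1/4))) * G s else 0) \<partial>lborel"

text \<open>The factor two in front of the source term absorbs the integral, which is a small multiple
  of the supremum of \<open>g\<close> over \<open>[t/2, t]\<close>; the a priori bound \<open>D\<close> is halved in each step.\<close>

lemma decay_bootstrap:
  fixes g G :: "real \<Rightarrow> ennreal"
  assumes G: "AE s in lborel. 0 < s \<longrightarrow> G s \<le> g s"
    and D: "\<And>t. 0 < t \<Longrightarrow> g t \<le> ennreal D" and nonneg: "0 \<le> D" "0 \<le> B" "0 \<le> \<beta>" "0 \<le> \<eta>"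
    and \<eta>: "\<eta> * 8 * 2 powr \<beta> \<le> 1"
    and ineq: "\<And>t. 0 < t \<Longrightarrow> g t \<le> ennreal (B * t powr - \<beta>) +
      late_part \<eta> G t"
    and t: "0 < t"
  shows "g t \<le> ennreal (2 * B * t powr - \<beta>)"
proof -
  have step: "0 < t \<Longrightarrow> g t \<le> ennreal (2 * B * t powr - \<beta> + D / 2 ^ k)" for t k
  proof (induction k arbitrary: t)
    case 0
    have "ennreal D \<le> ennreal (2 * B * t powr - \<beta> + D / 2 ^ 0)" using nonneg by (intro ennreal_leI) simp
    with D[OF 0] show ?case by (rule order.trans)
  next
    case (Suc k)
    note t = \<open>0 < t\<close>
    define M where "M = 2 * B * (t/2) powr - \<beta> + D / 2 ^ k"
    let ?r = "\<lambda>s. if t / 2 < s \<and> s < t then ennreal ((t - s) powr - (3/4)) else 0"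
    let ?m = "ennreal (\<eta> * (t/2) powr - (1/4) * M)"
    let ?l = "\<lambda>s. if t / 2 < s \<and> s < t then ennreal (\<eta> * ((t - s) powr - (3/4) * s powr - (1/4))) * G s else 0"
    have M: "M \<ge> 0" using nonneg by (simp add: M_def)
    have "late_part \<eta> G t
      \<le> (\<integral>\<^sup>+s. ?m * ?r s \<partial>lborel)"
    proof (rule nn_integral_mono_AE, use G in eventually_elim)
      fix s assume G: "0 < s \<longrightarrow> G s \<le> g s"
      show "?l s
        \<le> ?m * ?r s"
      proof (cases "t / 2 < s \<and> s < t")
        case True
        then have s: "0 < s" using t by auto
        have "G s \<le> g s" using G s by simp
        also have "\<dots> \<le> ennreal (2 * B * s powr - \<beta> + D / 2 ^ k)" by (rule Suc.IH[OF s])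
        also have "\<dots> \<le> ennreal M" unfolding M_def using True t nonneg
          by (intro ennreal_leI add_right_mono mult_left_mono powr_mono2') auto
        finally have "ennreal (\<eta> * ((t - s) powr - (3/4) * s powr - (1/4))) * G s
          \<le> ennreal (\<eta> * ((t - s) powr - (3/4) * (t/2) powr - (1/4))) * ennreal M"
          using True t nonneg by (intro mult_mono ennreal_leI mult_left_mono powr_mono2') auto
        also have "\<dots> = ?m * ennreal ((t - s) powr - (3/4))"
          using nonneg M by (simp add: ennreal_mult[symmetric] mult_ac)
        finally show ?thesis using True by simp
      qed auto
    qed
    also have "\<dots> = ?m * (\<integral>\<^sup>+s. ?r s \<partial>lborel)"
      by (rule nn_integral_cmult) measurable
    also have "\<dots> \<le> ?m * ennreal ((t - t/2) powr (1 - 3/4) / (1 - 3/4))"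
      using t by (intro mult_left_mono nn_integral_powr_to) auto
    \<comment> \<open>The integral of (t - s)^(-3/4) over (t/2, t) is 4 (t/2)^(1/4), and its power
      of t cancels against the bound (t/2)^(-1/4) for s^(-1/4).\<close>
    also have "\<dots> = ennreal (4 * \<eta> * M)"
    proof -
      define p where "p = (t/2) powr - (1/4)"
      define r where "r = (t/2) powr (1/4)"
      have pr: "p * r = 1" using t by (simp add: p_def r_def powr_add[symmetric])
      have 1: "t - t/2 = t/2" "1 - 3/4 = (1/4::real)" by simp_all
      have "\<eta> * p * M * (r / (1/4)) = 4 * \<eta> * M * (p * r)" by (simp add: mult_ac)
      then have "\<eta> * (t/2) powr - (1/4) * M * ((t - t/2) powr (1 - 3/4) / (1 - 3/4)) = 4 * \<eta> * M"
        unfolding 1 p_def[symmetric] r_def[symmetric] pr by simp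
      then show ?thesis using nonneg M by (subst ennreal_mult[symmetric]) auto
    qed
    finally have "g t \<le> ennreal (B * t powr - \<beta>) + ennreal (4 * \<eta> * M)"
      using ineq[OF t] by (meson add_left_mono order.trans)
    also have "\<dots> = ennreal (B * t powr - \<beta> + 4 * \<eta> * M)"
      using nonneg M by (simp add: ennreal_plus)
    also have "\<dots> \<le> ennreal (2 * B * t powr - \<beta> + D / 2 ^ Suc k)"
    proof (rule ennreal_leI)
      have p: "(t/2) powr - \<beta> = 2 powr \<beta> * t powr - \<beta>" using t by (simp add: powr_divide powr_minus_divide[of 2])
      have "\<eta> * 8 * 1 \<le> \<eta> * 8 * 2 powr \<beta>" using nonneg by (intro mult_left_mono ge_one_powr_ge_zero) auto
      then have e: "\<eta> * 8 \<le> 1" using \<eta> by linarith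
      \<comment> \<open>M contains 2 B with the factor \<open>2 powr \<beta>\<close> from
        (t/2)^(-\<beta>), and D / 2^k, which is twice the new bound. This accounts for the constant
        8 and the power of 2 in the smallness condition on \<eta>.\<close>
      have "4 * \<eta> * M = (\<eta> * 8 * 2 powr \<beta>) * (B * t powr - \<beta>) + (\<eta> * 8) * (D / 2 ^ Suc k)"
        unfolding M_def p by (simp add: algebra_simps)
      also have "\<dots> \<le> 1 * (B * t powr - \<beta>) + 1 * (D / 2 ^ Suc k)"
        using nonneg by (intro add_mono mult_right_mono \<eta> e) auto
      finally show "B * t powr - \<beta> + 4 * \<eta> * M \<le> 2 * B * t powr - \<beta> + D / 2 ^ Suc k" by simp
    qed
    finally show ?case .
  qed
  have "(\<lambda>k. 2 * B * t powr - \<beta> + D * (1/2) ^ k) \<longlonglongrightarrow> 2 * B * t powr - \<beta> + D * 0"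
    by (intro tendsto_intros LIMSEQ_power_zero) auto
  then have "(\<lambda>k. ennreal (2 * B * t powr - \<beta> + D / 2 ^ k)) \<longlonglongrightarrow> ennreal (2 * B * t powr - \<beta>)"
    by (intro tendsto_ennrealI) (simp add: power_one_over)
  then show ?thesis using step[OF t] by (intro LIMSEQ_le_const) auto
qed

text \<open>Split the integral where the two bounds agree.\<close>

lemma nn_integral_square_min_le:
  fixes G :: "real \<Rightarrow> ennreal"
  assumes \<alpha>: "AE s in lborel. 0 < s \<longrightarrow> G s \<le> ennreal \<alpha>" and j: "AE s in lborel. 0 < s \<longrightarrow> G s \<le> ennreal (j * s powr - \<gamma>)"
    and nonneg: "0 \<le> \<alpha>" "0 \<le> j" and \<gamma>: "1/2 < \<gamma>"
  shows "(\<integral>\<^sup>+s. (if 0 < s then (G s)\<^sup>2 else 0) \<partial>lborel) \<le> ennreal ((1 + 1 / (2 * \<gamma> - 1)) * (j powr (1/\<gamma>) * \<alpha> powr (2 - 1/\<gamma>)))"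
proof (cases "\<alpha> = 0 \<or> j = 0")
  case True
  have "AE s in lborel. (if 0 < s then (G s)\<^sup>2 else 0) = 0"
    using \<alpha> j by eventually_elim (use True in auto)
  then have "(\<integral>\<^sup>+s. (if 0 < s then (G s)\<^sup>2 else 0) \<partial>lborel) = (\<integral>\<^sup>+s. 0 \<partial>(lborel :: real measure))"
    by (rule nn_integral_cong_AE)
  then show ?thesis by simp
next
  case False
  then have pos: "\<alpha> > 0" "j > 0" using nonneg by auto
  define T where "T = (j / \<alpha>) powr (1/\<gamma>)"
  let ?r = "\<lambda>s. if T < s then ennreal (s powr - (2 * \<gamma>)) else 0"
  have T: "T > 0" using pos by (simp add: T_def)
  have "(\<integral>\<^sup>+s. (if 0 < s then (G s)\<^sup>2 else 0) \<partial>lborel) \<le>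
    (\<integral>\<^sup>+s. ennreal (\<alpha>\<^sup>2) * indicator {0..T} s + ennreal (j\<^sup>2) * ?r s \<partial>lborel)"
  proof (rule nn_integral_mono_AE, use \<alpha> j in eventually_elim)
    fix s assume a: "0 < s \<longrightarrow> G s \<le> ennreal \<alpha>" and b: "0 < s \<longrightarrow> G s \<le> ennreal (j * s powr - \<gamma>)"
    show "(if 0 < s then (G s)\<^sup>2 else 0) \<le> ennreal (\<alpha>\<^sup>2) * indicator {0..T} s + ennreal (j\<^sup>2) * ?r s"
    proof (cases "0 < s")
      case s: True
      show ?thesis
      proof (cases "s \<le> T")
        case True
        have "(G s)\<^sup>2 \<le> (ennreal \<alpha>)\<^sup>2" using a s by (intro power_mono) auto
        then show ?thesis using s True nonneg by (simp add: ennreal_power)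
      next
        case False
        have "(G s)\<^sup>2 \<le> (ennreal (j * s powr - \<gamma>))\<^sup>2" using b s by (intro power_mono) auto
        also have "\<dots> = ennreal (j\<^sup>2) * ennreal (s powr - (2 * \<gamma>))"
        proof -
          have "(s powr - \<gamma>)\<^sup>2 = s powr - (2 * \<gamma>)" by (simp add: power2_eq_square powr_add[symmetric])
          then show ?thesis using nonneg by (simp add: ennreal_power ennreal_mult[symmetric] power_mult_distrib)
        qed
        finally show ?thesis using s False by simp
      qed
    qed auto
  qed
  also have "\<dots> = ennreal (\<alpha>\<^sup>2) * emeasure lborel {0..T} + ennreal (j\<^sup>2) * (\<integral>\<^sup>+s. ?r s \<partial>lborel)"
    by (simp add: nn_integral_add nn_integral_cmult)
  also have "\<dots> \<le> ennreal (\<alpha>\<^sup>2) * ennreal T + ennreal (j\<^sup>2) * ennreal (T powr (1 - 2 * \<gamma>) / (2 * \<gamma> - 1))"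
    using T \<gamma> nn_integral_powr_atLeast[of "2 * \<gamma>" T] by (intro add_mono mult_left_mono) auto
  also have "\<dots> = ennreal (\<alpha>\<^sup>2 * T + j\<^sup>2 * (T powr (1 - 2 * \<gamma>) / (2 * \<gamma> - 1)))"
    using T \<gamma> by (simp add: ennreal_mult[symmetric] ennreal_plus[symmetric] del: ennreal_plus)
  also have "\<alpha>\<^sup>2 * T + j\<^sup>2 * (T powr (1 - 2 * \<gamma>) / (2 * \<gamma> - 1)) = (1 + 1 / (2 * \<gamma> - 1)) * (j powr (1/\<gamma>) * \<alpha> powr (2 - 1/\<gamma>))"
  proof -
    have 1: "\<alpha>\<^sup>2 * T = j powr (1/\<gamma>) * \<alpha> powr (2 - 1/\<gamma>)"
      using pos by (simp add: T_def powr_divide powr_diff)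
    have "T powr (1 - 2 * \<gamma>) = (j / \<alpha>) powr (1/\<gamma> - 2)"
      using \<gamma> by (simp add: T_def powr_powr field_simps)
    then have "j\<^sup>2 * T powr (1 - 2 * \<gamma>) = j powr (1/\<gamma>) * \<alpha> powr (2 - 1/\<gamma>)"
      using pos by (simp add: powr_divide powr_diff)
    then show ?thesis using 1 by (simp add: distrib_right)
  qed
  finally show ?thesis .
qed

text \<open>The kernel rate 1/2 + n/4 = (n+2)/4 is the one that the first moment gives for the
  linear part, so both parts of the solution end at the same rate.\<close>

lemma oseen_convolution_L1_L2:
  fixes V :: "real ^ 'n::finite \<Rightarrow> ennreal"
  assumes [measurable]: "V \<in> borel_measurable borel" and \<tau>: "0 < \<tau>"
  shows "L_norm 2 (\<lambda>x. \<integral>\<^sup>+y. oseen_majorant \<tau> (x - y) * (V y * V y) \<partial>lborel) \<le>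
    ennreal (oseen_const TYPE('n) 2 * \<tau> powr - ((real CARD('n) + 2) / 4)) * (L_norm 2 V)\<^sup>2"
proof -
  have e: "- (1/2) - real CARD('n) / 2 * (1 - 1 / 2) = - ((real CARD('n) + 2) / 4)" by (simp add: field_simps)
  have "L_norm 2 (\<lambda>x. \<integral>\<^sup>+y. oseen_majorant \<tau> (x - y) * (V y * V y) \<partial>lborel)
     \<le> L_norm 2 (oseen_majorant \<tau> :: real ^ 'n \<Rightarrow> ennreal) * (\<integral>\<^sup>+y. V y * V y \<partial>lborel)"
    by (rule nn_norm_convolution_L1) auto
  also have "\<dots> \<le> ennreal (oseen_const TYPE('n) 2 * \<tau> powr - ((real CARD('n) + 2) / 4)) * (L_norm 2 V)\<^sup>2"
    using nn_norm_oseen_majorant[of 2 \<tau>, where 'n='n] \<tau> unfolding e nn_norm_2_squared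
    by (simp add: power2_eq_square mult_right_mono)
  finally show ?thesis .
qed

definition split_const :: "'n::finite itself \<Rightarrow> real" where
  "split_const T = bilinear_const T + oseen_const T 2 * 2 powr ((real CARD('n) + 2) / 4) + 1"

text \<open>The singularity (t-s)^(-(n+2)/4) is not integrable at s = t, but on the early half t - s
  is at least t/2 and it becomes a power of t. On the late half the weaker (t-s)^(-3/4) is
  integrable and the small factor \<epsilon> is kept for absorption. The early integral is stated
  over all of (0, t), which only enlarges it.\<close>

lemma kato_op_split:
  fixes V :: "real \<Rightarrow> real ^ 'n::finite \<Rightarrow> ennreal"
  defines "c \<equiv> split_const TYPE('n)" and "\<beta> \<equiv> (real CARD('n) + 2) / 4"
  assumes n: "2 \<le> CARD('n)"
    and V: "Borel_field V" and t: "0 < t" and \<epsilon>: "0 \<le> \<epsilon>"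
    and X: "decays (2 * real CARD('n)) (ennreal \<epsilon>) (1/4) V"
  shows "0 < c"
    and "L_norm 2 (kato_op V V t) \<le>
      ennreal (c * t powr - \<beta>) * (\<integral>\<^sup>+s. (if 0 < s \<and> s < t then (L_norm 2 (V s))\<^sup>2 else 0) \<partial>lborel) +
      (\<integral>\<^sup>+s. (if t / 2 < s \<and> s < t then ennreal (c * \<epsilon> * ((t - s) powr - (3/4) * s powr - (1/4))) * L_norm 2 (V s) else 0) \<partial>lborel)"
proof -
  define c1 where "c1 = bilinear_const TYPE('n)"
  define c2 where "c2 = oseen_const TYPE('n) 2"
  have \<beta>: "\<beta> \<ge> 0" by (simp add: \<beta>_def)
  have c1: "0 \<le> c1" unfolding c1_def by (rule oseen_convolution_bound[OF n, of "\<lambda>_. 0" "\<lambda>_. 0" 2 1]) auto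
  have c2: "0 \<le> c2" by (simp add: c2_def)
  then have "0 \<le> c2 * 2 powr \<beta>" by simp
  moreover have "c = c1 + c2 * 2 powr \<beta> + 1"
    by (simp add: c_def split_const_def c1_def c2_def \<beta>_def)
  ultimately have c: "c > 0" "c1 \<le> c" "c2 * 2 powr \<beta> \<le> c" using c1 by linarith+
  show "0 < c" by (rule c(1))
  note [measurable] = measurable_uncurry[OF V]
  let ?G = "\<lambda>s. L_norm 2 (V s)"
  have [measurable]: "?G \<in> borel_measurable borel"
    using measurable_nn_norm[OF sigma_finite_lborel, of V borel 2] V by simp
  let ?P = "\<lambda>s. if 0 < s \<and> s < t then (?G s)\<^sup>2 else 0"
  let ?Q = "\<lambda>s. if t / 2 < s \<and> s < t then ennreal (c * \<epsilon> * ((t - s) powr - (3/4) * s powr - (1/4))) * ?G s else 0"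
  have "L_norm 2 (kato_op V V t) \<le> (\<integral>\<^sup>+s. (if 0 < s \<and> s < t then
    L_norm 2 (\<lambda>x. \<integral>\<^sup>+y. oseen_majorant (t - s) (x - y) * (V s y * V s y) \<partial>lborel) else 0) \<partial>lborel)"
    by (rule nn_norm_kato_op_le[OF V V]) simp
  also have "\<dots> \<le> (\<integral>\<^sup>+s. ennreal (c * t powr - \<beta>) * ?P s + ?Q s \<partial>lborel)"
  proof (rule nn_integral_mono_AE, use X in eventually_elim)
    fix s assume X: "0 < s \<longrightarrow> L_norm (2 * real CARD('n)) (V s) \<le> ennreal \<epsilon> * ennreal (s powr - (1/4))"
    let ?L = "L_norm 2 (\<lambda>x. \<integral>\<^sup>+y. oseen_majorant (t - s) (x - y) * (V s y * V s y) \<partial>lborel)"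
    show "(if 0 < s \<and> s < t then ?L else 0) \<le> ennreal (c * t powr - \<beta>) * ?P s + ?Q s"
    proof (cases "0 < s \<and> s < t")
      case s: True
      show ?thesis
      proof (cases "s \<le> t / 2")
        case True
        have "?L \<le> ennreal (c2 * (t - s) powr - \<beta>) * (?G s)\<^sup>2" unfolding c2_def \<beta>_def using s by (intro oseen_convolution_L1_L2) auto
        also have "c2 * (t - s) powr - \<beta> \<le> c2 * (t / 2) powr - \<beta>"
          using True s \<beta> c2 by (intro mult_left_mono powr_mono2') auto
        also have "(t / 2) powr - \<beta> = 2 powr \<beta> * t powr - \<beta>" using t by (simp add: powr_divide powr_minus_divide[of 2])
        also have "c2 * (2 powr \<beta> * t powr - \<beta>) \<le> c * t powr - \<beta>"
          using c(3) by (simp add: mult.assoc[symmetric] mult_right_mono)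
        finally show ?thesis using True s by (simp add: ennreal_leI mult_right_mono)
      next
        case False
        have "?L \<le> ennreal (c1 * (t - s) powr - (3/4)) * (L_norm (2 * real CARD('n)) (V s) * ?G s)"
          unfolding c1_def using s by (intro oseen_convolution_bound n) auto
        also have "\<dots> \<le> ennreal (c * (t - s) powr - (3/4)) * ((ennreal \<epsilon> * ennreal (s powr - (1/4))) * ?G s)"
          using X s c by (intro mult_mono ennreal_leI) auto
        also have "\<dots> = ennreal (c * \<epsilon> * ((t - s) powr - (3/4) * s powr - (1/4))) * ?G s"
          using c(1) \<epsilon> by (simp add: ennreal_mult mult_ac)
        finally have "?L \<le> ?Q s" using False s by simp
        then show ?thesis using s by (simp add: add_increasing)
      qed
    qed auto
  qed
  also have "\<dots> = ennreal (c * t powr - \<beta>) * (\<integral>\<^sup>+s. ?P s \<partial>lborel) + (\<integral>\<^sup>+s. ?Q s \<partial>lborel)"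
    by (subst nn_integral_add) (auto simp: nn_integral_cmult)
  finally show "L_norm 2 (kato_op V V t) \<le> ennreal (c * t powr - \<beta>) * (\<integral>\<^sup>+s. ?P s \<partial>lborel) + (\<integral>\<^sup>+s. ?Q s \<partial>lborel)" .
qed

text \<open>The geometric mean of the linear bounds with rates n/4 and (n+2)/4 has the rate (n+1)/4;
  it is the origin of the square roots in J.\<close>

lemma min_le_sqrt_mult:
  assumes "0 \<le> p" "0 \<le> (q::real)"
  shows "min p q \<le> p powr (1/2) * q powr (1/2)"
proof -
  have "min p q = min p q powr (1/2) * min p q powr (1/2)"
    using assms by (simp add: powr_add[symmetric])
  also have "\<dots> \<le> p powr (1/2) * q powr (1/2)"
    using assms by (intro mult_mono powr_mono2) auto
  finally show ?thesis .
qed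

section \<open>Constants and decay estimates for the majorant equation\<close>

text \<open>The first two terms are for \<open>kato_op_iteration\<close> with the weights 0 and 3/8.
  The third is the smallness condition of \<open>decay_bootstrap\<close> for the rate (n+2)/4, and
  thereby also for the smaller rate (n+1)/4.\<close>

definition decay_radius :: "'n::finite itself \<Rightarrow> real" where
  "decay_radius T = min (min (iteration_radius T 0) (iteration_radius T (3/8)))
    (1 / (8 * 2 powr ((real CARD('n) + 2) / 4) * split_const T))"

text \<open>The first summand is the geometric mean of the constants in
  \<open>heat_majorant_L1_L2\<close> and \<open>heat_diff_majorant_L2\<close>, which happen to
  coincide. The factor 16 is 4 from squaring the bound 2 aq \<alpha>q s^(-3/8), times 4 from
  integrating s^(-3/4).\<close>

definition J_const :: "'n::finite itself \<Rightarrow> real" where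
  "J_const T = (gauss_const T 2 * gauss_const T 2) powr (1/2) + 16 * split_const T * (subcritical_const T)\<^sup>2"

text \<open>The constant of \<open>nn_integral_square_min_le\<close> for the rate \<gamma>, with the
  factors of the two bounds on the L^2 norm inserted: 2 * \<open>J_const\<close> for the decaying
  one and 2 * \<open>gauss_const T 1\<close> for the uniform one.\<close>

definition K_const :: "'n::finite itself \<Rightarrow> real" where
  "K_const T = (let \<gamma> = (real CARD('n) + 1) / 4 in
     split_const T * ((1 + 1 / (2 * \<gamma> - 1)) * ((2 * J_const T) powr (1/\<gamma>) * (2 * gauss_const T 1) powr (2 - 1/\<gamma>))))"

definition final_const :: "'n::finite itself \<Rightarrow> real" where
  "final_const T = 2 * gauss_const T 1 + 2 * (gauss_const T 2 + K_const T) + 1"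

lemma decay_const_pos:
  assumes n: "2 \<le> CARD('n::finite)"
  shows "0 < split_const TYPE('n)" "0 < decay_radius TYPE('n)" "0 \<le> J_const TYPE('n)" "0 \<le> K_const TYPE('n)" "0 < final_const TYPE('n)"
proof -
  show s: "0 < split_const TYPE('n)"
    by (rule kato_op_split(1)[OF n, of "\<lambda>_ _. 0" 1 0]) (auto simp: nn_norm_def)
  then show "0 < decay_radius TYPE('n)" by (simp add: decay_radius_def)
  show J: "0 \<le> J_const TYPE('n)" using s by (simp add: J_const_def)
  have "0 \<le> 1 + 1 / (2 * ((real CARD('n) + 1) / 4) - 1)" using n by (simp add: field_simps)
  then show K: "0 \<le> K_const TYPE('n)" using s unfolding K_const_def Let_def
    by (intro mult_nonneg_nonneg) auto
  show "0 < final_const TYPE('n)" using K by (simp add: final_const_def add_nonneg_pos)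
qed

text \<open>The conclusion concerns v at every time, while the integrals see its Borel version V,
  which equals v at almost every time only. Both linear majorants are assumed side by side because
  the intermediate rate uses the smaller of their norms.\<close>

lemma majorant_decay:
  fixes A :: "real ^ 'n::finite \<Rightarrow> ennreal" and V v :: "real \<Rightarrow> real ^ 'n \<Rightarrow> ennreal" and \<alpha> \<alpha>1 \<alpha>q m t :: real
  defines "N \<equiv> real CARD('n)" and "\<epsilon> \<equiv> decay_radius TYPE('n)" and "c \<equiv> final_const TYPE('n)"
  assumes n: "2 \<le> CARD('n)"
    and [measurable]: "A \<in> borel_measurable borel" and V: "Borel_field V"
    and Vv: "AE s in lborel. 0 < s \<longrightarrow> (AE x in lborel. V s x = v s x)"
    and X: "decays (2 * N) (ennreal \<epsilon>) (1/4) V"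
    and v0: "\<And>t. 0 < t \<Longrightarrow> AE x in lborel. v t x \<le> heat_majorant A t x + kato_op V V t x"
    and v1: "\<And>t. 0 < t \<Longrightarrow> AE x in lborel. v t x \<le> heat_diff_majorant A t x + kato_op V V t x"
    and \<alpha>: "L_norm 2 A = ennreal \<alpha>" and \<alpha>1: "L_norm 1 A = ennreal \<alpha>1"
    and \<alpha>q: "L_norm (4 * N / (3 + 2 * N)) A = ennreal \<alpha>q"
    and m: "(\<integral>\<^sup>+y. ennreal (norm y) * A y \<partial>lborel) = ennreal m"
    and nonneg: "0 \<le> \<alpha>" "0 \<le> \<alpha>1" "0 \<le> \<alpha>q" "0 \<le> m" and t: "0 < t"
  shows "L_norm 2 (v t) \<le> ennreal (c * \<alpha>) \<and>
    L_norm 2 (v t) \<le> ennreal (c * (m + (\<alpha>1 powr (1/2) * m powr (1/2) + \<alpha>q\<^sup>2) powr (4 / (N + 1))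
      * \<alpha> powr (2 * (N - 1) / (N + 1))) * t powr (- (N + 2) / 4))"
proof -
  have N: "N \<ge> 2" using n by (simp add: N_def)
  define a2 where "a2 = gauss_const TYPE('n) 1"
  define am where "am = gauss_const TYPE('n) 2"
  define aq where "aq = subcritical_const TYPE('n)"
  define d where "d = split_const TYPE('n)"
  define CJ where "CJ = J_const TYPE('n)"
  define CK where "CK = K_const TYPE('n)"
  have a2: "0 \<le> a2" and am: "0 \<le> am" and aq: "0 \<le> aq" by (simp_all add: a2_def am_def aq_def)
  have d: "0 < d" and CJ: "0 \<le> CJ" and CK: "0 \<le> CK" and \<epsilon>0: "0 < \<epsilon>"
    using decay_const_pos[OF n] by (simp_all add: d_def CJ_def CK_def \<epsilon>_def)
  define \<beta> where "\<beta> = (N + 2) / 4"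
  define \<gamma> where "\<gamma> = (N + 1) / 4"
  have \<gamma>: "1/2 < \<gamma>" "1 / \<gamma> = 4 / (N + 1)" "2 - 1 / \<gamma> = 2 * (N - 1) / (N + 1)" "0 \<le> \<gamma>" "\<gamma> \<le> \<beta>" "0 \<le> \<beta>" "- \<beta> + 1/4 = - \<gamma>"
    using N by (auto simp: \<gamma>_def \<beta>_def field_simps)
  have CJ_eq: "CJ = (am * am) powr (1/2) + 16 * d * aq\<^sup>2"
    by (simp add: CJ_def J_const_def am_def d_def aq_def)
  have CK_eq: "CK = d * ((1 + 1 / (2 * \<gamma> - 1)) * ((2 * CJ) powr (1/\<gamma>) * (2 * a2) powr (2 - 1/\<gamma>)))"
    unfolding CK_def K_const_def Let_def d_def CJ_def a2_def \<gamma>_def N_def ..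
  note split = kato_op_split(2)[OF n V _ less_imp_le[OF \<epsilon>0] X[unfolded N_def], folded d_def N_def, folded \<beta>_def]
  have \<epsilon>: "0 < \<epsilon>" "\<epsilon> \<le> iteration_radius TYPE('n) 0" "\<epsilon> \<le> iteration_radius TYPE('n) (3/8)" "d * \<epsilon> * 8 * 2 powr \<beta> \<le> 1"
  proof -
    show "0 < \<epsilon>" "\<epsilon> \<le> iteration_radius TYPE('n) 0" "\<epsilon> \<le> iteration_radius TYPE('n) (3/8)"
      using \<epsilon>0 by (auto simp: \<epsilon>_def decay_radius_def)
    have "\<epsilon> \<le> 1 / (8 * 2 powr \<beta> * d)" by (simp add: \<epsilon>_def decay_radius_def \<beta>_def N_def d_def)
    then show "d * \<epsilon> * 8 * 2 powr \<beta> \<le> 1" using d by (simp add: field_simps)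
  qed
  have \<epsilon>\<gamma>: "d * \<epsilon> * 8 * 2 powr \<gamma> \<le> 1"
    by (rule order.trans[OF _ \<epsilon>(4)]) (use \<gamma> d \<epsilon>(1) in \<open>auto intro!: mult_left_mono\<close>)
  have c: "c > 0" "2 * a2 \<le> c" "2 * am \<le> c" "2 * CK \<le> c"
    using a2 am CK decay_const_pos(5)[OF n] by (auto simp: c_def final_const_def a2_def am_def CK_def)
  note [measurable] = measurable_uncurry[OF V]
  define j where "j = \<alpha>1 powr (1/2) * m powr (1/2) + \<alpha>q\<^sup>2"
  have j: "0 \<le> j" using nonneg by (simp add: j_def)
  define g where "g t = L_norm 2 (v t)" for t
  define G where "G t = L_norm 2 (V t)" for t
  have [measurable]: "G \<in> borel_measurable borel"
    using measurable_nn_norm[OF sigma_finite_lborel, of V borel 2] V unfolding G_def[abs_def] by simp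
  have Gg: "AE s in lborel. 0 < s \<longrightarrow> G s \<le> g s"
    using Vv
  proof eventually_elim
    fix s assume "0 < s \<longrightarrow> (AE x in lborel. V s x = v s x)"
    then show "0 < s \<longrightarrow> G s \<le> g s" unfolding G_def g_def using nn_norm_cong_AE[of "V s" "v s" lborel 2] by auto
  qed
  have Xe: "decays (2 * N) (ennreal e) (1/4) V" if "\<epsilon> \<le> e" for e
    using X
  proof eventually_elim
    fix s assume "0 < s \<longrightarrow> L_norm (2 * N) (V s) \<le> ennreal \<epsilon> * ennreal (s powr - (1/4))"
    then show "0 < s \<longrightarrow> L_norm (2 * N) (V s) \<le> ennreal e * ennreal (s powr - (1/4))"
      using that by (meson ennreal_leI mult_right_mono order.trans zero_le)
  qed
  have sub: "AE s in lborel. 0 < s \<longrightarrow> (AE x in lborel. V s x \<le> heat_majorant A s x + kato_op V V s x)"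
    using Vv
  proof eventually_elim
    fix s assume Vv: "0 < s \<longrightarrow> (AE x in lborel. V s x = v s x)"
    show "0 < s \<longrightarrow> (AE x in lborel. V s x \<le> heat_majorant A s x + kato_op V V s x)"
    proof
      assume s: "0 < s"
      from Vv s have "AE x in lborel. V s x = v s x" by simp
      with v0[OF s] show "AE x in lborel. V s x \<le> heat_majorant A s x + kato_op V V s x"
        by eventually_elim simp
    qed
  qed
  have hm: "Borel_field (heat_majorant A)" by measurable
  have g2: "g t \<le> ennreal (2 * a2 * \<alpha>)" if t: "0 < t" for t
  proof -
    have "L_norm 2 (v t) \<le> 2 * (ennreal a2 * ennreal \<alpha>) * ennreal (t powr - 0)"
    proof (rule kato_op_iteration[OF n _ _ V hm t Xe[OF \<epsilon>(2), unfolded N_def] sub _ v0[OF t]])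
      fix s :: real assume "0 < s"
      then show "L_norm 2 (heat_majorant A s) \<le> ennreal a2 * ennreal \<alpha> * ennreal (s powr - 0)"
        using heat_majorant_L2[of A s] by (simp add: \<alpha> a2_def)
    qed simp_all
    also have "\<dots> = ennreal (2 * a2 * \<alpha>)" using t a2 nonneg by (simp add: ennreal_mult mult_ac)
    finally show ?thesis by (simp add: g_def)
  qed
  have gq: "g t \<le> ennreal (2 * aq * \<alpha>q * t powr - (3/8))" if t: "0 < t" for t
  proof -
    have "L_norm 2 (v t) \<le> 2 * (ennreal aq * ennreal \<alpha>q) * ennreal (t powr - (3/8))"
    proof (rule kato_op_iteration[OF n _ _ V hm t Xe[OF \<epsilon>(3), unfolded N_def] sub _ v0[OF t]])
      fix s :: real assume "0 < s"
      then show "L_norm 2 (heat_majorant A s) \<le> ennreal aq * ennreal \<alpha>q * ennreal (s powr - (3/8))"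
        using heat_majorant_Lq_L2[of A s] n \<alpha>q by (simp add: aq_def N_def)
    qed simp_all
    also have "\<dots> = ennreal (2 * aq * \<alpha>q * t powr - (3/8))" using t aq nonneg by (simp add: ennreal_mult mult_ac)
    finally show ?thesis by (simp add: g_def)
  qed
  \<comment> \<open>\<open>h\<close> stands for either linear majorant with norm at most b, and q
    bounds the time integral of the squared norm. One inequality thus feeds both bootstraps: with q
    growing like t^(1/4) in \<open>gJ\<close>, with q constant in t in \<open>gK\<close>.\<close>
  have ineq: "g t \<le> ennreal (b + d * t powr - \<beta> * q) +
      late_part (d * \<epsilon>) G t"
    if t: "0 < t" and h: "h \<in> borel_measurable borel" "L_norm 2 h \<le> ennreal b" "AE x in lborel. v t x \<le> h x + kato_op V V t x"
      and q: "early_part G t \<le> ennreal q" and bq: "0 \<le> b" "0 \<le> q" for t h b q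
  proof -
    let ?Q = "late_part (d * \<epsilon>) G t"
    have [measurable]: "kato_op V V t \<in> borel_measurable borel"
      using measurable_uncurry[OF measurable_kato_op[OF V V], of "\<lambda>_. t" borel "\<lambda>x. x"] by simp
    have "g t \<le> L_norm 2 (\<lambda>x. h x + kato_op V V t x)" unfolding g_def by (rule nn_norm_mono_AE) (use h in auto)
    also have "\<dots> \<le> L_norm 2 h + L_norm 2 (kato_op V V t)"
      using h by (intro nn_norm_add sigma_finite_lborel) auto
    also have "\<dots> \<le> ennreal b + (ennreal (d * t powr - \<beta>) * ennreal q + ?Q)"
    proof (intro add_mono h(2))
      have "L_norm 2 (kato_op V V t) \<le> ennreal (d * t powr - \<beta>) * early_part G t + ?Q"
        unfolding G_def by (rule split[OF t])
      also have "\<dots> \<le> ennreal (d * t powr - \<beta>) * ennreal q + ?Q"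
        by (intro add_right_mono mult_left_mono q) auto
      finally show "L_norm 2 (kato_op V V t) \<le> \<dots>" .
    qed
    also have "\<dots> = ennreal (b + d * t powr - \<beta> * q) + ?Q"
      using bq d by (simp add: ennreal_mult[symmetric] ennreal_plus[symmetric] add.assoc[symmetric] del: ennreal_plus)
    finally show ?thesis .
  qed
  have gJ: "g t \<le> ennreal (2 * (CJ * j) * t powr - \<gamma>)" if "0 < t" for t
  proof (rule decay_bootstrap[OF Gg g2 _ _ \<gamma>(4) _ \<epsilon>\<gamma> _ that])
    show "0 \<le> 2 * a2 * \<alpha>" "0 \<le> CJ * j" "0 \<le> d * \<epsilon>" using a2 nonneg CJ j d \<epsilon> by auto
    fix t :: real assume t: "0 < t"
    let ?Q = "late_part (d * \<epsilon>) G t"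
    define p1 where "p1 = am * \<alpha>1 * t powr (- (N / 4))"
    define p2 where "p2 = am * m * t powr (- (N + 2) / 4)"
    have p: "0 \<le> p1" "0 \<le> p2" using am nonneg by (auto simp: p1_def p2_def)
    define q where "q = 16 * aq\<^sup>2 * \<alpha>q\<^sup>2 * t powr (1/4)"
    have q: "early_part G t \<le> ennreal q"
    proof -
      have "early_part G t \<le>
        (\<integral>\<^sup>+s. ennreal ((2 * aq * \<alpha>q)\<^sup>2) * (if 0 < s \<and> s < t then ennreal (s powr - (3/4)) else 0) \<partial>lborel)"
      proof (rule nn_integral_mono_AE, use Gg in eventually_elim)
        fix s assume Gs: "0 < s \<longrightarrow> G s \<le> g s"
        show "(if 0 < s \<and> s < t then (G s)\<^sup>2 else 0) \<le> ennreal ((2 * aq * \<alpha>q)\<^sup>2) * (if 0 < s \<and> s < t then ennreal (s powr - (3/4)) else 0)"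
        proof (cases "0 < s \<and> s < t")
          case True
          have "(G s)\<^sup>2 \<le> (ennreal (2 * aq * \<alpha>q * s powr - (3/8)))\<^sup>2"
            using Gs gq[of s] True by (intro power_mono) auto
          also have "\<dots> = ennreal ((2 * aq * \<alpha>q * s powr - (3/8))\<^sup>2)" using aq nonneg by (simp only: ennreal_power mult_nonneg_nonneg less_imp_le powr_ge_zero zero_le_numeral)
          also have "(2 * aq * \<alpha>q * s powr - (3/8))\<^sup>2 = (2 * aq * \<alpha>q)\<^sup>2 * s powr - (3/4)"
            by (simp add: power_mult_distrib power2_eq_square[of "s powr _"] powr_add[symmetric])
          also have "ennreal \<dots> = ennreal ((2 * aq * \<alpha>q)\<^sup>2) * ennreal (s powr - (3/4))" by (rule ennreal_mult) auto
          finally show ?thesis using True by simp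
        qed auto
      qed
      also have "\<dots> = ennreal ((2 * aq * \<alpha>q)\<^sup>2) * (\<integral>\<^sup>+s. (if 0 < s \<and> s < t then ennreal (s powr - (3/4)) else 0) \<partial>lborel)"
        by (rule nn_integral_cmult) measurable
      also have "\<dots> \<le> ennreal ((2 * aq * \<alpha>q)\<^sup>2) * ennreal (t powr (1 - 3/4) / (1 - 3/4))"
        using t by (intro mult_left_mono nn_integral_powr_from_0) auto
      also have "\<dots> = ennreal ((2 * aq * \<alpha>q)\<^sup>2 * (t powr (1 - 3/4) / (1 - 3/4)))" by (rule ennreal_mult[symmetric]) auto
      also have "(2 * aq * \<alpha>q)\<^sup>2 * (t powr (1 - 3/4) / (1 - 3/4)) = q"
        by (simp add: q_def power_mult_distrib)
      finally show ?thesis .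
    qed
    have q0: "0 \<le> q" by (simp add: q_def)
    have h1: "L_norm 2 (heat_majorant A t) \<le> ennreal p1"
      using heat_majorant_L1_L2[of A t] am nonneg t unfolding \<alpha>1 p1_def am_def N_def by (simp add: ennreal_mult)
    have h2: "L_norm 2 (heat_diff_majorant A t) \<le> ennreal p2"
      using heat_diff_majorant_L2[of A t] am nonneg t unfolding m p2_def am_def N_def by (simp add: ennreal_mult)
    \<comment> \<open>At each time the better of the two linear bounds is taken, so that the minimum
      can be replaced by the geometric mean.\<close>
    have "g t \<le> ennreal (min p1 p2 + d * t powr - \<beta> * q) + ?Q"
    proof (cases "p1 \<le> p2")
      case True
      then show ?thesis using ineq[OF t _ h1 v0[OF t] q p(1) q0] by simp
    next
      case False
      then show ?thesis using ineq[OF t _ h2 v1[OF t] q p(2) q0] by simp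
    qed
    also have "\<dots> \<le> ennreal (CJ * j * t powr - \<gamma>) + ?Q"
    proof (intro add_right_mono ennreal_leI)
      have "min p1 p2 \<le> p1 powr (1/2) * p2 powr (1/2)" by (rule min_le_sqrt_mult[OF p])
      also have "\<dots> = (am * am) powr (1/2) * (\<alpha>1 powr (1/2) * m powr (1/2)) * (t powr (- (N / 4) * (1/2)) * t powr (- (N + 2) / 4 * (1/2)))"
        using am nonneg unfolding p1_def p2_def by (simp add: powr_mult powr_powr mult_ac)
      also have "t powr (- (N / 4) * (1/2)) * t powr (- (N + 2) / 4 * (1/2)) = t powr - \<gamma>"
      proof -
        have "- (N / 4) * (1/2) + - (N + 2) / 4 * (1/2) = - \<gamma>" by (simp add: \<gamma>_def field_simps)
        then show ?thesis by (simp only: powr_add[symmetric])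
      qed
      finally have 1: "min p1 p2 \<le> (am * am) powr (1/2) * (\<alpha>1 powr (1/2) * m powr (1/2)) * t powr - \<gamma>" .
      have "d * t powr - \<beta> * q = 16 * d * aq\<^sup>2 * \<alpha>q\<^sup>2 * (t powr - \<beta> * t powr (1/4))" by (simp add: q_def mult_ac)
      also have "t powr - \<beta> * t powr (1/4) = t powr - \<gamma>" by (simp only: powr_add[symmetric] \<gamma>)
      finally have "min p1 p2 + d * t powr - \<beta> * q \<le>
        ((am * am) powr (1/2) * (\<alpha>1 powr (1/2) * m powr (1/2)) + 16 * d * aq\<^sup>2 * \<alpha>q\<^sup>2) * t powr - \<gamma>"
        using 1 by (simp only: distrib_right add_right_mono)
      also have "\<dots> \<le> CJ * j * t powr - \<gamma>"
      proof (rule mult_right_mono)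
        have "(am * am) powr (1/2) * (\<alpha>1 powr (1/2) * m powr (1/2)) + (16 * d * aq\<^sup>2) * \<alpha>q\<^sup>2 \<le> CJ * (\<alpha>1 powr (1/2) * m powr (1/2)) + CJ * \<alpha>q\<^sup>2"
          unfolding CJ_eq using d by (intro add_mono mult_right_mono) auto
        then show "(am * am) powr (1/2) * (\<alpha>1 powr (1/2) * m powr (1/2)) + 16 * d * aq\<^sup>2 * \<alpha>q\<^sup>2 \<le> CJ * j"
          by (simp add: j_def distrib_left)
      qed simp
      finally show "min p1 p2 + d * t powr - \<beta> * q \<le> CJ * j * t powr - \<gamma>" .
    qed
    finally show "g t \<le> ennreal (CJ * j * t powr - \<gamma>) + ?Q" .
  qed
  define K' where "K' = j powr (1/\<gamma>) * \<alpha> powr (2 - 1/\<gamma>)"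
  have K': "0 \<le> K'" by (simp add: K'_def)
  \<comment> \<open>The bound for the integral of G^2 over all positive times, obtained by inserting
    \<open>g2\<close> and \<open>gJ\<close> into \<open>nn_integral_square_min_le\<close>. Its
    dependence on the data is exactly K', the second summand of K.\<close>
  define q where "q = (1 + 1 / (2 * \<gamma> - 1)) * ((2 * (CJ * j)) powr (1/\<gamma>) * (2 * a2 * \<alpha>) powr (2 - 1/\<gamma>))"
  have q: "(\<integral>\<^sup>+s. (if 0 < s then (G s)\<^sup>2 else 0) \<partial>lborel) \<le> ennreal q"
    unfolding q_def
  proof (rule nn_integral_square_min_le)
    show "AE s in lborel. 0 < s \<longrightarrow> G s \<le> ennreal (2 * a2 * \<alpha>)"
      using Gg by eventually_elim (use g2 order.trans in blast)
    show "AE s in lborel. 0 < s \<longrightarrow> G s \<le> ennreal (2 * (CJ * j) * s powr - \<gamma>)"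
      using Gg by eventually_elim (use gJ order.trans in blast)
  qed (use a2 nonneg CJ j \<gamma> in auto)
  have dq: "d * q = CK * K'"
    using CJ j a2 nonneg unfolding q_def CK_eq K'_def mult.assoc[symmetric, of 2 CJ j]
    by (simp add: powr_mult mult_ac)
  have q0: "0 \<le> q" using \<gamma> by (simp add: q_def)
  have gK: "g t \<le> ennreal (2 * (am * m + CK * K') * t powr - \<beta>)"
  proof (rule decay_bootstrap[OF Gg g2 _ _ \<gamma>(6) _ \<epsilon>(4) _ t])
    show "0 \<le> 2 * a2 * \<alpha>" "0 \<le> am * m + CK * K'" "0 \<le> d * \<epsilon>" using a2 nonneg CK K' d \<epsilon> am by auto
    fix t :: real assume t: "0 < t"
    have "early_part G t \<le> (\<integral>\<^sup>+s. (if 0 < s then (G s)\<^sup>2 else 0) \<partial>lborel)"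
      by (intro nn_integral_mono) auto
    then have q': "early_part G t \<le> ennreal q" using q by (rule order.trans)
    have b: "- (N + 2) / 4 = - \<beta>" unfolding \<beta>_def by (rule minus_divide_left[symmetric])
    have h: "L_norm 2 (heat_diff_majorant A t) \<le> ennreal (am * m * t powr - \<beta>)"
      using heat_diff_majorant_L2[of A t] am nonneg t unfolding m b[unfolded N_def] by (simp add: ennreal_mult am_def)
    have hb: "0 \<le> am * m * t powr - \<beta>" using am nonneg by simp
    have "am * m * t powr - \<beta> + d * t powr - \<beta> * q = (am * m + CK * K') * t powr - \<beta>"
      unfolding dq[symmetric] by (simp add: algebra_simps)
    then show "g t \<le> ennreal ((am * m + CK * K') * t powr - \<beta>) +
      late_part (d * \<epsilon>) G t"
      using ineq[OF t _ h v1[OF t] q' hb q0] by simp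
  qed
  have "g t \<le> ennreal (c * \<alpha>)"
    using c nonneg by (intro order.trans[OF g2[OF t]] ennreal_leI mult_right_mono) auto
  moreover have "g t \<le> ennreal (c * (m + K') * t powr - \<beta>)"
  proof (intro order.trans[OF gK] ennreal_leI mult_right_mono)
    have "2 * am * m + 2 * CK * K' \<le> c * m + c * K'"
      using c nonneg K' by (intro add_mono mult_right_mono) auto
    then show "2 * (am * m + CK * K') \<le> c * (m + K')" by (simp add: distrib_left)
  qed simp
  moreover have "- (N + 2) / 4 = - \<beta>" unfolding \<beta>_def by (rule minus_divide_left[symmetric])
  ultimately show ?thesis
    unfolding g_def K'_def j_def \<gamma>(3) unfolding \<gamma>(2) by (simp only: simp_thms)
qed

section \<open>Application to Kato's solution\<close>

lemma norm_Borel_version: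
  fixes a :: "real ^ 'n::finite \<Rightarrow> real ^ 'n"
  assumes "a \<in> borel_measurable lebesgue"
  obtains A where "A \<in> borel_measurable borel" "AE y in lborel. A y = ennreal (norm (a y))"
proof -
  have "(\<lambda>y. ennreal (norm (a y))) \<in> borel_measurable lebesgue" using assms by measurable
  from completion_ex_borel_measurable[OF this] obtain A where "A \<in> borel_measurable lborel" "AE y in lborel. ennreal (norm (a y)) = A y"
    by blast
  then show ?thesis using that[of A] by (auto simp: eq_commute)
qed

text \<open>Pointwise |a|^q is at most |a| + |a|^r, by comparing |a| with 1. The lemma supplies
  finiteness of the L^2 and L^(4n/(3+2n)) norms of the data, so that the main estimate can be
  carried out with real numbers.\<close>

lemma Lq_norm_interpolation_finite:
  fixes a :: "'a::euclidean_space \<Rightarrow> 'b::euclidean_space"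
  assumes a: "a \<in> borel_measurable lebesgue" and fin: "Lq_norm 1 a < top" "Lq_norm r a < top" and q: "1 \<le> q" "q \<le> r"
  shows "Lq_norm q a < top"
proof -
  have f: "(\<integral>\<^sup>+x. ennreal (norm (a x) powr s) \<partial>lebesgue) < top" if "Lq_norm s a < top" for s
    using that unfolding Lq_norm_def by (simp add: less_top[symmetric])
  have le: "ennreal (norm (a x) powr q) \<le> ennreal (norm (a x) powr 1) + ennreal (norm (a x) powr r)" for x
  proof -
    have "norm (a x) powr q \<le> norm (a x) powr 1 + norm (a x) powr r"
    proof (cases "norm (a x) \<le> 1")
      case True
      then have "norm (a x) powr q \<le> norm (a x) powr 1" using q by (intro powr_mono') auto
      then show ?thesis by (simp add: add_increasing2)
    next
      case False
      then have "norm (a x) powr q \<le> norm (a x) powr r" using q by (intro powr_mono) auto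
      then show ?thesis by (simp add: add_increasing)
    qed
    then show ?thesis by (simp add: ennreal_plus[symmetric] ennreal_leI del: ennreal_plus)
  qed
  have [measurable]: "(\<lambda>x. ennreal (norm (a x) powr s)) \<in> borel_measurable lebesgue" for s using a by measurable
  have "(\<integral>\<^sup>+x. ennreal (norm (a x) powr q) \<partial>lebesgue) \<le> (\<integral>\<^sup>+x. ennreal (norm (a x) powr 1) + ennreal (norm (a x) powr r) \<partial>lebesgue)"
    by (intro nn_integral_mono le)
  also have "\<dots> = (\<integral>\<^sup>+x. ennreal (norm (a x) powr 1) \<partial>lebesgue) + (\<integral>\<^sup>+x. ennreal (norm (a x) powr r) \<partial>lebesgue)"
    by (rule nn_integral_add) measurable
  also have "\<dots> < top" using f[OF fin(1)] f[OF fin(2)] by simp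
  finally show ?thesis unfolding Lq_norm_def less_top[symmetric] by (simp only: ennreal_powr_eq_top_iff not_False_eq_True)
qed

theorem mainTheorem2:
  fixes C :: real
  assumes "CARD('n::finite) \<ge> 2"
    and "heat_X_bound TYPE('n) C"
  shows "\<exists>\<delta>>0. \<exists>c>0. \<forall>(a :: real ^ 'n \<Rightarrow> real ^ 'n) u.
    a \<in> Lq_sigma (real CARD('n)) \<and>
    (\<integral>\<^sup>+ x. ennreal ((1 + norm x) * norm (a x)) \<partial>lebesgue) < top \<and>
    Lq_norm (real CARD('n)) a \<le> ennreal \<delta> \<and>
    kato_solution C a u \<longrightarrow>
    (\<forall>t>0. Lq_norm 2 (u t)
       \<le> ennreal c * min (Lq_norm 2 a) (K a * ennreal (t powr (- (real CARD('n) + 2) / 4))))"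
proof -
  note n = assms(1)
  define N where "N = real CARD('n)"
  have N: "N \<ge> 2" using n by (simp add: N_def)
  define \<epsilon> where "\<epsilon> = decay_radius TYPE('n)"
  define c where "c = final_const TYPE('n)"
  have \<epsilon>: "0 < \<epsilon>" and c: "0 < c" using decay_const_pos[OF n] by (simp_all add: \<epsilon>_def c_def)
  \<comment> \<open>The factor of \<open>mild_solution_majorant\<close>: the decay estimate is
    applied to k |u| with the data k |a|.\<close>
  define k where "k = N ^ 3"
  have k: "k \<ge> 1" using N by (simp add: k_def)
  \<comment> \<open>Makes the norm k * 2 C \<delta> of k |u| at most \<epsilon>. The absolute value
    and the added 1 keep the quotient positive for every real C.\<close>
  define \<delta> where "\<delta> = \<epsilon> / (k * (2 * \<bar>C\<bar> + 1))"
  have \<delta>: "\<delta> > 0" using \<epsilon> k by (auto simp: \<delta>_def intro!: divide_pos_pos mult_pos_pos)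
  define p where "p = 4 / (N + 1)"
  define r where "r = 2 * (N - 1) / (N + 1)"
  have pr: "0 < p" "0 < r" using N by (auto simp: p_def r_def)
  \<comment> \<open>The two summands undo the scaling of the data by k: the L^2 norm and the first
    moment scale like k, and the product in K acquires at most the factor (k^2)^p k^r.\<close>
  define c' where "c' = c * k + c * (k\<^sup>2 powr p * k powr r)"
  have c': "c' > 0" "c * k \<le> c'" "c * (k\<^sup>2 powr p * k powr r) \<le> c'"
    using c k by (auto simp: c'_def intro!: add_pos_nonneg)
  show ?thesis
  proof (rule exI[of _ \<delta>], rule conjI[OF \<delta>], rule exI[of _ c'], rule conjI[OF c'(1)], intro allI impI)
    fix a :: "real ^ 'n \<Rightarrow> real ^ 'n" and u and t :: real
    assume "a \<in> Lq_sigma (real CARD('n)) \<and> (\<integral>\<^sup>+ x. ennreal ((1 + norm x) * norm (a x)) \<partial>lebesgue) < top \<and>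
      Lq_norm (real CARD('n)) a \<le> ennreal \<delta> \<and> kato_solution C a u"
    then have a: "a \<in> Lq_sigma N" and mom: "(\<integral>\<^sup>+ x. ennreal ((1 + norm x) * norm (a x)) \<partial>lebesgue) < top"
      and a\<delta>: "Lq_norm N a \<le> ennreal \<delta>" and kato: "kato_solution C a u"
      by (auto simp: N_def)
    assume t: "0 < t"
    have am: "a \<in> borel_measurable lebesgue" using a by (simp add: Lq_sigma_def Lq_def)
    obtain A0 where [measurable]: "A0 \<in> borel_measurable borel" and A0: "AE y in lborel. A0 y = ennreal (norm (a y))"
      by (rule norm_Borel_version[OF am])
    have norm_a: "Lq_norm s a = L_norm s A0" for s
      unfolding Lq_norm_eq_nn_norm by (rule nn_norm_cong_AE, use A0 in eventually_elim) simp
    have m_a: "first_moment a = (\<integral>\<^sup>+y. ennreal (norm y) * A0 y \<partial>lborel)"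
      unfolding first_moment_def nn_integral_completion
      by (rule nn_integral_cong_AE, use A0 in eventually_elim) (simp add: ennreal_mult)
    have "Lq_norm 1 a \<le> (\<integral>\<^sup>+ x. ennreal ((1 + norm x) * norm (a x)) \<partial>lebesgue)"
      unfolding Lq_norm_def by (simp, intro nn_integral_mono ennreal_leI) (simp add: distrib_right)
    then have fin1: "Lq_norm 1 a < top" using mom by (rule le_less_trans)
    have "first_moment a \<le> (\<integral>\<^sup>+ x. ennreal ((1 + norm x) * norm (a x)) \<partial>lebesgue)"
      unfolding first_moment_def by (intro nn_integral_mono ennreal_leI) (simp add: distrib_right)
    then have finm: "first_moment a < top" using mom by (rule le_less_trans)
    have finN: "Lq_norm N a < top" using a\<delta> by (rule le_less_trans) simp
    have fin2: "Lq_norm 2 a < top" by (rule Lq_norm_interpolation_finite[OF am fin1 finN]) (use N in auto)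
    have finq: "Lq_norm (4 * N / (3 + 2 * N)) a < top"
      by (rule Lq_norm_interpolation_finite[OF am fin1 fin2]) (use N in \<open>auto simp: field_simps\<close>)
    obtain \<alpha> \<alpha>1 \<alpha>q m where
      \<alpha>: "Lq_norm 2 a = ennreal \<alpha>" "0 \<le> \<alpha>" and \<alpha>1: "Lq_norm 1 a = ennreal \<alpha>1" "0 \<le> \<alpha>1" and
      \<alpha>q: "Lq_norm (4 * N / (3 + 2 * N)) a = ennreal \<alpha>q" "0 \<le> \<alpha>q" and m: "first_moment a = ennreal m" "0 \<le> m"
      using fin1 finm fin2 finq by (metis enn2real_nonneg ennreal_enn2real)
    define j where "j = \<alpha>1 powr (1/2) * m powr (1/2) + \<alpha>q\<^sup>2"
    have j: "0 \<le> j" using \<alpha>1 m by (simp add: j_def)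
    have J: "J a = ennreal j"
      unfolding J_def N_def[symmetric] \<alpha>1(1) \<alpha>q(1) m(1) j_def
      using \<alpha>1 \<alpha>q m by (simp add: ennreal_mult[symmetric] ennreal_power ennreal_plus[symmetric] del: ennreal_plus)
    have K: "K a = ennreal (m + j powr p * \<alpha> powr r)"
      unfolding K_def J \<alpha>(1) m(1) N_def[symmetric] p_def[symmetric] r_def[symmetric]
      using j m \<alpha> by (simp add: ennreal_mult[symmetric] ennreal_plus[symmetric] del: ennreal_plus)
    have int: "integrable lebesgue a"
      using am fin1 unfolding Lq_norm_def by (simp add: integrable_iff_bounded)
    have mean: "(\<integral>y. a y \<partial>lebesgue) = 0"
      by (rule integral_Lq_sigma_eq_0[OF n a[unfolded N_def] int])
    define A where "A y = ennreal k * A0 y" for y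
    have [measurable]: "A \<in> borel_measurable borel" unfolding A_def by measurable
    have mild: "mild_solution a u" and X: "X_norm u \<le> 2 * ennreal C * Lq_norm N a"
      using kato by (simp_all add: kato_solution_def N_def)
    obtain V where V: "Borel_field V"
      and Vu: "AE s in lborel. 0 < s \<longrightarrow> (AE x in lborel. V s x = ennreal k * ennreal (norm (u s x)))"
      and ineq: "\<And>t. 0 < t \<Longrightarrow> AE x in lborel. ennreal k * ennreal (norm (u t x))
       \<le> ennreal k * ennreal (norm (heat_semigroup t a x)) + kato_op V V t x"
      unfolding k_def N_def by (rule mild_solution_majorant[OF mild]) blast
    have A0': "AE y in lborel. ennreal (norm (a y)) = A0 y" using A0 by eventually_elim simp
    have hA: "ennreal k * heat_majorant A0 s x = heat_majorant A s x" for s x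
      unfolding heat_majorant_def A_def by (subst nn_integral_cmult[symmetric]) (auto simp: mult_ac)
    have hdA: "ennreal k * heat_diff_majorant A0 s x = heat_diff_majorant A s x" for s x
      unfolding heat_diff_majorant_def A_def by (subst nn_integral_cmult[symmetric]) (auto simp: mult_ac)
    have ineq': "AE x in lborel. ennreal k * ennreal (norm (u s x)) \<le> h s x + kato_op V V s x"
      if "0 < s" "\<And>x. ennreal k * ennreal (norm (heat_semigroup s a x)) \<le> h s x" for s h
      using ineq[OF that(1)] by eventually_elim (meson that(2) add_right_mono order.trans)
    have ineq0: "AE x in lborel. ennreal k * ennreal (norm (u s x)) \<le> heat_majorant A s x + kato_op V V s x" if "0 < s" for s
      by (rule ineq'[OF that]) (simp only: hA[symmetric] mult_left_mono heat_semigroup_le_majorant[OF A0'] zero_le)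
    have ineq1: "AE x in lborel. ennreal k * ennreal (norm (u s x)) \<le> heat_diff_majorant A s x + kato_op V V s x" if "0 < s" for s
      by (rule ineq'[OF that]) (simp only: hdA[symmetric] mult_left_mono heat_semigroup_le_diff_majorant[OF A0' int mean that] zero_le)
    have Xe: "decays (2 * N) (ennreal \<epsilon>) (1/4) V"
    proof -
      have "2 * ennreal C * Lq_norm N a \<le> 2 * ennreal \<bar>C\<bar> * ennreal \<delta>"
        by (intro mult_mono a\<delta> ennreal_leI) auto
      also have "\<dots> = ennreal (2 * \<bar>C\<bar> * \<delta>)" using \<delta> by (simp add: ennreal_mult)
      also have "\<dots> \<le> ennreal (\<epsilon> / k)"
      proof (rule ennreal_leI)
        have "\<epsilon> / k = (2 * \<bar>C\<bar> + 1) * \<delta>" using k by (simp add: \<delta>_def)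
        then show "2 * \<bar>C\<bar> * \<delta> \<le> \<epsilon> / k" using \<delta> by (simp add: distrib_right)
      qed
      finally have "X_norm u \<le> ennreal (\<epsilon> / k)" using X by (rule order.trans[rotated])
      from X_norm_AE[OF this] Vu show ?thesis
      proof eventually_elim
        fix s assume s: "0 < s \<longrightarrow> Lq_norm (2 * real CARD('n)) (u s) \<le> ennreal (\<epsilon> / k) * ennreal (s powr - (1/4))"
          and Vu: "0 < s \<longrightarrow> (AE x in lborel. V s x = ennreal k * ennreal (norm (u s x)))"
        show "0 < s \<longrightarrow> L_norm (2 * N) (V s) \<le> ennreal \<epsilon> * ennreal (s powr - (1/4))"
        proof
          assume s0: "0 < s"
          have "ennreal (1 / k) * ennreal k = 1" using k by (simp add: ennreal_mult[symmetric])
          then have "AE x in lborel. ennreal (norm (u s x)) = ennreal (1 / k) * V s x"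
            using Vu s0 by (auto simp: mult.assoc[symmetric])
          then have "Lq_norm (2 * N) (u s) = L_norm (2 * N) (\<lambda>x. ennreal (1 / k) * V s x)"
            unfolding Lq_norm_eq_nn_norm by (rule nn_norm_cong_AE)
          also have "\<dots> = ennreal (1 / k) * L_norm (2 * N) (V s)"
            using N measurable_uncurry[OF V, of "\<lambda>_. s" borel "\<lambda>x. x"] by (intro nn_norm_cmult) auto
          finally have "ennreal k * Lq_norm (2 * N) (u s) = L_norm (2 * N) (V s)"
            using \<open>ennreal (1 / k) * ennreal k = 1\<close> by (simp add: mult.assoc[symmetric] mult.commute[of "ennreal k"])
          moreover have "ennreal k * Lq_norm (2 * N) (u s) \<le> ennreal k * (ennreal (\<epsilon> / k) * ennreal (s powr - (1/4)))"
            using s s0 by (intro mult_left_mono) (auto simp: N_def)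
          moreover have "ennreal k * (ennreal (\<epsilon> / k) * ennreal (s powr - (1/4))) = ennreal \<epsilon> * ennreal (s powr - (1/4))"
            using k \<epsilon> by (simp add: ennreal_mult[symmetric])
          ultimately show "L_norm (2 * N) (V s) \<le> ennreal \<epsilon> * ennreal (s powr - (1/4))" by simp
        qed
      qed
    qed
    have nA: "L_norm s A = ennreal k * Lq_norm s a" if "0 < s" for s
      unfolding norm_a A_def using that by (intro nn_norm_cmult) auto
    have mA: "(\<integral>\<^sup>+y. ennreal (norm y) * A y \<partial>lborel) = ennreal (k * m)"
    proof -
      have "(\<integral>\<^sup>+y. ennreal (norm y) * A y \<partial>lborel) = ennreal k * first_moment a"
        unfolding m_a A_def by (subst nn_integral_cmult[symmetric]) (auto simp: mult_ac)
      then show ?thesis using m k by (simp add: ennreal_mult)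
    qed
    have q0: "0 < 4 * N / (3 + 2 * N)" using N by simp
    define j' where "j' = (k * \<alpha>1) powr (1/2) * (k * m) powr (1/2) + (k * \<alpha>q)\<^sup>2"
    have bound: "L_norm 2 (\<lambda>x. ennreal k * ennreal (norm (u t x))) \<le> ennreal (c * (k * \<alpha>)) \<and>
      L_norm 2 (\<lambda>x. ennreal k * ennreal (norm (u t x))) \<le> ennreal (c * (k * m + j' powr p * (k * \<alpha>) powr r) * t powr (- (N + 2) / 4))"
      unfolding j'_def p_def r_def N_def c_def
    proof (rule majorant_decay[OF n _ V Vu Xe[unfolded N_def \<epsilon>_def] ineq0 ineq1 _ _ _ mA _ _ _ _ t])
      show "L_norm 2 A = ennreal (k * \<alpha>)" "L_norm 1 A = ennreal (k * \<alpha>1)"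
        "L_norm (4 * real CARD('n) / (3 + 2 * real CARD('n))) A = ennreal (k * \<alpha>q)"
        using nA[of 2] nA[of 1] nA[OF q0] N_def \<alpha> \<alpha>1 \<alpha>q k by (simp_all add: ennreal_mult)
      show "0 \<le> k * \<alpha>" "0 \<le> k * \<alpha>1" "0 \<le> k * \<alpha>q" "0 \<le> k * m" using \<alpha> \<alpha>1 \<alpha>q m k by auto
    qed auto
    have u_le: "Lq_norm 2 (u t) \<le> L_norm 2 (\<lambda>x. ennreal k * ennreal (norm (u t x)))"
      unfolding Lq_norm_eq_nn_norm
    proof (rule nn_norm_mono)
      fix x
      have "1 * ennreal (norm (u t x)) \<le> ennreal k * ennreal (norm (u t x))"
        using k by (intro mult_right_mono) (auto simp flip: ennreal_1 intro!: ennreal_leI)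
      then show "ennreal (norm (u t x)) \<le> ennreal k * ennreal (norm (u t x))" by simp
    qed simp
    have b1: "Lq_norm 2 (u t) \<le> ennreal c' * Lq_norm 2 a"
    proof -
      have "ennreal (c * (k * \<alpha>)) \<le> ennreal (c' * \<alpha>)"
        using c'(2) \<alpha>(2) by (intro ennreal_leI) (simp add: mult.assoc[symmetric] mult_right_mono)
      then have "Lq_norm 2 (u t) \<le> ennreal (c' * \<alpha>)" using u_le bound by (meson order.trans)
      then show ?thesis using c'(1) \<alpha> by (simp add: ennreal_mult)
    qed
    have b2: "Lq_norm 2 (u t) \<le> ennreal c' * (K a * ennreal (t powr (- (N + 2) / 4)))"
    proof -
      have "j' = (k powr (1/2) * k powr (1/2)) * (\<alpha>1 powr (1/2) * m powr (1/2)) + k\<^sup>2 * \<alpha>q\<^sup>2"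
        unfolding j'_def using k \<alpha>1 m by (simp add: powr_mult power_mult_distrib mult_ac)
      also have "k powr (1/2) * k powr (1/2) = k" using k by (simp add: powr_add[symmetric])
      \<comment> \<open>J is not homogeneous: its first summand scales like k and its second like
        k^2. As k is at least 1, k^2 serves for both.\<close>
      also have "k * (\<alpha>1 powr (1/2) * m powr (1/2)) + k\<^sup>2 * \<alpha>q\<^sup>2 \<le> k\<^sup>2 * (\<alpha>1 powr (1/2) * m powr (1/2)) + k\<^sup>2 * \<alpha>q\<^sup>2"
        using k by (intro add_right_mono mult_right_mono) (auto simp: power2_eq_square)
      finally have "j' \<le> k\<^sup>2 * j" by (simp add: j_def distrib_left)
      moreover have "0 \<le> j'" unfolding j'_def by simp
      ultimately have "j' powr p \<le> (k\<^sup>2 * j) powr p" using pr by (intro powr_mono2) auto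
      also have "\<dots> = k\<^sup>2 powr p * j powr p" using j by (simp add: powr_mult)
      finally have "j' powr p * (k * \<alpha>) powr r \<le> (k\<^sup>2 powr p * j powr p) * (k * \<alpha>) powr r"
        by (rule mult_right_mono) simp
      also have "\<dots> = (k\<^sup>2 powr p * k powr r) * (j powr p * \<alpha> powr r)"
        using k \<alpha> by (simp add: powr_mult mult_ac)
      finally have "c * (k * m + j' powr p * (k * \<alpha>) powr r) \<le> (c * k) * m + (c * (k\<^sup>2 powr p * k powr r)) * (j powr p * \<alpha> powr r)"
        using c by (simp add: distrib_left mult.assoc mult_left_mono)
      also have "\<dots> \<le> c' * m + c' * (j powr p * \<alpha> powr r)"
        using c' m by (intro add_mono mult_right_mono) auto
      finally have "c * (k * m + j' powr p * (k * \<alpha>) powr r) * t powr (- (N + 2) / 4) \<le> c' * (m + j powr p * \<alpha> powr r) * t powr (- (N + 2) / 4)"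
        by (intro mult_right_mono) (simp_all add: distrib_left)
      then have "Lq_norm 2 (u t) \<le> ennreal (c' * (m + j powr p * \<alpha> powr r) * t powr (- (N + 2) / 4))"
        using u_le bound by (meson ennreal_leI order.trans)
      also have "\<dots> = ennreal c' * (K a * ennreal (t powr (- (N + 2) / 4)))"
      proof -
        have "0 \<le> m + j powr p * \<alpha> powr r" using m by simp
        then show ?thesis using c'(1) unfolding K
          by (simp only: ennreal_mult[symmetric] mult.assoc less_imp_le powr_ge_zero mult_nonneg_nonneg)
      qed
      finally show ?thesis .
    qed
    show "Lq_norm 2 (u t) \<le> ennreal c' * min (Lq_norm 2 a) (K a * ennreal (t powr (- (real CARD('n) + 2) / 4)))"
      using b1 b2 by (simp add: min_def N_def)
  qed
qed

end
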